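(* Let $(H,R)$ be a quasitriangular bialgebra over a field $\mathbb F$ which is cylindrical with twist pair $(\psi,J)$ and universal K-matrix $K\in H^\times$. (i) With $R^\psi:=(\psi\otimes\mathrm{id})(R)$ and $R^{\psi\psi}:=(\psi\otimes\psi)(R)$, $K$ satisfies the generalized reflection equation $$(K\otimes1)\cdot(R^\psi)_{21}\cdot(1\otimes K)\cdot R=R^{\psi\psi}_{21}\cdot(1\otimes K)\cdot R^\psi\cdot(K\otimes1).$$ (ii) Let $B\subseteq H$ be a cylindrically invariant right coideal subalgebra. Then there is a morphism of groups $\mu^n_{R,K}:\mathcal B_n^{\mathrm{cyl}}\to\mathrm{Aut}_B(H^{\otimes n})$ given by $$\mu^n_{R,K}(S_0)=(\psi^{-1}\otimes\mathrm{id}_H^{\otimes(n-1)})\circ(K\otimes1^{\otimes(n-1)}),\qquad \mu^n_{R,K}(S_i)=(i\ i{+}1)\circ R_{i,i+1}\quad(1\le i\le n-1).$$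
   Context: A quasitriangular bialgebra $(H,R)$ is a bialgebra $H$ (coproduct $\Delta$, counit $\varepsilon$) with $R\in(H\otimes H)^\times$ such that $R\Delta(x)=\Delta^{op}(x)R$ for all $x\in H$, $(\Delta\otimes\mathrm{id})(R)=R_{13}R_{23}$, $(\mathrm{id}\otimes\Delta)(R)=R_{13}R_{12}$. The subscript $21$ denotes exchanging tensor factors. A Drinfeld twist of $H$ is $J\in(H\otimes H)^\times$ with $(\varepsilon\otimes\mathrm{id})(J)=1=(\mathrm{id}\otimes\varepsilon)(J)$ and $(J\otimes1)(\Delta\otimes\mathrm{id})(J)=(1\otimes J)(\mathrm{id}\otimes\Delta)(J)$. A twist pair $(\psi,J)$ for $(H,R)$ is an algebra automorphism $\psi:H\to H$ and a Drinfeld twist $J$ such that $(\psi\otimes\psi)\circ\Delta^{op}\circ\psi^{-1}=\mathrm{Ad}(J)\circ\Delta$, $\varepsilon\circ\psi^{-1}=\varepsilon$ and $(\psi\otimes\psi)(R_{21})=J_{21}\cdot R\cdot J^{-1}$ ($\mathrm{Ad}$ = conjugation). $(H,R)$ is cylindrical with twist pair $(\psi,J)$ and universal K-matrix $K\in H^\times$ if $\Delta(K)=J^{-1}\cdot(1\otimes K)\cdot(\psi\otimes\mathrm{id})(R)\cdot(K\otimes1)$. A subalgebra $B\subseteq H$ is cylindrically invariant if $Kb=\psi(b)K$ for all $b\in B$; it is a right coideal if $\Delta(B)\subseteq B\otimes H$. $\mathcal B_n^{\mathrm{cyl}}$ (the Artin-Tits group of type $\mathsf B_n$) is generated by $S_0,S_1,\dots,S_{n-1}$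 with relations $S_iS_{i+1}S_i=S_{i+1}S_iS_{i+1}$ for $1\le i\le n-2$, $S_iS_j=S_jS_i$ for $|i-j|>1$ ($0\le i,j\le n-1$), and $S_0S_1S_0S_1=S_1S_0S_1S_0$. $H$ acts on $H^{\otimes n}$ by left multiplication by $\Delta^{(n)}(x)$, where $\Delta^{(1)}=\mathrm{id}$, $\Delta^{(n)}=(\Delta\otimes\mathrm{id}^{\otimes(n-2)})\circ\Delta^{(n-1)}$, and $\mathrm{Aut}_B(H^{\otimes n})$ is the group of $\mathbb F$-linear automorphisms commuting with the action of $B$. Elements $K\otimes1^{\otimes(n-1)}$ and $R_{i,i+1}$ stand for left multiplication operators; $(i\ i{+}1)$ is the transposition of the corresponding tensor factors. *)

theory Defs
  imports
    Complex_Main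
    "HOL-Library.Function_Algebras"
    "HOL-Combinatorics.Permutations"
    "HOL-Algebra.Bij"
begin

section \<open>Tensor powers of a vector space\<close>

text \<open>
  A map on lists is multilinear if it is linear in every entry, for every length of the list.
\<close>

definition multilinear ::
  "('f::field \<Rightarrow> 'h::ab_group_add \<Rightarrow> 'h) \<Rightarrow> ('f \<Rightarrow> 'v::ab_group_add \<Rightarrow> 'v) \<Rightarrow> ('h list \<Rightarrow> 'v) \<Rightarrow> bool"
  where "multilinear s s' m \<longleftrightarrow>
    (\<forall>us vs x y. m (us @ (x + y) # vs) = m (us @ x # vs) + m (us @ y # vs)) \<and>
    (\<forall>us vs c x. m (us @ s c x # vs) = s' c (m (us @ x # vs)))"

text \<open>
  Over a field, the tensor power of \<open>H\<close> embeds into the dual of the space of multilinear forms: the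
  pure tensor of \<open>x\<^sub>1, \<dots>, x\<^sub>n\<close> is evaluation of forms at \<open>[x\<^sub>1, \<dots>, x\<^sub>n]\<close>, and the \<open>n\<close>-th tensor power
  is the span of the pure tensors of length \<open>n\<close>. In this way the tensor powers of all degrees live in
  one type, associativity of the tensor product is strict, and the zeroth tensor power is the field,
  spanned by \<open>pure s []\<close>. The universal property is theorem \<open>tensor_universal\<close> below; for a
  fixed degree \<open>n\<close>, apply it to the extension by 0 of a map that is multilinear on lists of length \<open>n\<close>.
\<close>

type_synonym ('f, 'h) tensor = "('h list \<Rightarrow> 'f) \<Rightarrow> 'f"

definition tscale :: "'f::field \<Rightarrow> ('f, 'h) tensor \<Rightarrow> ('f, 'h) tensor"
  where "tscale c t = (\<lambda>\<phi>. c * t \<phi>)"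

definition pure :: "('f::field \<Rightarrow> 'h::ab_group_add \<Rightarrow> 'h) \<Rightarrow> 'h list \<Rightarrow> ('f, 'h) tensor"
  where "pure s xs = (\<lambda>\<phi>. if multilinear s (*) \<phi> then \<phi> xs else 0)"

definition tpow :: "('f::field \<Rightarrow> 'h::ab_group_add \<Rightarrow> 'h) \<Rightarrow> nat \<Rightarrow> ('f, 'h) tensor set"
  where "tpow s n = module.span tscale (pure s ` {xs. length xs = n})"

text \<open>
  The linear extension of a multilinear map \<open>m\<close>, see lemma \<open>tlift_pure\<close>. The guards on the length in
  the definitions below make the maps passed to \<open>tlift\<close> multilinear in all degrees.
\<close>

definition tlift :: "('h list \<Rightarrow> ('f::field, 'h) tensor) \<Rightarrow> ('f, 'h) tensor \<Rightarrow> ('f, 'h) tensor"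
  where "tlift m t = (\<lambda>\<phi>. t (\<lambda>xs. m xs \<phi>))"

text \<open>The tensor product of tensors: the product of the tensor algebra.\<close>

definition tprod ::
  "('f::field \<Rightarrow> 'h::ab_group_add \<Rightarrow> 'h) \<Rightarrow> ('f, 'h) tensor \<Rightarrow> ('f, 'h) tensor \<Rightarrow> ('f, 'h) tensor"
  where "tprod s t u = tlift (\<lambda>xs. tlift (\<lambda>ys. pure s (xs @ ys)) u) t"

text \<open>The factorwise product, which makes each tensor power of an algebra an algebra.\<close>

definition tmult ::
  "('f::field \<Rightarrow> 'h::ring_1 \<Rightarrow> 'h) \<Rightarrow> ('f, 'h) tensor \<Rightarrow> ('f, 'h) tensor \<Rightarrow> ('f, 'h) tensor"
  where "tmult s t u =
    tlift (\<lambda>xs. tlift (\<lambda>ys. if length xs = length ys then pure s (map2 (*) xs ys) else 0) u) t"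

abbreviation tmult_infix  (\<open>(_ \<cdot>\<^bsub>_\<^esub>/ _)\<close> [70, 0, 71] 70)
  where "t \<cdot>\<^bsub>s\<^esub> u \<equiv> tmult s t u"

definition tpow_monoid :: "('f::field \<Rightarrow> 'h::ring_1 \<Rightarrow> 'h) \<Rightarrow> nat \<Rightarrow> ('f, 'h) tensor monoid"
  where "tpow_monoid s n = \<lparr>carrier = tpow s n, mult = tmult s, one = pure s (replicate n 1)\<rparr>"

text \<open>
  \<open>tmap s [f\<^sub>1, \<dots>, f\<^sub>k]\<close> is the map \<open>f\<^sub>1 \<otimes> \<dots> \<otimes> f\<^sub>k\<close> on the \<open>k\<close>-th tensor power, for linear maps \<open>f\<^sub>i\<close>
  from \<open>H\<close> to tensors; the degrees of the values of the \<open>f\<^sub>i\<close> add up. Maps \<open>H \<rightarrow> H\<close> enter by way of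
  \<open>emb\<close> (the identity of \<open>H\<close> is just \<open>emb s\<close>), maps \<open>H \<rightarrow> \<bbbF>\<close> by way of \<open>scal\<close>.
\<close>

abbreviation emb :: "('f::field \<Rightarrow> 'h::ab_group_add \<Rightarrow> 'h) \<Rightarrow> 'h \<Rightarrow> ('f, 'h) tensor"
  where "emb s x \<equiv> pure s [x]"

abbreviation scal :: "('f::field \<Rightarrow> 'h::ab_group_add \<Rightarrow> 'h) \<Rightarrow> 'f \<Rightarrow> ('f, 'h) tensor"
  where "scal s c \<equiv> tscale c (pure s [])"

definition tmap ::
  "('f::field \<Rightarrow> 'h::ab_group_add \<Rightarrow> 'h) \<Rightarrow> ('h \<Rightarrow> ('f, 'h) tensor) list \<Rightarrow> ('f, 'h) tensor \<Rightarrow> ('f, 'h) tensor"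
  where "tmap s fs = tlift (\<lambda>xs.
    if length xs = length fs then foldr (tprod s) (map2 (\<lambda>f x. f x) fs xs) (pure s []) else 0)"

definition tperm ::
  "('f::field \<Rightarrow> 'h::ab_group_add \<Rightarrow> 'h) \<Rightarrow> nat \<Rightarrow> (nat \<Rightarrow> nat) \<Rightarrow> ('f, 'h) tensor \<Rightarrow> ('f, 'h) tensor"
  where "tperm s n p = tlift (\<lambda>xs. if length xs = n then pure s (permute_list p xs) else 0)"

text \<open>
  The transposition of the \<open>i\<close>-th and \<open>j\<close>-th tensor factors and the element \<open>R\<^sub>i\<^sub>j\<close> of the \<open>n\<close>-th
  tensor power. Tensor factors are counted from 1, list positions from 0.
\<close>

definition tswap ::
  "('f::field \<Rightarrow> 'h::ab_group_add \<Rightarrow> 'h) \<Rightarrow> nat \<Rightarrow> nat \<Rightarrow> nat \<Rightarrow> ('f, 'h) tensor \<Rightarrow> ('f, 'h) tensor"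
  where "tswap s n i j = tperm s n (transpose (i - 1) (j - 1))"

abbreviation flip :: "('f::field \<Rightarrow> 'h::ab_group_add \<Rightarrow> 'h) \<Rightarrow> ('f, 'h) tensor \<Rightarrow> ('f, 'h) tensor"
  where "flip s \<equiv> tswap s 2 1 2"

definition leg ::
  "('f::field \<Rightarrow> 'h::ring_1 \<Rightarrow> 'h) \<Rightarrow> nat \<Rightarrow> nat \<Rightarrow> nat \<Rightarrow> ('f, 'h) tensor \<Rightarrow> ('f, 'h) tensor"
  where "leg s n i j = tlift (\<lambda>xs.
    if length xs = 2 then pure s ((replicate n 1)[i - 1 := xs ! 0, j - 1 := xs ! 1]) else 0)"


subsection \<open>The universal property, and the maps above on pure tensors\<close>

lemma tlift_add: "tlift m (t + u) = tlift m t + tlift m u"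
  by (simp add: tlift_def fun_eq_iff)

lemma tlift_scale: "tlift m (tscale c t) = tscale c (tlift m t)"
  by (simp add: tlift_def tscale_def fun_eq_iff)

lemma vector_space_tscale: "vector_space (tscale :: 'f::field \<Rightarrow> ('f, 'h) tensor \<Rightarrow> _)"
  by unfold_locales (auto simp: tscale_def fun_eq_iff algebra_simps)

lemma multilinear_pure: "multilinear s tscale (pure s)"
  by (auto simp: multilinear_def pure_def tscale_def fun_eq_iff)

lemma pure_add: "pure s (us @ (x + y) # vs) = pure s (us @ x # vs) + pure s (us @ y # vs)"
  and pure_scale: "pure s (us @ s c x # vs) = tscale c (pure s (us @ x # vs))"
  using multilinear_pure[of s] unfolding multilinear_def by blast+

lemma tscale_zero: "tscale c 0 = 0"
  by (simp add: tscale_def fun_eq_iff)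

lemma tlift_pure:
  assumes "multilinear s tscale m"
  shows "tlift m (pure s xs) = m xs"
  using assms by (auto simp: tlift_def pure_def multilinear_def tscale_def fun_eq_iff)

theorem tensor_universal:
  fixes s :: "'f::field \<Rightarrow> 'h::ab_group_add \<Rightarrow> 'h" and s' :: "'f \<Rightarrow> 'v::ab_group_add \<Rightarrow> 'v"
  assumes "vector_space s'" and m: "multilinear s s' m"
  shows "\<exists>f. Vector_Spaces.linear tscale s' f \<and> (\<forall>xs. f (pure s xs) = m xs)"
proof -
  interpret T: vector_space "tscale :: 'f \<Rightarrow> ('f, 'h) tensor \<Rightarrow> _" by (rule vector_space_tscale)
  interpret V: vector_space s' by fact
  interpret TV: vector_space_pair "tscale :: 'f \<Rightarrow> ('f, 'h) tensor \<Rightarrow> _" s' ..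
  interpret F: vector_space "(*) :: 'f \<Rightarrow> 'f \<Rightarrow> 'f" by unfold_locales (auto simp: algebra_simps)
  interpret VF: vector_space_pair s' "(*) :: 'f \<Rightarrow> 'f \<Rightarrow> 'f" ..
  obtain B where B: "B \<subseteq> range (pure s)" "T.independent B" "range (pure s) \<subseteq> T.span B"
    using T.maximal_independent_subset[of "range (pure s)"] by blast
  define g where "g b = m (SOME xs. b = pure s xs)" for b
  obtain f where f: "Vector_Spaces.linear tscale s' f" "\<And>b. b \<in> B \<Longrightarrow> f b = g b"
    using TV.linear_independent_extend[OF B(2), of g] by blast
  have key: "l (f t) = t (\<lambda>xs. l (m xs))"
    if l: "Vector_Spaces.linear s' (*) l" and t: "t \<in> T.span B" for l t
  proof -
    interpret l: Vector_Spaces.linear s' "(*)" l by fact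
    interpret f: Vector_Spaces.linear tscale s' f by fact
    have ml: "multilinear s (*) (\<lambda>xs. l (m xs))"
      using m by (simp add: multilinear_def l.add l.scale)
    show ?thesis using t
    proof (induction rule: T.span_induct_alt)
      case base
      show ?case by (simp add: zero_fun_def[symmetric])
    next
      case (step c b u)
      obtain xs where "b = pure s xs" using step B(1) by blast
      then have "b = pure s (SOME xs. b = pure s xs)" by (rule someI)
      then have "b (\<lambda>xs. l (m xs)) = pure s (SOME xs. b = pure s xs) (\<lambda>xs. l (m xs))"
        by (rule arg_cong)
      also have "\<dots> = l (g b)"
        using ml by (simp add: g_def pure_def)
      finally have b: "b (\<lambda>xs. l (m xs)) = l (f b)"
        using step(1) by (simp add: f(2))
      have "l (f (tscale c b + u)) = c * l (f b) + l (f u)"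
        by (simp only: f.add f.scale l.add l.scale)
      also have "\<dots> = (tscale c b + u) (\<lambda>xs. l (m xs))"
        using b step by (simp add: tscale_def)
      finally show ?case .
    qed
  qed
  have "f (pure s xs) = m xs" for xs
  proof (rule ccontr)
    assume ne: "f (pure s xs) \<noteq> m xs"
    define d where "d = f (pure s xs) - m xs"
    have "V.independent {d}" using ne by (simp add: d_def)
    then obtain l where l: "Vector_Spaces.linear s' (*) l" "l d = 1"
      using VF.linear_independent_extend[of "{d}" "\<lambda>_. 1"] by auto
    interpret l: Vector_Spaces.linear s' "(*)" l by fact
    have "multilinear s (*) (\<lambda>xs. l (m xs))"
      using m by (simp add: multilinear_def l.add l.scale)
    then have "l (f (pure s xs)) = l (m xs)"
      using key[OF l(1), of "pure s xs"] B(3) by (auto simp: pure_def)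
    with l(2) show False by (simp add: d_def l.diff)
  qed
  with f(1) show ?thesis by blast
qed

lemma tprod_pure: "tprod s (pure s xs) (pure s ys) = pure s (xs @ ys)"
proof -
  have "tlift (\<lambda>ys. pure s (xs @ ys)) (pure s ys) = pure s (xs @ ys)" for xs
    by (rule tlift_pure)
      (auto simp: multilinear_def pure_def tscale_def fun_eq_iff simp flip: append_assoc)
  moreover have "tlift (\<lambda>xs. pure s (xs @ ys)) (pure s xs) = pure s (xs @ ys)"
    by (rule tlift_pure) (auto simp: multilinear_def pure_def tscale_def fun_eq_iff)
  ultimately show ?thesis by (simp add: tprod_def)
qed

lemma tperm_pure:
  fixes s :: "'f::field \<Rightarrow> 'h::ab_group_add \<Rightarrow> 'h"
  assumes p: "p permutes {..<n}" and len: "length xs = n"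
  shows "tperm s n p (pure s xs) = pure s (permute_list p xs)"
proof -
  have upd: "\<exists>us' vs'. \<forall>x. permute_list p (us @ x # vs) = us' @ x # vs'"
    if "length us + length vs + 1 = n" for us vs :: "'h list"
  proof -
    define k where "k = inv_into UNIV p (length us)"
    have k: "p i = length us \<longleftrightarrow> i = k" for i
      using permutes_inv_eq[OF p, of "length us" i] by (auto simp: k_def)
    have kn: "k < n"
      using that permutes_in_image[OF permutes_inv[OF p], of "length us"] by (simp add: k_def)
    let ?w = "permute_list p (us @ undefined # vs)"
    have w: "permute_list p (us @ x # vs) = ?w[k := x]" for x
    proof (rule nth_equalityI)
      have *: "(us @ x # vs) ! j = (if j = length us then x else (us @ undefined # vs) ! j)" for j
        by (auto simp: nth_append nth_Cons')
      fix i assume "i < length (permute_list p (us @ x # vs))"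
      then have i: "i < n" using that by simp
      then have "permute_list p (us @ x # vs) ! i = (us @ x # vs) ! p i"
        using that by (simp add: permute_list_def)
      also have "\<dots> = (if i = k then x else (us @ undefined # vs) ! p i)"
        unfolding * k ..
      also have "\<dots> = ?w[k := x] ! i"
        using i that by (simp add: permute_list_def nth_list_update)
      finally show "permute_list p (us @ x # vs) ! i = ?w[k := x] ! i" .
    qed simp
    have "permute_list p (us @ x # vs) = take k ?w @ x # drop (Suc k) ?w" for x
      using kn that by (subst w, subst upd_conv_take_nth_drop) simp_all
    then show ?thesis by (intro exI allI)
  qed
  have "multilinear s tscale (\<lambda>xs. if length xs = n then pure s (permute_list p xs) else 0)"
    unfolding multilinear_def
  proof (intro conjI allI)
    fix us vs x y
    show "(if length (us @ (x + y) # vs) = n then pure s (permute_list p (us @ (x + y) # vs)) else 0)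
        = (if length (us @ x # vs) = n then pure s (permute_list p (us @ x # vs)) else 0)
        + (if length (us @ y # vs) = n then pure s (permute_list p (us @ y # vs)) else 0)"
    proof (cases "length us + length vs + 1 = n")
      case True
      then obtain us' vs' where "\<And>x. permute_list p (us @ x # vs) = us' @ x # vs'" using upd by blast
      with True show ?thesis by (simp add: pure_add)
    qed simp
  next
    fix us vs c x
    show "(if length (us @ s c x # vs) = n then pure s (permute_list p (us @ s c x # vs)) else 0)
        = tscale c (if length (us @ x # vs) = n then pure s (permute_list p (us @ x # vs)) else 0)"
    proof (cases "length us + length vs + 1 = n")
      case True
      then obtain us' vs' where "\<And>x. permute_list p (us @ x # vs) = us' @ x # vs'" using upd by blast
      with True show ?thesis by (simp add: pure_scale)
    qed (simp add: tscale_zero)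
  qed
  from tlift_pure[OF this] len show ?thesis by (simp add: tperm_def)
qed

lemma flip_pure: "flip s (pure s [x, y]) = pure s [y, x]"
proof -
  have "transpose 0 1 permutes {..<2::nat}" by (rule permutes_swap_id) auto
  then show ?thesis
    by (simp add: tswap_def tperm_pure permute_list_def numeral_2_eq_2 transpose_def)
qed

lemma leg_pure:
  fixes s :: "'f::field \<Rightarrow> 'h::ring_1 \<Rightarrow> 'h"
  assumes ij: "i \<in> {1..n}" "j \<in> {1..n}" "i \<noteq> j"
  shows "leg s n i j (pure s [x, y]) = pure s ((replicate n 1)[i - 1 := x, j - 1 := y])"
proof -
  have split: "\<exists>us vs. \<forall>z. w[k := z] = us @ z # vs" if "k < length w" for k and w :: "'h list"
    using that by (metis upd_conv_take_nth_drop)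
  let ?m = "\<lambda>xs. if length xs = 2
    then pure s ((replicate n 1)[i - 1 := xs ! 0, j - 1 := xs ! 1]) else 0"
  have "multilinear s tscale ?m"
    unfolding multilinear_def
  proof (intro conjI allI)
    have *: "(replicate n 1)[i - 1 := u, j - 1 := z] = (replicate n 1)[j - 1 := z, i - 1 := u]" for u z :: 'h
      using ij by (intro list_update_swap) auto
    have j: "\<exists>us vs. \<forall>z. (replicate n 1)[i - 1 := u, j - 1 := z] = us @ z # vs" for u :: 'h
      using ij by (intro split) auto
    have i: "\<exists>us vs. \<forall>u. (replicate n 1)[i - 1 := u, j - 1 := z] = us @ u # vs" for z :: 'h
      unfolding * using ij by (intro split) auto
    have two: "length (us @ z # vs) = 2 \<longleftrightarrow> (\<exists>b. us = [] \<and> vs = [b]) \<or> (\<exists>a. us = [a] \<and> vs = [])"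
      for us vs and z :: 'h
      by (cases us; cases vs) auto
    show "?m (us @ (a + b) # vs) = ?m (us @ a # vs) + ?m (us @ b # vs)" for us vs a b
    proof (cases "length (us @ a # vs) = 2")
      case True
      with two consider c where "us = []" "vs = [c]" | c where "us = [c]" "vs = []" by metis
      then show ?thesis
      proof cases
        case 1
        then show ?thesis using i[of c] by (auto simp: pure_add)
      next
        case 2
        then show ?thesis using j[of c] by (auto simp: pure_add)
      qed
    qed auto
    show "?m (us @ s c a # vs) = tscale c (?m (us @ a # vs))" for us vs c a
    proof (cases "length (us @ a # vs) = 2")
      case True
      with two consider d where "us = []" "vs = [d]" | d where "us = [d]" "vs = []" by metis
      then show ?thesis
      proof cases
        case 1
        then show ?thesis using i[of d] by (auto simp: pure_scale)
      next
        case 2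
        then show ?thesis using j[of d] by (auto simp: pure_scale)
      qed
    qed (simp add: tscale_zero)
  qed
  from tlift_pure[OF this] show ?thesis by (simp add: leg_def)
qed

lemma span_pure_additive:
  fixes s :: "'f::field \<Rightarrow> 'h::ab_group_add \<Rightarrow> 'h"
  assumes "t \<in> module.span tscale (range (pure s))"
  shows "multilinear s (*) \<phi> \<Longrightarrow> multilinear s (*) \<chi> \<Longrightarrow> t (\<lambda>xs. \<phi> xs + \<chi> xs) = t \<phi> + t \<chi>"
    and "multilinear s (*) \<phi> \<Longrightarrow> t (\<lambda>xs. c * \<phi> xs) = c * t \<phi>"
    and "t (\<lambda>xs. 0) = 0"
    and "\<not> multilinear s (*) \<phi> \<Longrightarrow> t \<phi> = 0"
proof -
  interpret T: vector_space "tscale :: 'f \<Rightarrow> ('f, 'h) tensor \<Rightarrow> _" by (rule vector_space_tscale)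
  have sum: "multilinear s (*) (\<lambda>xs. \<phi> xs + \<chi> xs)"
    if "multilinear s (*) \<phi>" "multilinear s (*) \<chi>" for \<phi> \<chi>
    using that by (simp add: multilinear_def algebra_simps)
  have mul: "multilinear s (*) (\<lambda>xs. c * \<phi> xs)" if "multilinear s (*) \<phi>" for \<phi> c
    using that by (simp add: multilinear_def algebra_simps)
  show "multilinear s (*) \<phi> \<Longrightarrow> multilinear s (*) \<chi> \<Longrightarrow> t (\<lambda>xs. \<phi> xs + \<chi> xs) = t \<phi> + t \<chi>"
    using assms
    by (induction rule: T.span_induct_alt) (auto simp: pure_def sum tscale_def algebra_simps)
  show "multilinear s (*) \<phi> \<Longrightarrow> t (\<lambda>xs. c * \<phi> xs) = c * t \<phi>"
    using assms
    by (induction rule: T.span_induct_alt) (auto simp: pure_def mul tscale_def algebra_simps)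
  show "t (\<lambda>xs. 0) = 0"
    using assms by (induction rule: T.span_induct_alt) (auto simp: pure_def tscale_def)
  show "\<not> multilinear s (*) \<phi> \<Longrightarrow> t \<phi> = 0"
    using assms by (induction rule: T.span_induct_alt) (auto simp: pure_def tscale_def)
qed

lemma tprod_add_left: "tprod s (t + t') u = tprod s t u + tprod s t' u"
  and tprod_scale_left: "tprod s (tscale c t) u = tscale c (tprod s t u)"
  by (simp_all add: tprod_def tlift_add tlift_scale)

lemma tprod_right:
  fixes s :: "'f::field \<Rightarrow> 'h::ab_group_add \<Rightarrow> 'h"
  assumes t: "t \<in> module.span tscale (range (pure s))"
    and u: "u \<in> module.span tscale (range (pure s))"
  shows "v \<in> module.span tscale (range (pure s)) \<Longrightarrow> tprod s t (u + v) = tprod s t u + tprod s t v"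
    and "tprod s t (tscale c u) = tscale c (tprod s t u)"
proof -
  have ml: "multilinear s (*) (\<lambda>xs. w (\<lambda>ys. \<phi> (xs @ ys)))"
    if w: "w \<in> module.span tscale (range (pure s))" and \<phi>: "multilinear s (*) \<phi>" for w \<phi>
  proof -
    have ap: "multilinear s (*) (\<lambda>ys. \<phi> (xs @ ys))" for xs
      using \<phi> by (simp add: multilinear_def flip: append_assoc)
    have 1: "(\<lambda>ys. \<phi> ((us @ (x + y) # vs) @ ys)) = (\<lambda>ys. \<phi> ((us @ x # vs) @ ys) + \<phi> ((us @ y # vs) @ ys))"
      and 2: "(\<lambda>ys. \<phi> ((us @ s c x # vs) @ ys)) = (\<lambda>ys. c * \<phi> ((us @ x # vs) @ ys))" for us vs x y c
      using \<phi> by (simp_all add: multilinear_def)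
    show ?thesis
      unfolding multilinear_def 1 2 span_pure_additive(1)[OF w ap ap] span_pure_additive(2)[OF w ap]
      by simp
  qed
  show "tprod s t (u + v) = tprod s t u + tprod s t v" if v: "v \<in> module.span tscale (range (pure s))"
  proof
    fix \<phi>
    show "tprod s t (u + v) \<phi> = (tprod s t u + tprod s t v) \<phi>"
      using span_pure_additive(1)[OF t ml[OF u] ml[OF v], of \<phi>] span_pure_additive(3)[OF t]
        span_pure_additive(3)[OF u] span_pure_additive(3)[OF v]
      by (cases "multilinear s (*) \<phi>") (auto simp: tprod_def tlift_def pure_def)
  qed
  show "tprod s t (tscale c u) = tscale c (tprod s t u)"
  proof
    fix \<phi>
    show "tprod s t (tscale c u) \<phi> = tscale c (tprod s t u) \<phi>"
      using span_pure_additive(2)[OF t ml[OF u], of \<phi>] span_pure_additive(3)[OF t]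
        span_pure_additive(3)[OF u]
      by (cases "multilinear s (*) \<phi>") (auto simp: tprod_def tlift_def pure_def tscale_def)
  qed
qed

lemma tprod_zero_right:
  assumes "t \<in> module.span tscale (range (pure s))"
  shows "tprod s t 0 = 0"
  using span_pure_additive(3)[OF assms] by (simp add: tprod_def tlift_def fun_eq_iff)

lemma tprod_span:
  fixes s :: "'f::field \<Rightarrow> 'h::ab_group_add \<Rightarrow> 'h"
  assumes "t \<in> module.span tscale (range (pure s))" "u \<in> module.span tscale (range (pure s))"
  shows "tprod s t u \<in> module.span tscale (range (pure s))"
proof -
  interpret T: vector_space "tscale :: 'f \<Rightarrow> ('f, 'h) tensor \<Rightarrow> _" by (rule vector_space_tscale)
  have zero: "tprod s 0 v = 0" "w \<in> T.span (range (pure s)) \<Longrightarrow> tprod s w 0 = 0" for v w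
    by (auto simp: tprod_zero_right) (simp add: tprod_def tlift_def fun_eq_iff)
  have p: "pure s xs \<in> T.span (range (pure s))" for xs
    by (simp add: T.span_base)
  have 1: "u \<in> T.span (range (pure s)) \<and> tprod s (pure s xs) u \<in> T.span (range (pure s))" for xs
    using assms(2)
  proof (induction rule: T.span_induct_alt)
    case base
    show ?case using T.span_zero zero(2)[OF p] by (simp add: zero_fun_def)
  next
    case (step c x y)
    then have x: "tscale c x \<in> T.span (range (pure s))" "x \<in> T.span (range (pure s))"
      by (auto intro: T.span_scale p)
    with step have "tprod s (pure s xs) (tscale c x + y)
        = tscale c (tprod s (pure s xs) x) + tprod s (pure s xs) y"
      using tprod_right[OF p x(1)] tprod_right(2)[OF p x(2)] by simp
    moreover have "tprod s (pure s xs) x \<in> T.span (range (pure s))"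
      using step by (auto simp: tprod_pure p)
    ultimately have "tscale c x + y \<in> T.span (range (pure s)) \<and>
        tprod s (pure s xs) (tscale c x + y) \<in> T.span (range (pure s))"
      using step x by (auto intro: T.span_add T.span_scale simp del: plus_fun_apply)
    then show ?case .
  qed
  show ?thesis using assms(1)
  proof (induction rule: T.span_induct_alt)
    case base
    show ?case using T.span_zero zero(1)[of u] by (simp add: zero_fun_def)
  next
    case (step c x y)
    then have "tprod s (tscale c x + y) u \<in> T.span (range (pure s))"
      using 1 by (auto simp: tprod_add_left tprod_scale_left intro!: T.span_add T.span_scale
        simp del: plus_fun_apply)
    then show ?case .
  qed
qed

text \<open>For pure tensors this is \<open>(f\<^sub>1 \<otimes> \<dots> \<otimes> f\<^sub>k) (x\<^sub>1 \<otimes> \<dots> \<otimes> x\<^sub>k) = f\<^sub>1 x\<^sub>1 \<otimes> \<dots> \<otimes> f\<^sub>k x\<^sub>k\<close>.\<close>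

lemma tmap_pure:
  fixes s :: "'f::field \<Rightarrow> 'h::ab_group_add \<Rightarrow> 'h"
  assumes fs: "\<And>f. f \<in> set fs \<Longrightarrow> Vector_Spaces.linear s tscale f"
      "\<And>f x. f \<in> set fs \<Longrightarrow> f x \<in> module.span tscale (range (pure s))"
    and len: "length xs = length fs"
  shows "tmap s fs (pure s xs) = foldr (tprod s) (map2 (\<lambda>f x. f x) fs xs) (pure s [])"
proof -
  interpret T: vector_space "tscale :: 'f \<Rightarrow> ('f, 'h) tensor \<Rightarrow> _" by (rule vector_space_tscale)
  define F :: "('h \<Rightarrow> ('f, 'h) tensor) list \<Rightarrow> 'h list \<Rightarrow> ('f, 'h) tensor" where
    "F fs xs = (if length xs = length fs
      then foldr (tprod s) (map2 (\<lambda>f x. f x) fs xs) (pure s []) else 0)" for fs xs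
  have tprod0: "w \<in> T.span (range (pure s)) \<Longrightarrow> tprod s w 0 = 0" for w
    by (rule tprod_zero_right)
  have F_Cons: "F (f # fs) (x # xs) = tprod s (f x) (F fs xs)"
    if "f x \<in> T.span (range (pure s))" for f fs x xs
    using that tprod0 by (simp add: F_def)
  have span: "F fs xs \<in> T.span (range (pure s))"
    if "\<forall>f\<in>set fs. \<forall>x. f x \<in> T.span (range (pure s))" for fs :: "('h \<Rightarrow> ('f, 'h) tensor) list" and xs
    using that
  proof (induction fs arbitrary: xs)
    case Nil
    have "F [] xs = (if xs = [] then pure s [] else 0)" by (simp add: F_def)
    moreover have "pure s [] \<in> T.span (range (pure s))" by (rule T.span_base) simp
    moreover have "0 \<in> T.span (range (pure s))" by (rule T.span_zero)
    ultimately show ?case by (cases "xs = []") (simp_all del: zero_fun_apply)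
  next
    case (Cons f fs)
    show ?case
    proof (cases xs)
      case Nil
      then show ?thesis by (simp add: F_def T.span_zero del: zero_fun_apply)
    next
      case (Cons x xs')
      have fx: "f x \<in> T.span (range (pure s))" and *: "F fs xs' \<in> T.span (range (pure s))"
        using Cons.prems Cons.IH[of xs'] by auto
      show ?thesis
        unfolding Cons F_Cons[where f = f, OF fx] by (rule tprod_span[OF fx *])
    qed
  qed
  have "multilinear s tscale (F fs)"
    using fs
  proof (induction fs)
    case Nil
    show ?case by (simp add: F_def multilinear_def tscale_def fun_eq_iff)
  next
    case (Cons f fs)
    interpret f: Vector_Spaces.linear s tscale f by (rule Cons.prems(1)) simp
    have f: "f x \<in> T.span (range (pure s))" for x by (rule Cons.prems(2)) simp
    have IH: "multilinear s tscale (F fs)"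
      by (rule Cons.IH) (rule Cons.prems, simp)+
    have sp: "F fs xs \<in> T.span (range (pure s))" for xs
      by (rule span, intro ballI allI, rule Cons.prems(2)) simp
    note * = F_Cons[where f = f and fs = fs, OF f]
    show ?case
      unfolding multilinear_def
    proof (intro conjI allI)
      show "F (f # fs) (us @ (x + y) # vs) = F (f # fs) (us @ x # vs) + F (f # fs) (us @ y # vs)"
        for us vs x y
      proof (cases us)
        case Nil
        then show ?thesis by (simp only: append_Nil * f.add tprod_add_left)
      next
        case (Cons u us')
        have "F fs (us' @ (x + y) # vs) = F fs (us' @ x # vs) + F fs (us' @ y # vs)"
          using IH unfolding multilinear_def by blast
        then show ?thesis using tprod_right(1)[OF f sp sp, of u "us' @ x # vs" "us' @ y # vs"]
          by (simp only: Cons append_Cons *)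
      qed
      show "F (f # fs) (us @ s c x # vs) = tscale c (F (f # fs) (us @ x # vs))" for us vs c x
      proof (cases us)
        case Nil
        then show ?thesis by (simp only: append_Nil * f.scale tprod_scale_left)
      next
        case (Cons u us')
        have "F fs (us' @ s c x # vs) = tscale c (F fs (us' @ x # vs))"
          using IH unfolding multilinear_def by blast
        then show ?thesis using tprod_right(2)[OF f sp, of u c "us' @ x # vs"]
          by (simp only: Cons append_Cons *)
      qed
    qed
  qed
  from tlift_pure[OF this] len show ?thesis by (simp add: tmap_def F_def[abs_def])
qed

lemma tmult_pure:
  fixes s :: "'f::field \<Rightarrow> 'h::ring_1 \<Rightarrow> 'h"
  assumes "\<And>c x y. s c x * y = s c (x * y)" "\<And>c x y. x * s c y = s c (x * y)"
    and len: "length xs = length ys"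
  shows "pure s xs \<cdot>\<^bsub>s\<^esub> pure s ys = pure s (map2 (*) xs ys)"
proof -
  let ?m = "\<lambda>xs ys. if length xs = length ys then pure s (map2 (*) xs ys) else 0"
  have split: "\<exists>us' x' vs'. xs = us' @ x' # vs' \<and> length us' = length us \<and> length vs' = length vs"
    if "length xs = length us + Suc (length vs)" for xs us vs :: "'h list"
    using that
    by (intro exI[of _ "take (length us) xs"] exI[of _ "xs ! length us"] exI[of _ "drop (Suc (length us)) xs"])
       (simp add: id_take_nth_drop[symmetric])
  have 1: "multilinear s tscale (?m xs)" for xs
    unfolding multilinear_def
  proof (intro conjI allI)
    show "?m xs (us @ (x + y) # vs) = ?m xs (us @ x # vs) + ?m xs (us @ y # vs)" for us vs x y
      using split[of xs us vs] by (auto simp: distrib_left pure_add)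
    show "?m xs (us @ s c x # vs) = tscale c (?m xs (us @ x # vs))" for us vs c x
      using split[of xs us vs] by (auto simp: assms pure_scale tscale_zero)
  qed
  have 2: "multilinear s tscale (\<lambda>xs. ?m xs ys)"
    unfolding multilinear_def
  proof (intro conjI allI)
    show "?m (us @ (x + y) # vs) ys = ?m (us @ x # vs) ys + ?m (us @ y # vs) ys" for us vs x y
      using split[of ys us vs] by (auto simp: distrib_right pure_add)
    show "?m (us @ s c x # vs) ys = tscale c (?m (us @ x # vs) ys)" for us vs c x
      using split[of ys us vs] by (auto simp: assms pure_scale tscale_zero)
  qed
  show ?thesis unfolding tmult_def tlift_pure[OF 1] tlift_pure[OF 2] using len by simp
qed


section \<open>Cylindrical bialgebras\<close>

text \<open>
  A nonzero unital algebra over a field. The assumption \<open>0 \<noteq> 1\<close> of \<open>ring_1\<close> is harmless: the counit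
  of a bialgebra maps 1 to 1.
\<close>

locale k_algebra = vector_space s
  for s :: "'f::field \<Rightarrow> 'h::ring_1 \<Rightarrow> 'h" +
  assumes scale_mult_left: "s c x * y = s c (x * y)"
    and mult_scale_right: "x * s c y = s c (x * y)"

locale bialgebra = k_algebra s
  for s :: "'f::field \<Rightarrow> 'h::ring_1 \<Rightarrow> 'h"
    and \<Delta> :: "'h \<Rightarrow> ('f, 'h) tensor" and \<epsilon> :: "'h \<Rightarrow> 'f" +
  assumes comult_tpow: "\<Delta> x \<in> tpow s 2"
    and comult_linear: "Vector_Spaces.linear s tscale \<Delta>"
    and comult_mult: "\<Delta> (x * y) = \<Delta> x \<cdot>\<^bsub>s\<^esub> \<Delta> y"
    and comult_one: "\<Delta> 1 = pure s [1, 1]"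
    and counit_linear: "Vector_Spaces.linear s (*) \<epsilon>"
    and counit_mult: "\<epsilon> (x * y) = \<epsilon> x * \<epsilon> y"
    and counit_one: "\<epsilon> 1 = 1"
    and coassoc: "tmap s [\<Delta>, emb s] (\<Delta> x) = tmap s [emb s, \<Delta>] (\<Delta> x)"
    and counit_left: "tmap s [scal s \<circ> \<epsilon>, emb s] (\<Delta> x) = emb s x"
    and counit_right: "tmap s [emb s, scal s \<circ> \<epsilon>] (\<Delta> x) = emb s x"

locale quasitriangular_bialgebra = bialgebra s \<Delta> \<epsilon>
  for s :: "'f::field \<Rightarrow> 'h::ring_1 \<Rightarrow> 'h" and \<Delta> \<epsilon>
    and R :: "('f, 'h) tensor" +
  assumes R_unit: "R \<in> Units (tpow_monoid s 2)"
    and R_comult: "R \<cdot>\<^bsub>s\<^esub> \<Delta> x = flip s (\<Delta> x) \<cdot>\<^bsub>s\<^esub> R"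
    and R_comult_left: "tmap s [\<Delta>, emb s] R = leg s 3 1 3 R \<cdot>\<^bsub>s\<^esub> leg s 3 2 3 R"
    and R_comult_right: "tmap s [emb s, \<Delta>] R = leg s 3 1 3 R \<cdot>\<^bsub>s\<^esub> leg s 3 1 2 R"

definition drinfeld_twist ::
  "('f::field \<Rightarrow> 'h::ring_1 \<Rightarrow> 'h) \<Rightarrow> ('h \<Rightarrow> ('f, 'h) tensor) \<Rightarrow> ('h \<Rightarrow> 'f) \<Rightarrow> ('f, 'h) tensor \<Rightarrow> bool"
  where "drinfeld_twist s \<Delta> \<epsilon> J \<longleftrightarrow>
    J \<in> Units (tpow_monoid s 2) \<and>
    tmap s [scal s \<circ> \<epsilon>, emb s] J = emb s 1 \<and>
    tmap s [emb s, scal s \<circ> \<epsilon>] J = emb s 1 \<and>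
    tprod s J (emb s 1) \<cdot>\<^bsub>s\<^esub> tmap s [\<Delta>, emb s] J = tprod s (emb s 1) J \<cdot>\<^bsub>s\<^esub> tmap s [emb s, \<Delta>] J"

definition algebra_automorphism :: "('f::field \<Rightarrow> 'h::ring_1 \<Rightarrow> 'h) \<Rightarrow> ('h \<Rightarrow> 'h) \<Rightarrow> bool"
  where "algebra_automorphism s \<psi> \<longleftrightarrow>
    bij \<psi> \<and> Vector_Spaces.linear s s \<psi> \<and> (\<forall>x y. \<psi> (x * y) = \<psi> x * \<psi> y) \<and> \<psi> 1 = 1"

definition twist_pair ::
  "('f::field \<Rightarrow> 'h::ring_1 \<Rightarrow> 'h) \<Rightarrow> ('h \<Rightarrow> ('f, 'h) tensor) \<Rightarrow> ('h \<Rightarrow> 'f) \<Rightarrow> ('f, 'h) tensor \<Rightarrow>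
    ('h \<Rightarrow> 'h) \<Rightarrow> ('f, 'h) tensor \<Rightarrow> bool"
  where "twist_pair s \<Delta> \<epsilon> R \<psi> J \<longleftrightarrow>
    algebra_automorphism s \<psi> \<and>
    drinfeld_twist s \<Delta> \<epsilon> J \<and>
    (\<forall>x. tmap s [emb s \<circ> \<psi>, emb s \<circ> \<psi>] (flip s (\<Delta> (inv_into UNIV \<psi> x)))
      = J \<cdot>\<^bsub>s\<^esub> \<Delta> x \<cdot>\<^bsub>s\<^esub> inv\<^bsub>tpow_monoid s 2\<^esub> J) \<and>
    (\<forall>x. \<epsilon> (inv_into UNIV \<psi> x) = \<epsilon> x) \<and>
    tmap s [emb s \<circ> \<psi>, emb s \<circ> \<psi>] (flip s R) = flip s J \<cdot>\<^bsub>s\<^esub> R \<cdot>\<^bsub>s\<^esub> inv\<^bsub>tpow_monoid s 2\<^esub> J"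

locale cylindrical_bialgebra = quasitriangular_bialgebra s \<Delta> \<epsilon> R
  for s :: "'f::field \<Rightarrow> 'h::ring_1 \<Rightarrow> 'h" and \<Delta> \<epsilon> R
    and \<psi> :: "'h \<Rightarrow> 'h" and J :: "('f, 'h) tensor" and K :: 'h +
  assumes twist_pair: "twist_pair s \<Delta> \<epsilon> R \<psi> J"
    and K_unit: "\<exists>L. K * L = 1 \<and> L * K = 1"
    and comult_K: "\<Delta> K = inv\<^bsub>tpow_monoid s 2\<^esub> J \<cdot>\<^bsub>s\<^esub> pure s [1, K] \<cdot>\<^bsub>s\<^esub> tmap s [emb s \<circ> \<psi>, emb s] R
      \<cdot>\<^bsub>s\<^esub> pure s [K, 1]"

definition subalgebra :: "('f::field \<Rightarrow> 'h::ring_1 \<Rightarrow> 'h) \<Rightarrow> 'h set \<Rightarrow> bool"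
  where "subalgebra s B \<longleftrightarrow> module.subspace s B \<and> 1 \<in> B \<and> (\<forall>x\<in>B. \<forall>y\<in>B. x * y \<in> B)"

text \<open>The condition \<open>\<Delta>(B) \<subseteq> B \<otimes> H\<close>.\<close>

definition right_coideal ::
  "('f::field \<Rightarrow> 'h::ring_1 \<Rightarrow> 'h) \<Rightarrow> ('h \<Rightarrow> ('f, 'h) tensor) \<Rightarrow> 'h set \<Rightarrow> bool"
  where "right_coideal s \<Delta> B \<longleftrightarrow> \<Delta> ` B \<subseteq> module.span tscale {pure s [b, h] | b h. b \<in> B}"

definition cylindrically_invariant :: "('h::ring_1 \<Rightarrow> 'h) \<Rightarrow> 'h \<Rightarrow> 'h set \<Rightarrow> bool"
  where "cylindrically_invariant \<psi> K B \<longleftrightarrow> (\<forall>b\<in>B. K * b = \<psi> b * K)"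


section \<open>The action on tensor powers\<close>

text \<open>\<open>comult_iter s \<Delta> k\<close> is \<open>\<Delta>\<^sup>(\<^sup>k\<^sup>+\<^sup>1\<^sup>)\<close>, with values in the \<open>(k + 1)\<close>-st tensor power.\<close>

primrec comult_iter ::
  "('f::field \<Rightarrow> 'h::ring_1 \<Rightarrow> 'h) \<Rightarrow> ('h \<Rightarrow> ('f, 'h) tensor) \<Rightarrow> nat \<Rightarrow> 'h \<Rightarrow> ('f, 'h) tensor"
  where
    "comult_iter s \<Delta> 0 = emb s"
  | "comult_iter s \<Delta> (Suc k) = tmap s (\<Delta> # replicate k (emb s)) \<circ> comult_iter s \<Delta> k"

definition tact ::
  "('f::field \<Rightarrow> 'h::ring_1 \<Rightarrow> 'h) \<Rightarrow> ('h \<Rightarrow> ('f, 'h) tensor) \<Rightarrow> nat \<Rightarrow> 'h \<Rightarrow> ('f, 'h) tensor \<Rightarrow> ('f, 'h) tensor"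
  where "tact s \<Delta> n x t = comult_iter s \<Delta> (n - 1) x \<cdot>\<^bsub>s\<^esub> t"

text \<open>
  The group of linear automorphisms of the \<open>n\<close>-th tensor power (\<open>n \<ge> 1\<close>) that commute with \<open>B\<close>. As in
  \<open>BijGroup\<close>, its elements are functions on the carrier, extended by \<open>undefined\<close>.
\<close>

definition Aut_tpow ::
  "('f::field \<Rightarrow> 'h::ring_1 \<Rightarrow> 'h) \<Rightarrow> ('h \<Rightarrow> ('f, 'h) tensor) \<Rightarrow> 'h set \<Rightarrow> nat \<Rightarrow>
    (('f, 'h) tensor \<Rightarrow> ('f, 'h) tensor) monoid"
  where "Aut_tpow s \<Delta> B n = BijGroup (tpow s n) \<lparr>carrier := {f \<in> Bij (tpow s n).
    (\<forall>t\<in>tpow s n. \<forall>u\<in>tpow s n. f (t + u) = f t + f u) \<and>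
    (\<forall>c. \<forall>t\<in>tpow s n. f (tscale c t) = tscale c (f t)) \<and>
    (\<forall>b\<in>B. \<forall>t\<in>tpow s n. f (tact s \<Delta> n b t) = tact s \<Delta> n b (f t))}\<rparr>"


section \<open>The cylindrical braid group\<close>

text \<open>
  Groups given by generators and relations: words in the generators and their formal inverses
  (marked \<open>True\<close> and \<open>False\<close>) modulo the congruence generated by the relations and by cancellation.
\<close>

type_synonym 'g word = "('g \<times> bool) list"

definition words :: "'g set \<Rightarrow> 'g word set"
  where "words G = lists (G \<times> UNIV)"

inductive_set pres_rel :: "'g set \<Rightarrow> ('g word \<times> 'g word) set \<Rightarrow> ('g word \<times> 'g word) set"
  for G rels where
    pres_refl: "w \<in> words G \<Longrightarrow> (w, w) \<in> pres_rel G rels"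
  | pres_sym: "(v, w) \<in> pres_rel G rels \<Longrightarrow> (w, v) \<in> pres_rel G rels"
  | pres_trans: "(u, v) \<in> pres_rel G rels \<Longrightarrow> (v, w) \<in> pres_rel G rels \<Longrightarrow> (u, w) \<in> pres_rel G rels"
  | pres_cancel: "u \<in> words G \<Longrightarrow> v \<in> words G \<Longrightarrow> g \<in> G \<Longrightarrow>
      (u @ [(g, e), (g, \<not> e)] @ v, u @ v) \<in> pres_rel G rels"
  | pres_relator: "u \<in> words G \<Longrightarrow> v \<in> words G \<Longrightarrow> (l, r) \<in> rels \<Longrightarrow> l \<in> words G \<Longrightarrow> r \<in> words G \<Longrightarrow>
      (u @ l @ v, u @ r @ v) \<in> pres_rel G rels"

definition presented_group :: "'g set \<Rightarrow> ('g word \<times> 'g word) set \<Rightarrow> 'g word set monoid"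
  where "presented_group G rels =
    \<lparr>carrier = words G // pres_rel G rels,
     mult = (\<lambda>X Y. \<Union>x\<in>X. \<Union>y\<in>Y. pres_rel G rels `` {x @ y}),
     one = pres_rel G rels `` {[]}\<rparr>"

definition cyl_braid_relations :: "nat \<Rightarrow> (nat word \<times> nat word) set"
  where "cyl_braid_relations n = (let \<sigma> = \<lambda>i. (i, True) in
    {([\<sigma> i, \<sigma> (i + 1), \<sigma> i], [\<sigma> (i + 1), \<sigma> i, \<sigma> (i + 1)]) | i. 1 \<le> i \<and> i + 1 < n} \<union>
    {([\<sigma> i, \<sigma> j], [\<sigma> j, \<sigma> i]) | i j. i < n \<and> j < n \<and> \<bar>int i - int j\<bar> > 1} \<union>
    (if 1 < n then {([\<sigma> 0, \<sigma> 1, \<sigma> 0, \<sigma> 1], [\<sigma> 1, \<sigma> 0, \<sigma> 1, \<sigma> 0])} else {}))"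

definition cyl_braid_group :: "nat \<Rightarrow> nat word set monoid"
  where "cyl_braid_group n = presented_group {..<n} (cyl_braid_relations n)"

definition cyl_braid_gen :: "nat \<Rightarrow> nat \<Rightarrow> nat word set"
  where "cyl_braid_gen n i = pres_rel {..<n} (cyl_braid_relations n) `` {[(i, True)]}"

end

theory Submission
  imports Defs
begin

text \<open>
  Part (i). Conjugation by \<open>R\<close> turns \<open>\<Delta>(K)\<close> into \<open>\<Delta>\<^sup>o\<^sup>p(K)\<close>. The coproduct formula for \<open>K\<close> expresses
  \<open>\<Delta>(K)\<close> by the factors on the right of the reflection equation, preceded by \<open>J\<^sup>-\<^sup>1\<close>, and expresses
  \<open>\<Delta>\<^sup>o\<^sup>p(K)\<close> by the flipped factors. After multiplication of \<open>R \<Delta>(K) = \<Delta>\<^sup>o\<^sup>p(K) R\<close> by \<open>J\<^sub>2\<^sub>1\<close> from the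
  left, the twists occur only in \<open>J\<^sub>2\<^sub>1 R J\<^sup>-\<^sup>1\<close>, which is \<open>(\<psi> \<otimes> \<psi>)(R\<^sub>2\<^sub>1)\<close> by the axioms of a twist pair
  (\<open>reflection_equation\<close>).

  Part (ii). All operators in question have the form \<open>t \<mapsto> a \<cdot> \<theta>(t)\<close> with an element \<open>a\<close> and an algebra
  automorphism \<open>\<theta>\<close> of \<open>H\<^sup>\<otimes>\<^sup>n\<close>: for \<open>S\<^sub>i\<close> the element is \<open>R\<^sub>i\<^sub>+\<^sub>1\<^sub>,\<^sub>i\<close> and \<open>\<theta>\<close> is the transposition
  (\<open>braiding_eq\<close>), for \<open>S\<^sub>0\<close> the element is \<open>\<psi>\<^sup>-\<^sup>1(K)\<close> on the first leg and \<open>\<theta>\<close> is \<open>\<psi>\<^sup>-\<^sup>1\<close> on that leg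
  (\<open>cylinder_twist_eq\<close>). Moving the automorphisms to the right, each defining relation splits into a
  relation between automorphisms, which is evident on pure tensors, and a relation between elements.
  The latter is the Yang-Baxter equation for the braid relation, commutation of elements with disjoint
  legs for the commutation relations, and the image of the reflection equation under
  \<open>\<psi>\<^sup>-\<^sup>1 \<otimes> \<psi>\<^sup>-\<^sup>1\<close> for the relation of length four (\<open>untwisted_reflection_equation\<close>).

  The operators commute with \<open>B\<close> for two reasons. By coassociativity, \<open>\<Delta>\<^sup>(\<^sup>n\<^sup>)(x)\<close> arises from
  \<open>\<Delta>\<^sup>(\<^sup>n\<^sup>-\<^sup>1\<^sup>)(x)\<close> by applying \<open>\<Delta>\<close> to any chosen leg (\<open>comult_iter_at\<close>); for the \<open>i\<close>-th leg, the
  intertwining property of \<open>R\<close> applies at the positions \<open>i\<close> and \<open>i + 1\<close>. And since \<open>B\<close> is a right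
  coideal, \<open>\<Delta>\<^sup>(\<^sup>n\<^sup>)(b)\<close> lies in \<open>B \<otimes> H\<^sup>\<otimes>\<^sup>(\<^sup>n\<^sup>-\<^sup>1\<^sup>)\<close>, so that cylindrical invariance applies on the first leg.
\<close>


section \<open>Linearity on tensor powers\<close>

interpretation tensor: vector_space "tscale :: 'f::field \<Rightarrow> ('f, 'h) tensor \<Rightarrow> _"
  by (rule vector_space_tscale)

text \<open>
  Sums of tensors are to be handled by linearity of the operations on tensors. Pointwise evaluation of
  these sums would turn them into functions to which the linearity lemmas do not apply.
\<close>

declare plus_fun_apply [simp del] zero_fun_apply [simp del]

lemma tpow_add: "t \<in> tpow s n \<Longrightarrow> u \<in> tpow s n \<Longrightarrow> t + u \<in> tpow s n"
  and tpow_scale: "t \<in> tpow s n \<Longrightarrow> tscale c t \<in> tpow s n"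
  and pure_in_tpow: "length xs = n \<Longrightarrow> pure s xs \<in> tpow s n"
  unfolding tpow_def by (auto intro: tensor.span_add tensor.span_scale tensor.span_base)

lemma tscale_add: "tscale c (t + u) = tscale c t + tscale c u"
  by (simp add: tscale_def plus_fun_def algebra_simps)

text \<open>
  An element of the span of a set of pure tensors can be analysed by treating pure tensors, sums and
  multiples. Zero needs no case of its own: it is a multiple of a pure tensor.
\<close>

lemma span_pure_induct [consumes 2, case_names pure add scale]:
  assumes "t \<in> tensor.span (pure s ` A)" and "A \<noteq> {}"
    and pure: "\<And>xs. xs \<in> A \<Longrightarrow> P (pure s xs)"
    and add: "\<And>t u. t \<in> tensor.span (pure s ` A) \<Longrightarrow> u \<in> tensor.span (pure s ` A) \<Longrightarrow>
      P t \<Longrightarrow> P u \<Longrightarrow> P (t + u)"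
    and scale: "\<And>c t. t \<in> tensor.span (pure s ` A) \<Longrightarrow> P t \<Longrightarrow> P (tscale c t)"
  shows "P t"
proof -
  have gen: "pure s xs \<in> tensor.span (pure s ` A)" if "xs \<in> A" for xs
    using tensor.span_superset[of "pure s ` A"] that by blast
  have "t \<in> tensor.span (pure s ` A) \<and> P t"
    using assms(1)
  proof (induction rule: tensor.span_induct_alt)
    case base
    obtain xs where "xs \<in> A" using assms(2) by blast
    then have "P (tscale 0 (pure s xs))" using gen by (intro scale pure)
    then show ?case using tensor.span_zero by (simp only: tensor.scale_zero_left) simp
  next
    case (step c x y)
    then obtain xs where "xs \<in> A" "x = pure s xs" by blast
    with step gen[of xs] show ?case
      by (intro conjI tensor.span_add tensor.span_scale add scale) (auto intro: pure)
  qed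
  then show ?thesis ..
qed

lemma tpow_induct [consumes 1, case_names pure add scale]:
  assumes "t \<in> tpow s n"
    and "\<And>xs. length xs = n \<Longrightarrow> P (pure s xs)"
    and "\<And>t u. t \<in> tpow s n \<Longrightarrow> u \<in> tpow s n \<Longrightarrow> P t \<Longrightarrow> P u \<Longrightarrow> P (t + u)"
    and "\<And>c t. t \<in> tpow s n \<Longrightarrow> P t \<Longrightarrow> P (tscale c t)"
  shows "P t"
proof -
  have "replicate n undefined \<in> {xs. length xs = n}" by simp
  then have "{xs. length xs = n} \<noteq> {}" by blast
  from span_pure_induct[where P = P, OF assms(1)[unfolded tpow_def] this] assms(2-) show ?thesis
    by (auto simp: tpow_def)
qed

lemma tpow_in_span: "t \<in> tpow s n \<Longrightarrow> t \<in> tensor.span (range (pure s))"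
  unfolding tpow_def using tensor.span_mono[of "pure s ` {xs. length xs = n}" "range (pure s)"] by blast

lemma multilinear_add:
  "multilinear s tscale m \<Longrightarrow> multilinear s tscale m' \<Longrightarrow> multilinear s tscale (\<lambda>xs. m xs + m' xs)"
  by (simp add: multilinear_def tscale_add)

lemma multilinear_scale:
  "multilinear s tscale m \<Longrightarrow> multilinear s tscale (\<lambda>xs. tscale c (m xs))"
  by (simp add: multilinear_def tscale_add mult.commute)

text \<open>
  For a family of maps that is multilinear in two lists, contraction of the second list with a tensor
  leaves a multilinear map; this makes products with a fixed right factor computable on pure tensors.
\<close>

lemma multilinear_tlift:
  assumes "\<And>xs. multilinear s tscale (M xs)" "\<And>ys. multilinear s tscale (\<lambda>xs. M xs ys)"
    and "u \<in> tpow s n"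
  shows "multilinear s tscale (\<lambda>xs. tlift (M xs) u)"
  using assms(3)
  by (induction rule: tpow_induct)
    (simp_all add: tlift_pure[OF assms(1)] assms(2) tlift_add tlift_scale
      multilinear_add multilinear_scale)

lemma tmap_add: "tmap s fs (t + u) = tmap s fs t + tmap s fs u"
  and tmap_scale: "tmap s fs (tscale c t) = tscale c (tmap s fs t)"
  by (simp_all add: tmap_def tlift_add tlift_scale)

lemma tperm_add: "tperm s n p (t + u) = tperm s n p t + tperm s n p u"
  and tperm_scale: "tperm s n p (tscale c t) = tscale c (tperm s n p t)"
  by (simp_all add: tperm_def tlift_add tlift_scale)

lemma tswap_add: "tswap s n i j (t + u) = tswap s n i j t + tswap s n i j u"
  and tswap_scale: "tswap s n i j (tscale c t) = tscale c (tswap s n i j t)"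
  by (simp_all add: tswap_def tperm_add tperm_scale)

lemma leg_add: "leg s n i j (t + u) = leg s n i j t + leg s n i j u"
  and leg_scale: "leg s n i j (tscale c t) = tscale c (leg s n i j t)"
  by (simp_all add: leg_def tlift_add tlift_scale)

lemma tmult_add_left: "(t + t') \<cdot>\<^bsub>s\<^esub> u = t \<cdot>\<^bsub>s\<^esub> u + t' \<cdot>\<^bsub>s\<^esub> u"
  and tmult_scale_left: "tscale c t \<cdot>\<^bsub>s\<^esub> u = tscale c (t \<cdot>\<^bsub>s\<^esub> u)"
  by (simp_all add: tmult_def tlift_add tlift_scale)


section \<open>The tensor product of tensors\<close>

lemma tprod_tpow:
  assumes t: "t \<in> tpow s m" and u: "u \<in> tpow s n"
  shows "tprod s t u \<in> tpow s (m + n)"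
  using t
proof (induction rule: tpow_induct)
  case (pure xs)
  from u show ?case
  proof (induction rule: tpow_induct)
    case (pure ys)
    then show ?case using \<open>length xs = m\<close> by (simp add: tprod_pure pure_in_tpow)
  next
    case (add v w)
    have "tprod s (pure s xs) (v + w) = tprod s (pure s xs) v + tprod s (pure s xs) w"
      using add pure pure_in_tpow tpow_in_span by (intro tprod_right(1)) blast+
    with add show ?case by (simp add: tpow_add)
  next
    case (scale c v)
    have "tprod s (pure s xs) (tscale c v) = tscale c (tprod s (pure s xs) v)"
      using scale pure pure_in_tpow tpow_in_span by (intro tprod_right(2)) blast+
    with scale show ?case by (simp add: tpow_scale)
  qed
qed (simp_all add: tprod_add_left tprod_scale_left tpow_add tpow_scale)

text \<open>
  Linearity in the right factor holds only on genuine tensors: on other functionals the product need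
  not even be additive. The degrees of both factors therefore occur in the hypotheses.
\<close>

lemma tprod_add_right:
  "t \<in> tpow s m \<Longrightarrow> u \<in> tpow s n \<Longrightarrow> v \<in> tpow s n \<Longrightarrow> tprod s t (u + v) = tprod s t u + tprod s t v"
  and tprod_scale_right:
  "t \<in> tpow s m \<Longrightarrow> u \<in> tpow s n \<Longrightarrow> tprod s t (tscale c u) = tscale c (tprod s t u)"
  using tprod_right tpow_in_span by blast+

lemmas tprod_linear_left = tprod_add_left tprod_scale_left
lemmas tprod_linear_right = tprod_add_right tprod_scale_right

lemma tprod_assoc:
  assumes t: "t \<in> tpow s k" and u: "u \<in> tpow s m" and v: "v \<in> tpow s n"
  shows "tprod s (tprod s t u) v = tprod s t (tprod s u v)"
  using t
proof (induction rule: tpow_induct)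
  case (pure xs)
  note xs = pure_in_tpow[OF pure]
  from u show ?case
  proof (induction rule: tpow_induct)
    case (pure ys)
    note ys = pure_in_tpow[OF pure]
    from v show ?case
    proof (induction rule: tpow_induct)
      case (pure zs)
      then show ?case by (simp add: tprod_pure)
    qed (simp_all add: tprod_linear_right[OF tprod_tpow[OF xs ys]] tprod_linear_right[OF ys]
        tprod_add_right[OF xs tprod_tpow[OF ys] tprod_tpow[OF ys]] tprod_scale_right[OF xs tprod_tpow[OF ys]])
  qed (simp_all add: tprod_linear_right[OF xs] tprod_add_right[OF xs tprod_tpow[OF _ v] tprod_tpow[OF _ v]] tprod_scale_right[OF xs tprod_tpow[OF _ v]]
      tprod_linear_left)
qed (simp_all add: tprod_linear_left)

lemma tprod_Nil:
  assumes "t \<in> tpow s n"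
  shows "tprod s (pure s []) t = t" and "tprod s t (pure s []) = t"
proof -
  have e: "pure s [] \<in> tpow s 0" by (rule pure_in_tpow) simp
  show "tprod s (pure s []) t = t"
    using assms by (induction rule: tpow_induct) (simp_all add: tprod_pure tprod_linear_right[OF e])
  show "tprod s t (pure s []) = t"
    using assms by (induction rule: tpow_induct) (simp_all add: tprod_pure tprod_linear_left)
qed


section \<open>The tensor powers of an algebra\<close>

text \<open>
  The maps that may be combined by \<open>tmap\<close>; the target degree \<open>d\<close> is 1 for endomorphisms of the algebra
  and 2 for the coproduct.
\<close>

definition linear_into ::
  "('f::field \<Rightarrow> 'h::ab_group_add \<Rightarrow> 'h) \<Rightarrow> nat \<Rightarrow> ('h \<Rightarrow> ('f, 'h) tensor) \<Rightarrow> bool"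
  where "linear_into s d f \<longleftrightarrow> Vector_Spaces.linear s tscale f \<and> (\<forall>x. f x \<in> tpow s d)"

lemma linear_intoD:
  assumes "linear_into s d f"
  shows "f x \<in> tpow s d" and "f (x + y) = f x + f y" and "f (s c x) = tscale c (f x)"
proof -
  interpret f: Vector_Spaces.linear s tscale f using assms by (simp add: linear_into_def)
  show "f x \<in> tpow s d" using assms by (simp add: linear_into_def)
  show "f (x + y) = f x + f y" and "f (s c x) = tscale c (f x)" by (fact f.add f.scale)+
qed

lemma tmap_Nil: "tmap s [] (pure s []) = pure s []"
  by (subst tmap_pure) simp_all

lemma tmap_Cons_pure:
  assumes "list_all2 (linear_into s) (d # ds) (f # fs)" and len: "length xs = length fs"
  shows "tmap s (f # fs) (pure s (x # xs)) = tprod s (f x) (tmap s fs (pure s xs))"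
proof -
  have "\<exists>d. linear_into s d g" if "g \<in> set (f # fs)" for g
    using that assms(1) unfolding list_all2_conv_all_nth in_set_conv_nth by metis
  then have lin: "Vector_Spaces.linear s tscale g" and "g x \<in> tensor.span (range (pure s))"
    if "g \<in> set (f # fs)" for g x
    using that tpow_in_span unfolding linear_into_def by blast+
  then have "tmap s (f # fs) (pure s (x # xs))
        = foldr (tprod s) (map2 (\<lambda>f x. f x) (f # fs) (x # xs)) (pure s [])"
    and "tmap s fs (pure s xs) = foldr (tprod s) (map2 (\<lambda>f x. f x) fs xs) (pure s [])"
    using len by (intro tmap_pure; simp)+
  then show ?thesis by simp
qed

lemma tmap_pure_tpow:
  assumes "list_all2 (linear_into s) ds fs" and "length xs = length fs"
  shows "tmap s fs (pure s xs) \<in> tpow s (sum_list ds)"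
  using assms
proof (induction arbitrary: xs rule: list_all2_induct)
  case Nil
  then show ?case by (simp add: tmap_Nil pure_in_tpow)
next
  case (Cons d ds f fs)
  then obtain x xs' where xs: "xs = x # xs'" by (cases xs) auto
  with Cons have "tmap s (f # fs) (pure s xs) = tprod s (f x) (tmap s fs (pure s xs'))"
    by (simp add: tmap_Cons_pure[where ds = ds and d = d])
  moreover have "tprod s (f x) (tmap s fs (pure s xs')) \<in> tpow s (d + sum_list ds)"
    using Cons xs by (intro tprod_tpow Cons.IH linear_intoD) auto
  ultimately show ?case by simp
qed

lemma tmap_tpow:
  assumes "list_all2 (linear_into s) ds fs" and "t \<in> tpow s (length fs)"
  shows "tmap s fs t \<in> tpow s (sum_list ds)"
  using assms(2)
  by (induction rule: tpow_induct)
    (simp_all add: tmap_pure_tpow[OF assms(1)] tmap_add tmap_scale tpow_add tpow_scale)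

lemma tmap_append_pure:
  assumes "list_all2 (linear_into s) ds fs" and gs: "list_all2 (linear_into s) es gs"
    and "length xs = length fs" and ys: "length ys = length gs"
  shows "tmap s (fs @ gs) (pure s (xs @ ys)) = tprod s (tmap s fs (pure s xs)) (tmap s gs (pure s ys))"
  using assms(1,3)
proof (induction arbitrary: xs rule: list_all2_induct)
  case Nil
  then show ?case using tprod_Nil(1)[OF tmap_pure_tpow[OF gs ys]] by (simp add: tmap_Nil)
next
  case (Cons d ds f fs)
  then obtain x xs' where xs: "xs = x # xs'" "length xs' = length fs" by (cases xs) auto
  have a: "list_all2 (linear_into s) (d # ds) (f # fs)"
    and b: "list_all2 (linear_into s) (d # (ds @ es)) (f # (fs @ gs))"
    using Cons gs by (auto intro: list_all2_appendI)
  have "tmap s ((f # fs) @ gs) (pure s (xs @ ys))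
      = tprod s (f x) (tprod s (tmap s fs (pure s xs')) (tmap s gs (pure s ys)))"
    using tmap_Cons_pure[OF b, of "xs' @ ys" x] Cons.IH[OF xs(2)] xs ys by simp
  also have "\<dots> = tprod s (tprod s (f x) (tmap s fs (pure s xs'))) (tmap s gs (pure s ys))"
    by (rule tprod_assoc[symmetric], rule linear_intoD[OF Cons(1)],
        rule tmap_pure_tpow[OF Cons(2) xs(2)], rule tmap_pure_tpow[OF gs ys])
  finally show ?case using tmap_Cons_pure[OF a xs(2)] xs by simp
qed

text \<open>
  Functoriality of the tensor product of maps, with the factors grouped in two blocks. Every later
  computation with \<open>tmap\<close> splits off the legs on which the map is the identity.
\<close>

lemma tmap_append:
  assumes fs: "list_all2 (linear_into s) ds fs" and gs: "list_all2 (linear_into s) es gs"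
    and t: "t \<in> tpow s (length fs)" and u: "u \<in> tpow s (length gs)"
  shows "tmap s (fs @ gs) (tprod s t u) = tprod s (tmap s fs t) (tmap s gs u)"
  using t
proof (induction rule: tpow_induct)
  case (pure xs)
  note xs = pure_in_tpow[OF pure] and fxs = tmap_pure_tpow[OF fs pure]
  from u show ?case
  proof (induction rule: tpow_induct)
    case (pure ys)
    with \<open>length xs = length fs\<close> show ?case
      by (simp add: tprod_pure tmap_append_pure[OF fs gs])
  qed (simp_all add: tprod_linear_right[OF xs] tmap_add tmap_scale
      tprod_add_right[OF fxs tmap_tpow[OF gs] tmap_tpow[OF gs]]
      tprod_scale_right[OF fxs tmap_tpow[OF gs]])
qed (simp_all add: tprod_linear_left tmap_add tmap_scale)


context k_algebra
begin

lemma linear_into_emb_comp: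
  assumes "Vector_Spaces.linear s s f"
  shows "linear_into s 1 (emb s \<circ> f)"
proof -
  interpret f: Vector_Spaces.linear s s f by fact
  have "Vector_Spaces.linear s tscale (emb s \<circ> f)"
    by unfold_locales
      (use pure_add[of s "[]" _ _ "[]"] pure_scale[of s "[]" _ _ "[]"] in \<open>simp_all add: f.add f.scale\<close>)
  then show ?thesis by (simp add: linear_into_def pure_in_tpow)
qed

lemma linear_into_emb: "linear_into s 1 (emb s)"
  using linear_into_emb_comp[OF linear_id] by (simp add: comp_def)

lemma list_all2_emb: "list_all2 (linear_into s) (replicate n 1) (replicate n (emb s))"
  using linear_into_emb by (simp add: list_all2_conv_all_nth)

lemma tmap_emb:
  assumes "t \<in> tpow s n"
  shows "tmap s (replicate n (emb s)) t = t"
proof -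
  have "tmap s (replicate (length xs) (emb s)) (pure s xs) = pure s xs" for xs
  proof (induction xs)
    case (Cons x xs)
    have "list_all2 (linear_into s) (1 # replicate (length xs) 1)
        (emb s # replicate (length xs) (emb s))"
      using list_all2_emb linear_into_emb by simp
    from tmap_Cons_pure[OF this, of xs] Cons show ?case by (simp add: tprod_pure)
  qed (simp add: tmap_Nil)
  with assms show ?thesis
    by (induction rule: tpow_induct) (auto simp: tmap_add tmap_scale)
qed

lemma tmap_first_pure:
  assumes f: "Vector_Spaces.linear s s f" and "length xs = k"
  shows "tmap s ((emb s \<circ> f) # replicate k (emb s)) (pure s (x # xs)) = pure s (f x # xs)"
proof -
  have "list_all2 (linear_into s) (1 # replicate k 1) ((emb s \<circ> f) # replicate k (emb s))"
    using list_all2_emb linear_into_emb_comp[OF f] by simp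
  from tmap_Cons_pure[OF this, of xs] assms(2) show ?thesis
    by (simp add: tprod_pure tmap_emb pure_in_tpow)
qed

lemma tmap_both_pure:
  assumes f: "Vector_Spaces.linear s s f" and g: "Vector_Spaces.linear s s g"
  shows "tmap s [emb s \<circ> f, emb s \<circ> g] (pure s [x, y]) = pure s [f x, g y]"
proof -
  note lin = linear_into_emb_comp[OF f] linear_into_emb_comp[OF g]
  have "list_all2 (linear_into s) [1, 1] [emb s \<circ> f, emb s \<circ> g]"
    and "list_all2 (linear_into s) [1] [emb s \<circ> g]" using lin by simp_all
  from tmap_Cons_pure[OF this(1), of "[y]"] tmap_Cons_pure[OF this(2), of "[]"] show ?thesis
    by (simp add: tprod_pure tmap_Nil)
qed

lemma tmult_pures: "length xs = length ys \<Longrightarrow> pure s xs \<cdot>\<^bsub>s\<^esub> pure s ys = pure s (map2 (*) xs ys)"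
  by (rule tmult_pure) (simp_all add: scale_mult_left mult_scale_right)

lemma tmult_pure_left:
  assumes "u \<in> tpow s n"
  shows "pure s xs \<cdot>\<^bsub>s\<^esub> u
    = tlift (\<lambda>ys. if length xs = length ys then pure s (map2 (*) xs ys) else 0) u"
proof -
  let ?m = "\<lambda>xs ys. if length xs = length ys then pure s (map2 (*) xs ys) else 0"
  have split: "\<exists>us' x' vs'. xs = us' @ x' # vs' \<and> length us' = length us \<and> length vs' = length vs"
    if "length xs = length us + Suc (length vs)" for xs us vs :: "'h list"
    using that
    by (intro exI[of _ "take (length us) xs"] exI[of _ "xs ! length us"]
        exI[of _ "drop (Suc (length us)) xs"]) (simp add: id_take_nth_drop[symmetric])
  have 1: "multilinear s tscale (?m xs)" for xs
    unfolding multilinear_def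
  proof (intro conjI allI)
    show "?m xs (us @ (x + y) # vs) = ?m xs (us @ x # vs) + ?m xs (us @ y # vs)" for us vs x y
      using split[of xs us vs] by (auto simp: distrib_left pure_add)
    show "?m xs (us @ s c x # vs) = tscale c (?m xs (us @ x # vs))" for us vs c x
      using split[of xs us vs] by (auto simp: mult_scale_right pure_scale tscale_zero)
  qed
  have 2: "multilinear s tscale (\<lambda>xs. ?m xs ys)" for ys
    unfolding multilinear_def
  proof (intro conjI allI)
    show "?m (us @ (x + y) # vs) ys = ?m (us @ x # vs) ys + ?m (us @ y # vs) ys" for us vs x y
      using split[of ys us vs] by (auto simp: distrib_right pure_add)
    show "?m (us @ s c x # vs) ys = tscale c (?m (us @ x # vs) ys)" for us vs c x
      using split[of ys us vs] by (auto simp: scale_mult_left pure_scale tscale_zero)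
  qed
  show ?thesis unfolding tmult_def by (rule tlift_pure[OF multilinear_tlift[OF 1 2 assms]])
qed

text \<open>
  By linearity in the left factor, that factor may be taken pure; the product is then a single linear
  extension, which is additive.
\<close>

lemma tmult_add_right:
  assumes "t \<in> tpow s m" and "u \<in> tpow s n" and "v \<in> tpow s n"
  shows "t \<cdot>\<^bsub>s\<^esub> (u + v) = t \<cdot>\<^bsub>s\<^esub> u + t \<cdot>\<^bsub>s\<^esub> v"
  using assms(1)
  by (induction rule: tpow_induct)
    (simp_all add: tmult_pure_left[OF assms(2)] tmult_pure_left[OF assms(3)]
      tmult_pure_left[OF tpow_add[OF assms(2,3)]] tlift_add tmult_add_left tmult_scale_left
      tscale_add ac_simps)

lemma tmult_scale_right:
  assumes "t \<in> tpow s m" and "u \<in> tpow s n"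
  shows "t \<cdot>\<^bsub>s\<^esub> tscale c u = tscale c (t \<cdot>\<^bsub>s\<^esub> u)"
  using assms(1)
  by (induction rule: tpow_induct)
    (simp_all add: tmult_pure_left[OF assms(2)] tmult_pure_left[OF tpow_scale[OF assms(2)]]
      tlift_scale tmult_add_left tmult_scale_left tscale_add mult.commute)

lemmas tmult_linear_left = tmult_add_left tmult_scale_left
lemmas tmult_linear_right = tmult_add_right tmult_scale_right

lemma tmult_tpow:
  assumes t: "t \<in> tpow s n" and u: "u \<in> tpow s n"
  shows "t \<cdot>\<^bsub>s\<^esub> u \<in> tpow s n"
  using t
proof (induction rule: tpow_induct)
  case (pure xs)
  note xs = pure_in_tpow[OF pure]
  from u show ?case
    by (induction rule: tpow_induct)
      (simp_all add: tmult_pures pure tmult_linear_right[OF xs] tpow_add tpow_scale pure_in_tpow)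
qed (simp_all add: tmult_linear_left tpow_add tpow_scale)

lemma tmult_assoc:
  assumes t: "t \<in> tpow s n" and u: "u \<in> tpow s n" and v: "v \<in> tpow s n"
  shows "t \<cdot>\<^bsub>s\<^esub> u \<cdot>\<^bsub>s\<^esub> v = t \<cdot>\<^bsub>s\<^esub> (u \<cdot>\<^bsub>s\<^esub> v)"
  using t
proof (induction rule: tpow_induct)
  case (pure xs)
  note xs = pure_in_tpow[OF pure]
  from u show ?case
  proof (induction rule: tpow_induct)
    case (pure ys)
    note ys = pure_in_tpow[OF pure]
    from v show ?case
    proof (induction rule: tpow_induct)
      case (pure zs)
      have "map2 (*) (map2 (*) xs ys) zs = map2 (*) xs (map2 (*) ys zs)"
        using \<open>length xs = n\<close> \<open>length ys = n\<close> pure by (intro nth_equalityI) (auto simp: mult.assoc)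
      then show ?case using \<open>length xs = n\<close> \<open>length ys = n\<close> pure by (simp add: tmult_pures)
    qed (simp_all add: tmult_linear_right[OF tmult_tpow[OF xs ys]] tmult_linear_right[OF ys]
        tmult_add_right[OF xs tmult_tpow[OF ys] tmult_tpow[OF ys]]
        tmult_scale_right[OF xs tmult_tpow[OF ys]])
  qed (simp_all add: tmult_linear_right[OF xs] tmult_linear_left
      tmult_add_right[OF xs tmult_tpow[OF _ v] tmult_tpow[OF _ v]]
      tmult_scale_right[OF xs tmult_tpow[OF _ v]])
qed (simp_all add: tmult_linear_left)

lemma tmult_one:
  assumes "t \<in> tpow s n"
  shows "pure s (replicate n 1) \<cdot>\<^bsub>s\<^esub> t = t" and "t \<cdot>\<^bsub>s\<^esub> pure s (replicate n 1) = t"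
proof -
  have one: "pure s (replicate n 1) \<in> tpow s n" by (simp add: pure_in_tpow)
  have 1: "map2 (*) (replicate n 1) xs = xs" "map2 (*) xs (replicate n 1) = xs"
    if "length xs = n" for xs :: "'h list"
    using that by (auto intro: nth_equalityI)
  show "pure s (replicate n 1) \<cdot>\<^bsub>s\<^esub> t = t"
    using assms
    by (induction rule: tpow_induct) (simp_all add: tmult_pures 1 tmult_linear_right[OF one])
  show "t \<cdot>\<^bsub>s\<^esub> pure s (replicate n 1) = t"
    using assms by (induction rule: tpow_induct) (simp_all add: tmult_pures 1 tmult_linear_left)
qed

lemma tpow_monoid_simps:
  "carrier (tpow_monoid s n) = tpow s n"
  "t \<otimes>\<^bsub>tpow_monoid s n\<^esub> u = t \<cdot>\<^bsub>s\<^esub> u"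
  "\<one>\<^bsub>tpow_monoid s n\<^esub> = pure s (replicate n 1)"
  by (simp_all add: tpow_monoid_def)

lemma monoid_tpow: "monoid (tpow_monoid s n)"
  by (rule monoidI) (simp_all add: tpow_monoid_simps tmult_tpow tmult_assoc tmult_one pure_in_tpow)

text \<open>
  Linear maps between tensor powers are algebra homomorphisms as soon as they are multiplicative on
  pure tensors. This covers permutations of legs, insertions of units and maps applied to single legs.
\<close>

lemma multiplicative_if_on_pure:
  assumes add: "\<And>t u. f (t + u) = f t + f u" and scale: "\<And>c t. f (tscale c t) = tscale c (f t)"
    and into: "\<And>xs. length xs = m \<Longrightarrow> f (pure s xs) \<in> tpow s n"
    and pure: "\<And>xs ys. length xs = m \<Longrightarrow> length ys = m \<Longrightarrow>
      f (pure s (map2 (*) xs ys)) = f (pure s xs) \<cdot>\<^bsub>s\<^esub> f (pure s ys)"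
    and t: "t \<in> tpow s m" and u: "u \<in> tpow s m"
  shows "f (t \<cdot>\<^bsub>s\<^esub> u) = f t \<cdot>\<^bsub>s\<^esub> f u"
proof -
  have f: "f v \<in> tpow s n" if "v \<in> tpow s m" for v
    using that by (induction rule: tpow_induct) (simp_all add: into add scale tpow_add tpow_scale)
  show ?thesis using t
  proof (induction rule: tpow_induct)
    case (pure xs)
    note xs = pure_in_tpow[OF pure] and fxs = into[OF pure]
    from u show ?case
    proof (induction rule: tpow_induct)
      case (pure ys)
      with \<open>length xs = m\<close> show ?case by (simp add: tmult_pures assms(4))
    qed (simp_all add: tmult_linear_right[OF xs] add scale tmult_add_right[OF fxs f f]
        tmult_scale_right[OF fxs f])
  qed (simp_all add: tmult_linear_left add scale)
qed

lemma tprod_tmult: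
  assumes t: "t \<in> tpow s m" "t' \<in> tpow s m" and u: "u \<in> tpow s n" "u' \<in> tpow s n"
  shows "tprod s t u \<cdot>\<^bsub>s\<^esub> tprod s t' u' = tprod s (t \<cdot>\<^bsub>s\<^esub> t') (u \<cdot>\<^bsub>s\<^esub> u')"
  using t(1)
proof (induction rule: tpow_induct)
  case (pure xs)
  note xs = pure_in_tpow[OF pure]
  from u(1) show ?case
  proof (induction rule: tpow_induct)
    case (pure ys)
    note ys = pure_in_tpow[OF pure]
    note xy = tprod_tpow[OF xs ys]
    from t(2) show ?case
    proof (induction rule: tpow_induct)
      case (pure xs')
      note xs' = pure_in_tpow[OF pure]
      note xx = tmult_tpow[OF xs xs']
      from u(2) show ?case
      proof (induction rule: tpow_induct)
        case (pure ys')
        with \<open>length xs = m\<close> \<open>length xs' = m\<close> \<open>length ys = n\<close> show ?case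
          by (simp add: tmult_pures tprod_pure)
      qed (simp_all add: tprod_linear_right[OF xs'] tmult_linear_right[OF ys]
          tmult_add_right[OF xy tprod_tpow[OF xs'] tprod_tpow[OF xs']]
          tmult_scale_right[OF xy tprod_tpow[OF xs']]
          tprod_add_right[OF xx tmult_tpow[OF ys] tmult_tpow[OF ys]]
          tprod_scale_right[OF xx tmult_tpow[OF ys]])
    qed (simp_all add: tprod_linear_left tmult_linear_right[OF xs]
        tmult_add_right[OF xy tprod_tpow[OF _ u(2)] tprod_tpow[OF _ u(2)]]
        tmult_scale_right[OF xy tprod_tpow[OF _ u(2)]])
  qed (simp_all add: tprod_linear_right[OF xs] tmult_linear_left
      tprod_add_right[OF tmult_tpow[OF xs t(2)] tmult_tpow[OF _ u(2)] tmult_tpow[OF _ u(2)]]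
      tprod_scale_right[OF tmult_tpow[OF xs t(2)] tmult_tpow[OF _ u(2)]])
qed (simp_all add: tprod_linear_left tmult_linear_left)

end


section \<open>Permuting tensor factors and placing tensors on legs\<close>

lemma tensor_eqI:
  assumes "t \<in> tpow s n"
    and "\<And>t u. f (t + u) = f t + f u" "\<And>c t. f (tscale c t) = tscale c (f t)"
    and "\<And>t u. g (t + u) = g t + g u" "\<And>c t. g (tscale c t) = tscale c (g t)"
    and "\<And>xs. length xs = n \<Longrightarrow> f (pure s xs) = g (pure s xs)"
  shows "f t = g t"
  using assms(1) by (induction rule: tpow_induct) (simp_all add: assms(2-))

lemma tensor2_eqI:
  fixes s :: "'f::field \<Rightarrow> 'h::ab_group_add \<Rightarrow> 'h"
  assumes "t \<in> tpow s 2"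
    and "\<And>t u. f (t + u) = f t + f u" "\<And>c t. f (tscale c t) = tscale c (f t)"
    and "\<And>t u. g (t + u) = g t + g u" "\<And>c t. g (tscale c t) = tscale c (g t)"
    and "\<And>x y. f (pure s [x, y]) = g (pure s [x, y])"
  shows "f t = g t"
  using assms(1)
proof (rule tensor_eqI[where f = f and g = g, OF _ assms(2-5)])
  fix xs :: "'h list" assume "length xs = 2"
  then obtain x y where "xs = [x, y]" by (auto simp: numeral_2_eq_2 length_Suc_conv)
  then show "f (pure s xs) = g (pure s xs)" using assms(6) by simp
qed

lemma tensor_into:
  assumes "t \<in> tpow s n"
    and "\<And>t u. f (t + u) = f t + f u" "\<And>c t. f (tscale c t) = tscale c (f t)"
    and "\<And>xs. length xs = n \<Longrightarrow> f (pure s xs) \<in> tpow s m"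
  shows "f t \<in> tpow s m"
  using assms(1) by (induction rule: tpow_induct) (simp_all add: assms(2-) tpow_add tpow_scale)

lemma tperm_tpow: "p permutes {..<n} \<Longrightarrow> t \<in> tpow s n \<Longrightarrow> tperm s n p t \<in> tpow s n"
  by (rule tensor_into[where f = "tperm s n p"])
    (auto simp: tperm_add tperm_scale tperm_pure pure_in_tpow)

text \<open>
  The order of composition is reversed, since \<open>permute_list p xs\<close> has the entry \<open>xs ! p k\<close> at position \<open>k\<close>.
\<close>

lemma tperm_comp:
  assumes p: "p permutes {..<n}" and q: "q permutes {..<n}" and t: "t \<in> tpow s n"
  shows "tperm s n p (tperm s n q t) = tperm s n (q \<circ> p) t"
  using t
  by (rule tensor_eqI[where f = "\<lambda>t. tperm s n p (tperm s n q t)" and g = "tperm s n (q \<circ> p)"])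
    (auto simp: tperm_add tperm_scale tperm_pure[OF p] tperm_pure[OF q]
      tperm_pure[OF permutes_compose[OF p q]] permute_list_compose p simp del: o_apply)

lemma tperm_id: "t \<in> tpow s n \<Longrightarrow> tperm s n id t = t"
  by (rule tensor_eqI[where f = "tperm s n id"])
    (auto simp: tperm_add tperm_scale tperm_pure[OF permutes_id])

lemma pred_less: "i \<in> {1..n} \<Longrightarrow> i - 1 < (n::nat)"
  by (cases i) auto

lemma tswap_permutes:
  fixes i j n :: nat
  assumes "i \<in> {1..n}" and "j \<in> {1..n}"
  shows "transpose (i - 1) (j - 1) permutes {..<n}"
  using pred_less[OF assms(1)] pred_less[OF assms(2)] by (intro permutes_swap_id) simp_all

lemma pred_neq: "i \<in> {1..n} \<Longrightarrow> k \<in> {1..n} \<Longrightarrow> i \<noteq> k \<Longrightarrow> i - 1 \<noteq> k - (1::nat)"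
  by (simp; arith)

lemma tswap_pure:
  "i \<in> {1..n} \<Longrightarrow> j \<in> {1..n} \<Longrightarrow> length xs = n \<Longrightarrow>
    tswap s n i j (pure s xs) = pure s (permute_list (transpose (i - 1) (j - 1)) xs)"
  unfolding tswap_def by (intro tperm_pure tswap_permutes)

lemma tswap_tpow: "i \<in> {1..n} \<Longrightarrow> j \<in> {1..n} \<Longrightarrow> t \<in> tpow s n \<Longrightarrow> tswap s n i j t \<in> tpow s n"
  unfolding tswap_def by (intro tperm_tpow tswap_permutes)

lemma tswap_tswap:
  assumes "i \<in> {1..n}" and "j \<in> {1..n}" and "t \<in> tpow s n"
  shows "tswap s n i j (tswap s n i j t) = t"
  unfolding tswap_def
    tperm_comp[OF tswap_permutes[OF assms(1,2)] tswap_permutes[OF assms(1,2)] assms(3)]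
  by (simp add: tperm_id[unfolded id_def] assms(3) comp_def)

lemma tswap_commute:
  assumes i: "i \<in> {1..n}" and j: "j \<in> {1..n}" and k: "k \<in> {1..n}" and l: "l \<in> {1..n}"
    and ne: "i \<noteq> k" "i \<noteq> l" "j \<noteq> k" "j \<noteq> l" and t: "t \<in> tpow s n"
  shows "tswap s n i j (tswap s n k l t) = tswap s n k l (tswap s n i j t)"
proof -
  have "transpose (k - 1) (l - 1) \<circ> transpose (i - 1) (j - 1)
      = transpose (i - 1) (j - 1) \<circ> transpose (k - 1) (l - 1)"
    using pred_neq[OF i k ne(1)] pred_neq[OF i l ne(2)] pred_neq[OF j k ne(3)] pred_neq[OF j l ne(4)]
    by (simp add: fun_eq_iff transpose_def)
  then show ?thesis
    unfolding tswap_def tperm_comp[OF tswap_permutes[OF i j] tswap_permutes[OF k l] t]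
      tperm_comp[OF tswap_permutes[OF k l] tswap_permutes[OF i j] t] by (rule arg_cong)
qed

lemma tswap_braid:
  assumes i: "i \<in> {1..n}" and j: "j \<in> {1..n}" and k: "k \<in> {1..n}"
    and ne: "i \<noteq> j" "j \<noteq> k" "i \<noteq> k" and t: "t \<in> tpow s n"
  shows "tswap s n i j (tswap s n j k (tswap s n i j t)) = tswap s n j k (tswap s n i j (tswap s n j k t))"
proof -
  note ij = tswap_permutes[OF i j] and jk = tswap_permutes[OF j k]
  have "transpose (i - 1) (j - 1) \<circ> transpose (j - 1) (k - 1) \<circ> transpose (i - 1) (j - 1)
      = transpose (j - 1) (k - 1) \<circ> transpose (i - 1) (j - 1) \<circ> transpose (j - 1) (k - 1)"
    using pred_neq[OF i j ne(1)] pred_neq[OF j k ne(2)] pred_neq[OF i k ne(3)]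
    by (simp add: fun_eq_iff transpose_def)
  then show ?thesis
    unfolding tswap_def tperm_comp[OF jk ij t] tperm_comp[OF ij jk t]
      tperm_comp[OF ij permutes_compose[OF jk ij] t] tperm_comp[OF jk permutes_compose[OF ij jk] t]
    by (rule arg_cong)
qed

lemma nth_replicate_update2:
  "m < n \<Longrightarrow> (replicate n c)[i := x, j := y] ! m = (if m = j then y else if m = i then x else c)"
  by (cases "m = j"; cases "m = i") simp_all

lemma flip_tpow: "t \<in> tpow s 2 \<Longrightarrow> flip s t \<in> tpow s 2"
  by (rule tswap_tpow) auto

lemma flip_flip: "t \<in> tpow s 2 \<Longrightarrow> flip s (flip s t) = t"
  by (rule tswap_tswap) auto

lemma leg_tpow:
  fixes s :: "'f::field \<Rightarrow> 'h::ring_1 \<Rightarrow> 'h"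
  assumes "i \<in> {1..n}" "j \<in> {1..n}" "i \<noteq> j" "t \<in> tpow s 2"
  shows "leg s n i j t \<in> tpow s n"
  using assms(4)
proof (rule tensor_into[where f = "leg s n i j"])
  fix xs :: "'h list" assume "length xs = 2"
  then obtain x y where "xs = [x, y]" by (auto simp: numeral_2_eq_2 length_Suc_conv)
  then show "leg s n i j (pure s xs) \<in> tpow s n"
    using assms by (simp add: leg_pure pure_in_tpow)
qed (simp_all add: leg_add leg_scale)

lemma leg_flip:
  assumes "i \<in> {1..n}" "j \<in> {1..n}" "i \<noteq> j" "t \<in> tpow s 2"
  shows "leg s n i j (flip s t) = leg s n j i t"
  using assms(4)
proof (rule tensor2_eqI[where f = "\<lambda>t. leg s n i j (flip s t)"])
  fix x y
  show "leg s n i j (flip s (pure s [x, y])) = leg s n j i (pure s [x, y])"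
  proof -
    have "i - 1 \<noteq> j - 1" using pred_neq assms(1-3) by blast
    then show ?thesis unfolding flip_pure using assms by (simp add: leg_pure list_update_swap)
  qed
qed (simp_all add: leg_add leg_scale tswap_add tswap_scale)

lemma leg_id:
  fixes s :: "'f::field \<Rightarrow> 'h::ring_1 \<Rightarrow> 'h"
  assumes "t \<in> tpow s 2"
  shows "leg s 2 1 2 t = t"
proof -
  have "leg s 2 1 2 (pure s [x, y]) = pure s [x, y]" for x y :: 'h
    by (subst leg_pure) (simp_all add: numeral_2_eq_2)
  then show ?thesis
    by (intro tensor2_eqI[where f = "leg s 2 1 2" and g = "\<lambda>t. t", OF assms])
      (simp_all only: leg_add leg_scale)
qed

lemma tswap_leg:
  fixes s :: "'f::field \<Rightarrow> 'h::ring_1 \<Rightarrow> 'h"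
  assumes "i \<in> {1..n}" "j \<in> {1..n}" "i \<noteq> j" "k \<in> {1..n}" "l \<in> {1..n}" "t \<in> tpow s 2"
  shows "tswap s n k l (leg s n i j t) = leg s n (transpose k l i) (transpose k l j) t"
  using assms(6)
proof (rule tensor2_eqI[where f = "\<lambda>t. tswap s n k l (leg s n i j t)"])
  fix x y :: 'h
  have 1: "transpose k l i \<in> {1..n}" "transpose k l j \<in> {1..n}" "transpose k l i \<noteq> transpose k l j"
    using assms by (auto simp: transpose_def)
  have "permute_list (transpose (k - 1) (l - 1)) ((replicate n 1)[i - 1 := x, j - 1 := y])
      = (replicate n 1)[transpose k l i - 1 := x, transpose k l j - 1 := y]" (is "?l = ?r")
  proof (rule nth_equalityI)
    fix m assume "m < length ?l"
    then have m: "m < n" by simp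
    obtain i' j' k' l' where pred: "i = Suc i'" "j = Suc j'" "k = Suc k'" "l = Suc l'"
      using assms by (cases i; cases j; cases k; cases l) auto
    have Suc: "transpose (Suc k') (Suc l') (Suc u) = Suc (transpose k' l' u)" for u
      by (simp add: transpose_def)
    have "transpose k' l' m < n"
      using m assms pred by (simp add: transpose_def)
    moreover have "transpose k' l' m = u \<longleftrightarrow> m = transpose k' l' u" for u
      by (auto simp: transpose_def)
    ultimately show "?l ! m = ?r ! m"
      using m by (simp add: pred Suc permute_list_def nth_replicate_update2)
  qed simp
  then show "tswap s n k l (leg s n i j (pure s [x, y]))
      = leg s n (transpose k l i) (transpose k l j) (pure s [x, y])"
    using assms 1 by (simp add: leg_pure tswap_pure)
qed (simp_all add: leg_add leg_scale tswap_add tswap_scale)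


context k_algebra
begin

lemma leg_tmult:
  assumes ij: "i \<in> {1..n}" "j \<in> {1..n}" "i \<noteq> j" and t: "t \<in> tpow s 2" and u: "u \<in> tpow s 2"
  shows "leg s n i j (t \<cdot>\<^bsub>s\<^esub> u) = leg s n i j t \<cdot>\<^bsub>s\<^esub> leg s n i j u"
  using leg_add leg_scale _ _ t u
proof (rule multiplicative_if_on_pure[where n = n])
  fix xs ys :: "'h list" assume "length xs = 2" "length ys = 2"
  then obtain x y x' y' where xy: "xs = [x, y]" "ys = [x', y']"
    by (auto simp: numeral_2_eq_2 length_Suc_conv)
  have "map2 (*) ((replicate n 1)[i - 1 := x, j - 1 := y]) ((replicate n 1)[i - 1 := x', j - 1 := y'])
      = (replicate n 1)[i - 1 := x * x', j - 1 := y * y']"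
  proof (rule nth_equalityI)
    fix m assume "m < length (map2 (*) ((replicate n 1)[i - 1 := x, j - 1 := y])
        ((replicate n 1)[i - 1 := x', j - 1 := y']))"
    then show "map2 (*) ((replicate n 1)[i - 1 := x, j - 1 := y])
        ((replicate n 1)[i - 1 := x', j - 1 := y']) ! m
      = (replicate n 1)[i - 1 := x * x', j - 1 := y * y'] ! m"
      using pred_neq[OF ij] by (simp add: nth_replicate_update2)
  qed simp
  then show "leg s n i j (pure s (map2 (*) xs ys)) = leg s n i j (pure s xs) \<cdot>\<^bsub>s\<^esub> leg s n i j (pure s ys)"
    using ij by (simp add: xy leg_pure tmult_pures)
qed (use ij in \<open>simp add: leg_tpow pure_in_tpow\<close>)

lemma leg_commute:
  assumes ij: "i \<in> {1..n}" "j \<in> {1..n}" "i \<noteq> j" and kl: "k \<in> {1..n}" "l \<in> {1..n}" "k \<noteq> l"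
    and ne: "i \<noteq> k" "i \<noteq> l" "j \<noteq> k" "j \<noteq> l" and t: "t \<in> tpow s 2" and u: "u \<in> tpow s 2"
  shows "leg s n i j t \<cdot>\<^bsub>s\<^esub> leg s n k l u = leg s n k l u \<cdot>\<^bsub>s\<^esub> leg s n i j t"
  using t
proof (induction rule: tpow_induct)
  case (pure xs)
  then obtain x y where xs: "xs = [x, y]" by (auto simp: numeral_2_eq_2 length_Suc_conv)
  note lx = leg_tpow[OF ij pure_in_tpow[OF pure]]
  from u show ?case
  proof (induction rule: tpow_induct)
    case (pure ys)
    then obtain x' y' where ys: "ys = [x', y']" by (auto simp: numeral_2_eq_2 length_Suc_conv)
    have "map2 (*) ((replicate n 1)[i - 1 := x, j - 1 := y]) ((replicate n 1)[k - 1 := x', l - 1 := y'])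
      = map2 (*) ((replicate n 1)[k - 1 := x', l - 1 := y']) ((replicate n 1)[i - 1 := x, j - 1 := y])"
    proof (rule nth_equalityI)
      fix m assume "m < length (map2 (*) ((replicate n 1)[i - 1 := x, j - 1 := y])
        ((replicate n 1)[k - 1 := x', l - 1 := y']))"
      moreover note pred_neq[OF ij(1) kl(1) ne(1)] pred_neq[OF ij(1) kl(2) ne(2)]
        pred_neq[OF ij(2) kl(1) ne(3)] pred_neq[OF ij(2) kl(2) ne(4)]
      ultimately show "map2 (*) ((replicate n 1)[i - 1 := x, j - 1 := y])
          ((replicate n 1)[k - 1 := x', l - 1 := y']) ! m
        = map2 (*) ((replicate n 1)[k - 1 := x', l - 1 := y'])
          ((replicate n 1)[i - 1 := x, j - 1 := y]) ! m"
        by (simp add: nth_replicate_update2)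
    qed simp
    with ij kl show ?case by (simp add: xs ys leg_pure tmult_pures)
  qed (simp_all add: leg_add leg_scale tmult_linear_left tmult_add_right[OF lx leg_tpow[OF kl] leg_tpow[OF kl]]
      tmult_scale_right[OF lx leg_tpow[OF kl]])
qed (simp_all add: leg_add leg_scale tmult_linear_left
    tmult_add_right[OF leg_tpow[OF kl u] leg_tpow[OF ij] leg_tpow[OF ij]]
    tmult_scale_right[OF leg_tpow[OF kl u] leg_tpow[OF ij]])

lemma leg_one: "i \<in> {1..n} \<Longrightarrow> j \<in> {1..n} \<Longrightarrow> i \<noteq> j \<Longrightarrow> leg s n i j (pure s [1, 1]) = pure s (replicate n 1)"
  by (auto simp: leg_pure nth_replicate_update2 intro!: arg_cong[where f = "pure s"] nth_equalityI)

lemma leg_Units: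
  assumes ij: "i \<in> {1..n}" "j \<in> {1..n}" "i \<noteq> j" and "t \<in> Units (tpow_monoid s 2)"
  shows "leg s n i j t \<in> Units (tpow_monoid s n)"
proof -
  obtain u where u: "t \<in> tpow s 2" "u \<in> tpow s 2" "t \<cdot>\<^bsub>s\<^esub> u = pure s [1, 1]" "u \<cdot>\<^bsub>s\<^esub> t = pure s [1, 1]"
    using assms(4) by (auto simp: Units_def tpow_monoid_simps numeral_2_eq_2)
  have "leg s n i j t \<cdot>\<^bsub>s\<^esub> leg s n i j u = pure s (replicate n 1)"
    and "leg s n i j u \<cdot>\<^bsub>s\<^esub> leg s n i j t = pure s (replicate n 1)"
    using u ij by (simp_all add: leg_one flip: leg_tmult)
  then show ?thesis
    using u(1,2) ij unfolding Units_def tpow_monoid_simps by (blast intro: leg_tpow)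
qed

lemma tswap_tmult:
  assumes ij: "i \<in> {1..n}" "j \<in> {1..n}" and t: "t \<in> tpow s n" and u: "u \<in> tpow s n"
  shows "tswap s n i j (t \<cdot>\<^bsub>s\<^esub> u) = tswap s n i j t \<cdot>\<^bsub>s\<^esub> tswap s n i j u"
  using tswap_add tswap_scale _ _ t u
proof (rule multiplicative_if_on_pure[where n = n])
  fix xs ys :: "'h list" assume len: "length xs = n" "length ys = n"
  then have "permute_list p (map2 (*) xs ys) = map2 (*) (permute_list p xs) (permute_list p ys)"
    if "p permutes {..<n}" for p
    using that by (simp add: permute_list_map permute_list_zip)
  from this[OF tswap_permutes[OF ij]] len ij
  show "tswap s n i j (pure s (map2 (*) xs ys)) = tswap s n i j (pure s xs) \<cdot>\<^bsub>s\<^esub> tswap s n i j (pure s ys)"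
    by (simp add: tswap_pure tmult_pures)
qed (use ij in \<open>simp add: tswap_tpow pure_in_tpow\<close>)

end


subsection \<open>Padding with units\<close>

text \<open>
  The embedding \<open>t \<mapsto> 1 \<otimes> t \<otimes> 1\<close> of a tensor power as a block of adjacent legs. It transports identities
  between elements of a small tensor power, such as the Yang-Baxter equation, to any degree.
\<close>

definition pad :: "('f::field \<Rightarrow> 'h::ring_1 \<Rightarrow> 'h) \<Rightarrow> nat \<Rightarrow> nat \<Rightarrow> ('f, 'h) tensor \<Rightarrow> ('f, 'h) tensor"
  where "pad s a b t = tprod s (pure s (replicate a 1)) (tprod s t (pure s (replicate b 1)))"

lemma pad_leg:
  fixes s :: "'f::field \<Rightarrow> 'h::ring_1 \<Rightarrow> 'h"
  assumes pq: "p \<in> {1..m}" "q \<in> {1..m}" "p \<noteq> q" and t: "t \<in> tpow s 2"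
  shows "pad s a b (leg s m p q t) = leg s (a + (m + b)) (a + p) (a + q) t"
  using t
proof (induction rule: tpow_induct)
  case (pure xs)
  then obtain x y where xs: "xs = [x, y]" by (auto simp: numeral_2_eq_2 length_Suc_conv)
  have "replicate a 1 @ (replicate m 1)[p - 1 := x, q - 1 := y] @ replicate b 1
      = (replicate (a + (m + b)) 1)[a + p - 1 := x, a + q - 1 := y]"
  proof (rule nth_equalityI)
    fix l assume "l < length (replicate a 1 @ (replicate m 1)[p - 1 := x, q - 1 := y] @ replicate b 1)"
    then have "l < a + (m + b)" by simp
    then consider "l < a" | r where "l = a + r" "r < m" | r where "l = a + (m + r)" "r < b"
      by (metis add_less_cancel_left le_Suc_ex not_less)
    then show "(replicate a 1 @ (replicate m 1)[p - 1 := x, q - 1 := y] @ replicate b 1) ! l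
        = (replicate (a + (m + b)) 1)[a + p - 1 := x, a + q - 1 := y] ! l"
    proof cases
      case 1
      then have "l \<noteq> a + p - 1" "l \<noteq> a + q - 1" using pq by auto
      with 1 show ?thesis by (simp add: nth_append nth_replicate_update2)
    next
      case 2
      then have "l = a + p - 1 \<longleftrightarrow> r = p - 1" "l = a + q - 1 \<longleftrightarrow> r = q - 1" using pq by auto
      with 2 show ?thesis by (simp add: nth_append nth_replicate_update2)
    next
      case 3
      then have "l \<noteq> a + p - 1" "l \<noteq> a + q - 1" using pq by auto
      with 3 show ?thesis by (simp add: nth_append nth_replicate_update2)
    qed
  qed simp
  with pq show ?case by (simp add: xs leg_pure pad_def tprod_pure)
next
  case (add u v)
  have one: "pure s (replicate k 1) \<in> tpow s k" for k by (simp add: pure_in_tpow)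
  note in_m = leg_tpow[OF pq add(1)] leg_tpow[OF pq add(2)]
  show ?case using add
    by (simp add: pad_def leg_add tprod_linear_left
        tprod_add_right[OF one tprod_tpow[OF in_m(1) one] tprod_tpow[OF in_m(2) one]])
next
  case (scale c u)
  have one: "pure s (replicate k 1) \<in> tpow s k" for k by (simp add: pure_in_tpow)
  show ?case using scale
    by (simp add: pad_def leg_scale tprod_linear_left
        tprod_scale_right[OF one tprod_tpow[OF leg_tpow[OF pq] one]])
qed

lemma (in k_algebra) pad_tmult:
  assumes t: "t \<in> tpow s m" and u: "u \<in> tpow s m"
  shows "pad s a b (t \<cdot>\<^bsub>s\<^esub> u) = pad s a b t \<cdot>\<^bsub>s\<^esub> pad s a b u"
proof -
  have one: "pure s (replicate k 1) \<in> tpow s k" for k by (simp add: pure_in_tpow)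
  show ?thesis
    unfolding pad_def
    by (simp add: tprod_tmult[OF one one tprod_tpow[OF t one] tprod_tpow[OF u one]]
        tprod_tmult[OF t u one one] tmult_one one)
qed

text \<open>
  Transposing two adjacent legs only affects the degree 2 tensor on these legs.
\<close>

lemma tswap_sandwich:
  fixes s :: "'f::field \<Rightarrow> 'h::ab_group_add \<Rightarrow> 'h"
  assumes n: "n = length us + (2 + length vs)" and k: "k = Suc (length us)" and t: "t \<in> tpow s 2"
  shows "tswap s n k (k + 1) (tprod s (pure s us) (tprod s t (pure s vs)))
    = tprod s (pure s us) (tprod s (flip s t) (pure s vs))"
  using t
proof (induction rule: tpow_induct)
  case (pure xs)
  then obtain x y where xs: "xs = [x, y]" by (auto simp: numeral_2_eq_2 length_Suc_conv)
  have "permute_list (transpose (k - 1) k) (us @ [x, y] @ vs) = us @ [y, x] @ vs" (is "?l = ?r")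
  proof (rule nth_equalityI)
    fix m assume "m < length ?l"
    then have m: "m < length us + (2 + length vs)" by simp
    have "m < length us \<or> m = length us \<or> m = Suc (length us)
        \<or> (\<exists>r<length vs. m = length us + Suc (Suc r))"
      using m by presburger
    then consider "m < length us" | "m = length us" | "m = Suc (length us)"
      | r where "m = length us + Suc (Suc r)" "r < length vs" by blast
    moreover have "?l ! m = (us @ [x, y] @ vs) ! transpose (k - 1) k m"
      using m by (simp add: permute_list_def del: upt_Suc)
    ultimately show "?l ! m = ?r ! m"
      by cases (simp_all add: k transpose_def nth_append)
  qed simp
  then have "tswap s n k (k + 1) (pure s (us @ [x, y] @ vs)) = pure s (us @ [y, x] @ vs)"
    using n k by (simp add: tswap_pure)
  then show ?case unfolding xs flip_pure tprod_pure .
next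
  case (add u v)
  have p: "pure s ws \<in> tpow s (length ws)" for ws by (simp add: pure_in_tpow)
  note in_2 = flip_tpow[OF add(1)] flip_tpow[OF add(2)]
  show ?case using add
    by (simp add: tswap_add tprod_linear_left
        tprod_add_right[OF p tprod_tpow[OF add(1) p] tprod_tpow[OF add(2) p]]
        tprod_add_right[OF p tprod_tpow[OF in_2(1) p] tprod_tpow[OF in_2(2) p]] del: One_nat_def)
next
  case (scale c u)
  have p: "pure s ws \<in> tpow s (length ws)" for ws by (simp add: pure_in_tpow)
  show ?case using scale
    by (simp add: tswap_scale tprod_linear_left tprod_scale_right[OF p tprod_tpow[OF scale(1) p]]
        tprod_scale_right[OF p tprod_tpow[OF flip_tpow[OF scale(1)] p]] del: One_nat_def)
qed


section \<open>Iterated coproducts\<close>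

context bialgebra
begin

abbreviation comult_at :: "nat \<Rightarrow> nat \<Rightarrow> ('f, 'h) tensor \<Rightarrow> ('f, 'h) tensor"
  where "comult_at i j \<equiv> tmap s (replicate i (emb s) @ \<Delta> # replicate j (emb s))"

lemma linear_into_comult: "linear_into s 2 \<Delta>"
  using comult_linear comult_tpow by (simp add: linear_into_def)

lemma list_all2_comult_at:
  "list_all2 (linear_into s) (replicate i 1 @ 2 # replicate j 1)
    (replicate i (emb s) @ \<Delta> # replicate j (emb s))"
  using list_all2_emb linear_into_comult by (intro list_all2_appendI) simp_all

lemma list_all2_comult_at_0:
  "list_all2 (linear_into s) (2 # replicate j 1) (\<Delta> # replicate j (emb s))"
  using list_all2_comult_at[of 0 j] by simp

lemma comult_at_tpow: "t \<in> tpow s (i + Suc j) \<Longrightarrow> comult_at i j t \<in> tpow s (i + (2 + j))"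
  using tmap_tpow[OF list_all2_comult_at, of t i j] by (simp add: sum_list_replicate)

lemma comult_at_0_pure:
  assumes "length vs = j"
  shows "comult_at 0 j (pure s (x # vs)) = tprod s (\<Delta> x) (pure s vs)"
  using tmap_Cons_pure[OF list_all2_comult_at_0, of vs j x] assms
  by (simp add: tmap_emb pure_in_tpow)

lemma comult_at_pure:
  assumes "length us = i" and "length vs = j"
  shows "comult_at i j (pure s (us @ x # vs)) = tprod s (pure s us) (tprod s (\<Delta> x) (pure s vs))"
  using tmap_append_pure[OF list_all2_emb[of i] list_all2_comult_at_0[of j], of us "x # vs"]
    comult_at_0_pure[OF assms(2), of x] assms by (simp add: tmap_emb pure_in_tpow)

lemma comult_iter_Suc: "comult_iter s \<Delta> (Suc k) x = comult_at 0 k (comult_iter s \<Delta> k x)"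
  by simp

lemma comult_iter_tpow: "comult_iter s \<Delta> k x \<in> tpow s (Suc k)"
proof (induction k)
  case 0
  show ?case by (simp add: pure_in_tpow)
next
  case (Suc k)
  then show ?case using comult_at_tpow[of _ 0 k] by simp
qed

text \<open>
  Coproducts on two different legs commute; the coproduct on the first leg shifts the position of the
  other one by 1.
\<close>

lemma comult_at_comult_at_disjoint:
  assumes "t \<in> tpow s (Suc (a + Suc b))"
  shows "comult_at (Suc (Suc a)) b (comult_at 0 (a + Suc b) t)
    = comult_at 0 (a + (2 + b)) (comult_at (Suc a) b t)"
  using assms
proof (rule tensor_eqI)
  fix xs :: "'h list" assume "length xs = Suc (a + Suc b)"
  then obtain x ys where xs: "xs = x # ys" and ys: "length ys = a + Suc b" by (cases xs) auto
  define Y where "Y = comult_at a b (pure s ys)"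
  have Y: "Y \<in> tpow s (a + (2 + b))"
    unfolding Y_def using ys by (intro comult_at_tpow pure_in_tpow)
  have pys: "pure s ys \<in> tpow s (a + Suc b)" using ys by (rule pure_in_tpow)
  have "comult_at (Suc (Suc a)) b (comult_at 0 (a + Suc b) (pure s xs))
      = tmap s (replicate 2 (emb s) @ (replicate a (emb s) @ \<Delta> # replicate b (emb s)))
        (tprod s (\<Delta> x) (pure s ys))"
    by (simp add: xs comult_at_0_pure[OF ys, simplified] numeral_2_eq_2)
  also have "\<dots> = tprod s (\<Delta> x) Y"
    using tmap_append[OF list_all2_emb[of 2] list_all2_comult_at[of a b], of "\<Delta> x" "pure s ys"] pys
    by (simp add: comult_tpow tmap_emb Y_def)
  finally have 1: "comult_at (Suc (Suc a)) b (comult_at 0 (a + Suc b) (pure s xs)) = tprod s (\<Delta> x) Y" .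
  have "comult_at (Suc a) b (pure s xs)
      = tmap s (replicate 1 (emb s) @ (replicate a (emb s) @ \<Delta> # replicate b (emb s)))
        (tprod s (pure s [x]) (pure s ys))"
    by (simp add: xs tprod_pure)
  also have "\<dots> = tprod s (pure s [x]) Y"
    using tmap_append[OF list_all2_emb[of 1] list_all2_comult_at[of a b], of "pure s [x]" "pure s ys"]
      pys tmap_emb[OF pure_in_tpow[of "[x]" 1]]
    by (simp add: pure_in_tpow Y_def)
  finally have "comult_at 0 (a + (2 + b)) (comult_at (Suc a) b (pure s xs))
      = tmap s ([\<Delta>] @ replicate (a + (2 + b)) (emb s)) (tprod s (pure s [x]) Y)"
    by simp
  also have "\<dots> = tprod s (\<Delta> x) Y"
    using tmap_append[OF list_all2_comult_at[of 0 0] list_all2_emb[of "a + (2 + b)"], of "pure s [x]" Y]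
      Y comult_at_0_pure[of "[]" 0 x] tprod_Nil(2)[OF comult_tpow] tmap_emb[OF Y]
    by (simp add: pure_in_tpow)
  finally show "comult_at (Suc (Suc a)) b (comult_at 0 (a + Suc b) (pure s xs))
      = comult_at 0 (a + (2 + b)) (comult_at (Suc a) b (pure s xs))"
    using 1 by simp
qed (simp_all only: tmap_add tmap_scale)

lemma comult_at_coassoc:
  assumes "t \<in> tpow s (Suc k)"
  shows "comult_at 1 k (comult_at 0 k t) = comult_at 0 (Suc k) (comult_at 0 k t)"
  using assms
proof (rule tensor_eqI)
  fix xs :: "'h list" assume "length xs = Suc k"
  then obtain x ys where xs: "xs = x # ys" and ys: "length ys = k" by (cases xs) auto
  have D: "comult_at 0 k (pure s xs) = tprod s (\<Delta> x) (pure s ys)"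
    unfolding xs using ys by (rule comult_at_0_pure)
  note split = tmap_append[OF _ list_all2_emb[of k], of _ _ "\<Delta> x" "pure s ys"]
  have "comult_at 1 k (tprod s (\<Delta> x) (pure s ys)) = tprod s (tmap s [emb s, \<Delta>] (\<Delta> x)) (pure s ys)"
    using split[OF list_all2_comult_at[of 1 0]] ys comult_tpow[of x]
    by (simp add: pure_in_tpow tmap_emb numeral_2_eq_2)
  also have "\<dots> = comult_at 0 (Suc k) (tprod s (\<Delta> x) (pure s ys))"
    using split[OF list_all2_comult_at[of 0 1]] ys coassoc[of x] comult_tpow[of x]
    by (simp add: pure_in_tpow tmap_emb numeral_2_eq_2)
  finally show "comult_at 1 k (comult_at 0 k (pure s xs)) = comult_at 0 (Suc k) (comult_at 0 k (pure s xs))"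
    unfolding D .
qed (simp_all only: tmap_add tmap_scale)

text \<open>
  The iterated coproduct is defined by splitting the first leg repeatedly, but any leg may be split in
  the last step. By induction: the last two splittings of the first leg may be rearranged into a
  splitting of the first and of the second leg by coassociativity, and splittings of the first leg
  commute with those of later legs.
\<close>

lemma comult_iter_at:
  assumes "i \<le> k"
  shows "comult_iter s \<Delta> (Suc k) x = comult_at i (k - i) (comult_iter s \<Delta> k x)"
  using assms
proof (induction k arbitrary: i)
  case 0
  then show ?case by simp
next
  case (Suc k)
  consider "i = 0" | "i = 1" | a where "i = Suc (Suc a)"
    by (metis One_nat_def not0_implies_Suc)
  then show ?case
  proof cases
    case 1
    then show ?thesis by simp
  next
    case 2
    then show ?thesis
      using comult_at_coassoc[OF comult_iter_tpow[of k x]] by simp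
  next
    case 3
    with Suc.prems obtain b where k: "k = a + Suc b"
      by (metis Suc_le_mono add_Suc_right add_Suc le_Suc_ex)
    have "comult_iter s \<Delta> (Suc (Suc k)) x = comult_at 0 (Suc k) (comult_iter s \<Delta> (Suc k) x)"
      by (rule comult_iter_Suc)
    also have "comult_iter s \<Delta> (Suc k) x = comult_at (Suc a) b (comult_iter s \<Delta> k x)"
      using Suc.IH[of "Suc a"] k by simp
    also have "comult_at 0 (Suc k) \<dots> = comult_at (Suc (Suc a)) b (comult_at 0 k (comult_iter s \<Delta> k x))"
      using comult_at_comult_at_disjoint[of "comult_iter s \<Delta> k x" a b] comult_iter_tpow[of k x] k
      by simp
    also have "\<dots> = comult_at i (Suc k - i) (comult_iter s \<Delta> (Suc k) x)"
      unfolding comult_iter_Suc using 3 k by simp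
    finally show ?thesis .
  qed
qed

text \<open>
  \<open>\<Delta>\<^sup>(\<^sup>k\<^sup>+\<^sup>1\<^sup>)(B) \<subseteq> B \<otimes> H\<^sup>\<otimes>\<^sup>k\<close>: the defining splitting always acts on the leg that lies in \<open>B\<close>.
\<close>

lemma comult_iter_coideal:
  assumes "right_coideal s \<Delta> B" and b: "b \<in> B"
  shows "comult_iter s \<Delta> k b \<in> tensor.span (pure s ` {c # hs |c hs. c \<in> B \<and> length hs = k})"
proof (induction k)
  case 0
  show ?case using b by (auto intro!: tensor.span_base)
next
  case (Suc k)
  let ?A = "\<lambda>k. {c # hs |c hs. c \<in> B \<and> length hs = k}"
  have "b # replicate k 0 \<in> ?A k" using b by simp
  then have ne: "?A k \<noteq> {}" by blast
  have closed: "tprod s u (pure s hs) \<in> tensor.span (pure s ` ?A (Suc k))"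
    if "u \<in> tensor.span (pure s ` {[c, h] |c h. c \<in> B})" and "length hs = k" for u and hs :: "'h list"
  proof -
    have "{[c, h] |c h. c \<in> B} \<noteq> {}" using b by blast
    with that(1) show ?thesis
    proof (induction rule: span_pure_induct)
      case (pure xs)
      then obtain c h where "c \<in> B" "xs = [c, h]" by blast
      then show ?case using that(2) by (auto simp: tprod_pure intro!: tensor.span_base imageI)
    qed (simp_all add: tprod_linear_left tensor.span_add tensor.span_scale)
  qed
  have \<Delta>: "\<Delta> c \<in> tensor.span (pure s ` {[c, h] |c h. c \<in> B})" if "c \<in> B" for c
  proof -
    have "{pure s [b, h] |b h. b \<in> B} = pure s ` {[c, h] |c h. c \<in> B}" by blast
    with assms(1) that show ?thesis by (auto simp: right_coideal_def)
  qed
  have "comult_at 0 k t \<in> tensor.span (pure s ` ?A (Suc k))" if "t \<in> tensor.span (pure s ` ?A k)" for t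
    using that ne
  proof (induction rule: span_pure_induct)
    case (pure xs)
    then obtain c hs where c: "c \<in> B" and hs: "length hs = k" and xs: "xs = c # hs" by blast
    show ?case unfolding xs comult_at_0_pure[OF hs] using \<Delta>[OF c] hs by (rule closed)
  qed (simp_all add: tmap_add tmap_scale tensor.span_add tensor.span_scale)
  from this[OF Suc] show ?case unfolding comult_iter_Suc .
qed

end


section \<open>The Yang-Baxter equation\<close>

context quasitriangular_bialgebra
begin

lemma R_tpow: "R \<in> tpow s 2"
  using R_unit by (simp add: Units_def tpow_monoid_simps)

text \<open>
  The intertwining property \<open>R \<Delta>(x) = \<Delta>\<^sup>o\<^sup>p(x) R\<close> on two adjacent legs. It serves twice: for \<open>t = R\<close> it yields
  the Yang-Baxter equation, for an iterated coproduct it shows that the braiding commutes with \<open>H\<close>.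
\<close>

lemma R_comult_at:
  assumes t: "t \<in> tpow s (i + Suc j)" and n: "n = i + (2 + j)"
  shows "leg s n (i + 1) (i + 2) R \<cdot>\<^bsub>s\<^esub> comult_at i j t
    = tswap s n (i + 1) (i + 2) (comult_at i j t) \<cdot>\<^bsub>s\<^esub> leg s n (i + 1) (i + 2) R"
  using t
proof (induction rule: tpow_induct)
  case (pure xs)
  then have "xs = take i xs @ xs ! i # drop (Suc i) xs" by (intro id_take_nth_drop) simp
  with pure obtain us x vs where xs: "xs = us @ x # vs" "length us = i" "length vs = j"
    using that[of "take i xs" "xs ! i" "drop (Suc i) xs"] by simp
  have one: "pure s (replicate k 1) \<in> tpow s k" for k by (simp add: pure_in_tpow)
  have us: "pure s us \<in> tpow s i" and vs: "pure s vs \<in> tpow s j" using xs by (auto intro: pure_in_tpow)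
  have leg: "leg s n (i + 1) (i + 2) R
      = tprod s (pure s (replicate i 1)) (tprod s R (pure s (replicate j 1)))"
    using pad_leg[of 1 2 2 R s i j] R_tpow n by (simp add: leg_id[simplified] pad_def)
  have swap: "tswap s n (i + 1) (i + 2) (comult_at i j (pure s xs))
      = tprod s (pure s us) (tprod s (flip s (\<Delta> x)) (pure s vs))"
    using tswap_sandwich[of n us vs "i + 1" "\<Delta> x" s] xs n comult_tpow
    by (simp add: comult_at_pure)
  note \<Delta> = comult_tpow[of x]
  note \<Delta>' = flip_tpow[OF \<Delta>]
  show ?case
    unfolding swap leg
    by (simp only: xs(1) comult_at_pure[OF xs(2,3)]
        tprod_tmult[OF one us tprod_tpow[OF R_tpow one] tprod_tpow[OF \<Delta> vs]]
        tprod_tmult[OF us one tprod_tpow[OF \<Delta>' vs] tprod_tpow[OF R_tpow one]]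
        tprod_tmult[OF R_tpow \<Delta> one vs] tprod_tmult[OF \<Delta>' R_tpow vs one]
        tmult_one[OF us] tmult_one[OF vs] R_comult)
next
  case (add t u)
  have leg: "leg s n (i + 1) (i + 2) R \<in> tpow s n" using n R_tpow by (intro leg_tpow) auto
  note in_n = comult_at_tpow[OF add(1), folded n] comult_at_tpow[OF add(2), folded n]
  show ?case
    by (simp only: tmap_add tswap_add tmult_linear_left tmult_add_right[OF leg in_n] add(3,4))
next
  case (scale c t)
  have leg: "leg s n (i + 1) (i + 2) R \<in> tpow s n" using n R_tpow by (intro leg_tpow) auto
  show ?case
    by (simp only: tmap_scale tswap_scale tmult_linear_left
        tmult_scale_right[OF leg comult_at_tpow[OF scale(1), folded n]] scale(2))
qed

text \<open>
  Apply the preceding lemma to \<open>(\<Delta> \<otimes> id)(R)\<close>, which is \<open>R\<^sub>1\<^sub>3 R\<^sub>2\<^sub>3\<close>; exchanging its first two legs gives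
  \<open>R\<^sub>2\<^sub>3 R\<^sub>1\<^sub>3\<close>.
\<close>

lemma yang_baxter:
  "leg s 3 1 2 R \<cdot>\<^bsub>s\<^esub> (leg s 3 1 3 R \<cdot>\<^bsub>s\<^esub> leg s 3 2 3 R)
    = leg s 3 2 3 R \<cdot>\<^bsub>s\<^esub> leg s 3 1 3 R \<cdot>\<^bsub>s\<^esub> leg s 3 1 2 R"
proof -
  have "leg s 3 1 3 R \<in> tpow s 3" "leg s 3 2 3 R \<in> tpow s 3" using R_tpow by (auto intro: leg_tpow)
  then have "tswap s 3 1 2 (leg s 3 1 3 R \<cdot>\<^bsub>s\<^esub> leg s 3 2 3 R) = leg s 3 2 3 R \<cdot>\<^bsub>s\<^esub> leg s 3 1 3 R"
    using R_tpow by (simp add: tswap_tmult tswap_leg transpose_def)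
  then show ?thesis
    using R_comult_at[of R 0 1 3] R_tpow R_comult_left by (simp add: numeral_2_eq_2)
qed

text \<open>
  The form of the Yang-Baxter equation that the braid relation needs: all indices are reversed because
  the transpositions are moved to the right of the elements. It follows by exchanging the legs 1 and 3
  and by padding with units.
\<close>

lemma yang_baxter_legs:
  assumes "1 \<le> i" and "i + 2 \<le> n"
  shows "leg s n (i + 1) i R \<cdot>\<^bsub>s\<^esub> (leg s n (i + 2) i R \<cdot>\<^bsub>s\<^esub> leg s n (i + 2) (i + 1) R)
    = leg s n (i + 2) (i + 1) R \<cdot>\<^bsub>s\<^esub> (leg s n (i + 2) i R \<cdot>\<^bsub>s\<^esub> leg s n (i + 1) i R)"
proof -
  have T: "leg s 3 p q R \<in> tpow s 3" if "p \<in> {1..3}" "q \<in> {1..3}" "p \<noteq> q" for p q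
    using that R_tpow by (rule leg_tpow)
  have swap: "tswap s 3 1 3 (leg s 3 p q R) = leg s 3 (transpose 1 3 p) (transpose 1 3 q) R"
    if "p \<in> {1..3}" "q \<in> {1..3}" "p \<noteq> q" for p q
    using that R_tpow by (intro tswap_leg) auto
  have "tswap s 3 1 3 (leg s 3 1 2 R \<cdot>\<^bsub>s\<^esub> (leg s 3 1 3 R \<cdot>\<^bsub>s\<^esub> leg s 3 2 3 R))
      = tswap s 3 1 3 (leg s 3 2 3 R \<cdot>\<^bsub>s\<^esub> leg s 3 1 3 R \<cdot>\<^bsub>s\<^esub> leg s 3 1 2 R)"
    by (rule arg_cong[OF yang_baxter])
  then have "leg s 3 3 2 R \<cdot>\<^bsub>s\<^esub> (leg s 3 3 1 R \<cdot>\<^bsub>s\<^esub> leg s 3 2 1 R)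
      = leg s 3 2 1 R \<cdot>\<^bsub>s\<^esub> leg s 3 3 1 R \<cdot>\<^bsub>s\<^esub> leg s 3 3 2 R"
    by (simp add: tswap_tmult T tmult_tpow swap transpose_def del: One_nat_def)
  then have flipped: "leg s 3 2 1 R \<cdot>\<^bsub>s\<^esub> (leg s 3 3 1 R \<cdot>\<^bsub>s\<^esub> leg s 3 3 2 R)
      = leg s 3 3 2 R \<cdot>\<^bsub>s\<^esub> (leg s 3 3 1 R \<cdot>\<^bsub>s\<^esub> leg s 3 2 1 R)"
    by (simp add: tmult_assoc[OF T T T])
  \<comment> \<open>The legs 1, 2, 3 become \<open>i\<close>, \<open>i + 1\<close>, \<open>i + 2\<close>, with \<open>i - 1\<close> units before and \<open>b\<close> units after them.\<close>
  define b where "b = n - (i + 2)"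
  have n: "n = (i - 1) + (3 + b)" using assms by (simp add: b_def)
  have pad: "leg s n ((i - 1) + p) ((i - 1) + q) R = pad s (i - 1) b (leg s 3 p q R)"
    if "p \<in> {1..3}" "q \<in> {1..3}" "p \<noteq> q" for p q
    unfolding n using pad_leg[OF that R_tpow] by simp
  have shift: "(i - 1) + 1 = i" "(i - 1) + 2 = i + 1" "(i - 1) + 3 = i + 2" using assms by simp_all
  have "leg s n (i + 1) i R = pad s (i - 1) b (leg s 3 2 1 R)"
    and "leg s n (i + 2) i R = pad s (i - 1) b (leg s 3 3 1 R)"
    and "leg s n (i + 2) (i + 1) R = pad s (i - 1) b (leg s 3 3 2 R)"
    using pad[of 2 1] pad[of 3 1] pad[of 3 2] unfolding shift by simp_all
  then show ?thesis
    using arg_cong[OF flipped, of "pad s (i - 1) b"] by (simp add: pad_tmult[where m = 3] T tmult_tpow)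
qed

definition braiding :: "nat \<Rightarrow> nat \<Rightarrow> ('f, 'h) tensor \<Rightarrow> ('f, 'h) tensor"
  where "braiding n i t = tswap s n i (i + 1) (leg s n i (i + 1) R \<cdot>\<^bsub>s\<^esub> t)"

context
  fixes n i :: nat
  assumes i: "1 \<le> i" "i + 1 \<le> n"
begin

lemma leg_R_tpow: "leg s n i (i + 1) R \<in> tpow s n"
  using i R_tpow by (intro leg_tpow) auto

lemma braiding_tpow: "t \<in> tpow s n \<Longrightarrow> braiding n i t \<in> tpow s n"
  unfolding braiding_def using i leg_R_tpow by (intro tswap_tpow tmult_tpow) auto

text \<open>
  The transposition is an algebra automorphism, so it may act before the multiplication by \<open>R\<close>, whose
  legs it exchanges.
\<close>

lemma braiding_eq:
  assumes "t \<in> tpow s n"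
  shows "braiding n i t = leg s n (i + 1) i R \<cdot>\<^bsub>s\<^esub> tswap s n i (i + 1) t"
proof -
  have "tswap s n i (i + 1) (leg s n i (i + 1) R) = leg s n (i + 1) i R"
    using i R_tpow by (subst tswap_leg) auto
  then show ?thesis unfolding braiding_def using assms i leg_R_tpow by (subst tswap_tmult) auto
qed

lemma braiding_add:
  "t \<in> tpow s n \<Longrightarrow> u \<in> tpow s n \<Longrightarrow> braiding n i (t + u) = braiding n i t + braiding n i u"
  and braiding_scale: "t \<in> tpow s n \<Longrightarrow> braiding n i (tscale c t) = tscale c (braiding n i t)"
  by (simp_all only: braiding_def tmult_linear_right[OF leg_R_tpow] tswap_add tswap_scale)

lemma braiding_inverse:
  obtains g where "\<And>t. t \<in> tpow s n \<Longrightarrow> g t \<in> tpow s n"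
    and "\<And>t. t \<in> tpow s n \<Longrightarrow> braiding n i (g t) = t"
    and "\<And>t. t \<in> tpow s n \<Longrightarrow> g (braiding n i t) = t"
proof -
  let ?r = "leg s n i (i + 1) R"
  have ij: "i \<in> {1..n}" "i + 1 \<in> {1..n}" "i \<noteq> i + 1" using i by auto
  from leg_Units[OF ij R_unit] obtain q where q: "q \<in> tpow s n"
      "?r \<cdot>\<^bsub>s\<^esub> q = pure s (replicate n 1)" "q \<cdot>\<^bsub>s\<^esub> ?r = pure s (replicate n 1)"
    unfolding Units_def tpow_monoid_simps by blast
  show thesis
  proof (rule that[of "\<lambda>t. q \<cdot>\<^bsub>s\<^esub> tswap s n i (i + 1) t"])
    fix t assume t: "t \<in> tpow s n"
    note \<tau>t = tswap_tpow[OF ij(1,2) t]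
    show "q \<cdot>\<^bsub>s\<^esub> tswap s n i (i + 1) t \<in> tpow s n" using q(1) \<tau>t by (rule tmult_tpow)
    show "braiding n i (q \<cdot>\<^bsub>s\<^esub> tswap s n i (i + 1) t) = t"
      by (simp only: braiding_def tmult_assoc[OF leg_R_tpow q(1) \<tau>t, symmetric] q(2) tmult_one[OF \<tau>t]
          tswap_tswap[OF ij(1,2) t])
    show "q \<cdot>\<^bsub>s\<^esub> tswap s n i (i + 1) (braiding n i t) = t"
      by (simp only: braiding_def tswap_tswap[OF ij(1,2) tmult_tpow[OF leg_R_tpow t]]
          tmult_assoc[OF q(1) leg_R_tpow t, symmetric] q(3) tmult_one[OF t])
  qed
qed

text \<open>
  Split the \<open>i\<close>-th leg last in the iterated coproduct. Then \<open>R\<close> exchanges the legs \<open>i\<close> and \<open>i + 1\<close> of it, and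
  the transposition exchanges them back.
\<close>

lemma braiding_tact:
  assumes t: "t \<in> tpow s n"
  shows "braiding n i (tact s \<Delta> n x t) = tact s \<Delta> n x (braiding n i t)"
proof -
  let ?r = "leg s n i (i + 1) R" and ?\<tau> = "tswap s n i (i + 1)"
  define D where "D = comult_iter s \<Delta> (n - 1) x"
  have ij: "i \<in> {1..n}" "i + 1 \<in> {1..n}" using i by auto
  \<comment> \<open>Positions in lists count from 0, so the leg \<open>i\<close> has the position \<open>i - 1\<close>.\<close>
  obtain k where k: "n = Suc (Suc k)" "i - 1 \<le> k"
    using i by (metis Suc_le_mono add_leD2 le_add_diff_inverse plus_1_eq_Suc Suc_eq_plus1)
  have D: "D \<in> tpow s n" using comult_iter_tpow[of "Suc k" x] by (simp add: D_def k)
  have "D = comult_at (i - 1) (k - (i - 1)) (comult_iter s \<Delta> k x)"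
    using comult_iter_at[OF k(2)] by (simp add: D_def k)
  moreover have "comult_iter s \<Delta> k x \<in> tpow s (i - 1 + Suc (k - (i - 1)))"
    using comult_iter_tpow[of k x] k by simp
  ultimately have RD: "?r \<cdot>\<^bsub>s\<^esub> D = ?\<tau> D \<cdot>\<^bsub>s\<^esub> ?r"
    using R_comult_at[of "comult_iter s \<Delta> k x" "i - 1" "k - (i - 1)" n] k i by simp
  have "?r \<cdot>\<^bsub>s\<^esub> (D \<cdot>\<^bsub>s\<^esub> t) = ?\<tau> D \<cdot>\<^bsub>s\<^esub> (?r \<cdot>\<^bsub>s\<^esub> t)"
    using tmult_assoc[OF leg_R_tpow D t] tmult_assoc[OF tswap_tpow[OF ij D] leg_R_tpow t] RD by simp
  then show ?thesis
    unfolding tact_def braiding_def D_def[symmetric]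
    using tswap_tmult[OF ij tswap_tpow[OF ij D] tmult_tpow[OF leg_R_tpow t]] tswap_tswap[OF ij D]
    by simp
qed

end

lemma braiding_commute:
  assumes "1 \<le> i" "i + 1 < j" "j + 1 \<le> n" and t: "t \<in> tpow s n"
  shows "braiding n i (braiding n j t) = braiding n j (braiding n i t)"
proof -
  have i: "i \<in> {1..n}" "i + 1 \<in> {1..n}" and j: "j \<in> {1..n}" "j + 1 \<in> {1..n}"
    and ij: "1 \<le> i" "i + 1 \<le> n" "1 \<le> j" "j + 1 \<le> n"
    using assms by auto
  let ?a = "leg s n (i + 1) i R" and ?b = "leg s n (j + 1) j R"
  let ?\<sigma> = "tswap s n i (i + 1)" and ?\<tau> = "tswap s n j (j + 1)"
  have a: "?a \<in> tpow s n" and b: "?b \<in> tpow s n" using i j R_tpow by (auto intro: leg_tpow)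
  have sb: "?\<sigma> ?b = ?b" and ta: "?\<tau> ?a = ?a"
    using assms i j R_tpow by (simp_all add: tswap_leg transpose_def)
  have ab: "?a \<cdot>\<^bsub>s\<^esub> ?b = ?b \<cdot>\<^bsub>s\<^esub> ?a"
    using assms i j R_tpow by (intro leg_commute) auto
  note st = tswap_tpow[OF i t] tswap_tpow[OF j t]
  have "braiding n i (braiding n j t) = ?a \<cdot>\<^bsub>s\<^esub> (?b \<cdot>\<^bsub>s\<^esub> ?\<sigma> (?\<tau> t))"
    unfolding braiding_eq[OF ij(1,2) braiding_tpow[OF ij(3,4) t]]
    by (simp only: braiding_eq[OF ij(3,4) t] tswap_tmult[OF i b st(2)] sb)
  moreover have "braiding n j (braiding n i t) = ?b \<cdot>\<^bsub>s\<^esub> (?a \<cdot>\<^bsub>s\<^esub> ?\<tau> (?\<sigma> t))"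
    unfolding braiding_eq[OF ij(3,4) braiding_tpow[OF ij(1,2) t]]
    by (simp only: braiding_eq[OF ij(1,2) t] tswap_tmult[OF j a st(1)] ta)
  moreover have "?\<sigma> (?\<tau> t) = ?\<tau> (?\<sigma> t)" using assms i j by (intro tswap_commute) auto
  ultimately show ?thesis
    using ab tmult_assoc[OF a b tswap_tpow[OF j st(1)]] tmult_assoc[OF b a tswap_tpow[OF j st(1)]] by simp
qed

lemma braiding_braid:
  assumes "1 \<le> i" "i + 2 \<le> n" and t: "t \<in> tpow s n"
  shows "braiding n i (braiding n (i + 1) (braiding n i t))
    = braiding n (i + 1) (braiding n i (braiding n (i + 1) t))"
proof -
  let ?a = "leg s n (i + 1) i R" and ?b = "leg s n (i + 2) i R" and ?c = "leg s n (i + 2) (i + 1) R"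
  let ?\<sigma> = "tswap s n i (i + 1)" and ?\<tau> = "tswap s n (i + 1) (i + 2)"
  have i: "i \<in> {1..n}" "i + 1 \<in> {1..n}" and j: "i + 1 \<in> {1..n}" "i + 2 \<in> {1..n}"
    and ij: "1 \<le> i" "i + 1 \<le> n" "1 \<le> i + 1" "i + 1 + 1 \<le> n"
    using assms by auto
  have abc: "?a \<in> tpow s n" "?b \<in> tpow s n" "?c \<in> tpow s n" using i j R_tpow by (auto intro: leg_tpow)
  have legs: "?\<sigma> ?b = ?c" "?\<sigma> ?c = ?b" "?\<tau> ?a = ?b" "?\<tau> ?b = ?a"
    using i j R_tpow by (simp_all add: tswap_leg transpose_def)
  note \<sigma> = tswap_tpow[OF i] and \<tau> = tswap_tpow[OF j]
  note eqs = tswap_tmult[OF i] tswap_tmult[OF j] \<sigma> \<tau> abc legs t tmult_tpow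
  have \<sigma>_eq: "braiding n i u = ?a \<cdot>\<^bsub>s\<^esub> ?\<sigma> u" if "u \<in> tpow s n" for u
    using braiding_eq[OF ij(1,2) that] .
  have \<tau>_eq: "braiding n (i + 1) u = ?c \<cdot>\<^bsub>s\<^esub> ?\<tau> u" if "u \<in> tpow s n" for u
    using braiding_eq[OF ij(3,4) that] by simp
  have "braiding n i (braiding n (i + 1) (braiding n i t))
      = ?a \<cdot>\<^bsub>s\<^esub> (?b \<cdot>\<^bsub>s\<^esub> (?c \<cdot>\<^bsub>s\<^esub> ?\<sigma> (?\<tau> (?\<sigma> t))))"
    by (simp only: \<sigma>_eq \<tau>_eq eqs)
  also have "\<dots> = ?a \<cdot>\<^bsub>s\<^esub> (?b \<cdot>\<^bsub>s\<^esub> ?c) \<cdot>\<^bsub>s\<^esub> ?\<sigma> (?\<tau> (?\<sigma> t))"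
    by (simp only: tmult_assoc[where n = n] eqs)
  also have "?a \<cdot>\<^bsub>s\<^esub> (?b \<cdot>\<^bsub>s\<^esub> ?c) = ?c \<cdot>\<^bsub>s\<^esub> (?b \<cdot>\<^bsub>s\<^esub> ?a)"
    using assms by (intro yang_baxter_legs)
  also have "?\<sigma> (?\<tau> (?\<sigma> t)) = ?\<tau> (?\<sigma> (?\<tau> t))"
    using i j t by (intro tswap_braid) auto
  also have "?c \<cdot>\<^bsub>s\<^esub> (?b \<cdot>\<^bsub>s\<^esub> ?a) \<cdot>\<^bsub>s\<^esub> ?\<tau> (?\<sigma> (?\<tau> t))
      = ?c \<cdot>\<^bsub>s\<^esub> (?b \<cdot>\<^bsub>s\<^esub> (?a \<cdot>\<^bsub>s\<^esub> ?\<tau> (?\<sigma> (?\<tau> t))))"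
    by (simp only: tmult_assoc[where n = n] eqs)
  also have "\<dots> = braiding n (i + 1) (braiding n i (braiding n (i + 1) t))"
    by (simp only: \<sigma>_eq \<tau>_eq eqs)
  finally show ?thesis .
qed

end


section \<open>Maps on the first tensor factor\<close>

context k_algebra
begin

abbreviation on_first :: "nat \<Rightarrow> ('h \<Rightarrow> 'h) \<Rightarrow> ('f, 'h) tensor \<Rightarrow> ('f, 'h) tensor"
  where "on_first n f \<equiv> tmap s ((emb s \<circ> f) # replicate (n - 1) (emb s))"

abbreviation on_both :: "('h \<Rightarrow> 'h) \<Rightarrow> ('h \<Rightarrow> 'h) \<Rightarrow> ('f, 'h) tensor \<Rightarrow> ('f, 'h) tensor"
  where "on_both f g \<equiv> tmap s [emb s \<circ> f, emb s \<circ> g]"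

lemma on_first_pure:
  "Vector_Spaces.linear s s f \<Longrightarrow> Suc (length xs) = n \<Longrightarrow> on_first n f (pure s (x # xs)) = pure s (f x # xs)"
  by (rule tmap_first_pure) auto

lemma on_first_tpow:
  assumes f: "Vector_Spaces.linear s s f" and n: "1 \<le> n" and t: "t \<in> tpow s n"
  shows "on_first n f t \<in> tpow s n"
  using t
proof (rule tensor_into[where f = "on_first n f"])
  fix xs :: "'h list" assume "length xs = n"
  moreover from this n obtain x ys where "xs = x # ys" by (cases xs) auto
  ultimately show "on_first n f (pure s xs) \<in> tpow s n" using on_first_pure[OF f] by (simp add: pure_in_tpow)
qed (simp_all only: tmap_add tmap_scale)

lemma on_first_tmult:
  assumes f: "Vector_Spaces.linear s s f" and mult: "\<And>x y. f (x * y) = f x * f y"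
    and n: "1 \<le> n" and t: "t \<in> tpow s n" and u: "u \<in> tpow s n"
  shows "on_first n f (t \<cdot>\<^bsub>s\<^esub> u) = on_first n f t \<cdot>\<^bsub>s\<^esub> on_first n f u"
  using tmap_add tmap_scale _ _ t u
proof (rule multiplicative_if_on_pure[where n = n])
  fix xs ys :: "'h list" assume len: "length xs = n" "length ys = n"
  moreover from len n obtain x xs' y ys' where "xs = x # xs'" "ys = y # ys'" by (cases xs; cases ys) auto
  ultimately show "on_first n f (pure s (map2 (*) xs ys)) = on_first n f (pure s xs) \<cdot>\<^bsub>s\<^esub> on_first n f (pure s ys)"
    using on_first_pure[OF f] by (simp add: mult tmult_pures)
qed (rule on_first_tpow[OF f n pure_in_tpow])

lemma on_first_on_first:
  assumes f: "Vector_Spaces.linear s s f" and g: "Vector_Spaces.linear s s g"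
    and inv: "\<And>x. f (g x) = x" and n: "1 \<le> n" and t: "t \<in> tpow s n"
  shows "on_first n f (on_first n g t) = t"
  using t
proof (rule tensor_eqI[where g = "\<lambda>t. t"])
  fix xs :: "'h list" assume len: "length xs = n"
  moreover from this n obtain x ys where "xs = x # ys" by (cases xs) auto
  ultimately show "on_first n f (on_first n g (pure s xs)) = pure s xs"
    using on_first_pure[OF f] on_first_pure[OF g] inv by simp
qed (simp_all only: tmap_add tmap_scale)

lemma on_both_tpow:
  assumes f: "Vector_Spaces.linear s s f" and g: "Vector_Spaces.linear s s g" and t: "t \<in> tpow s 2"
  shows "on_both f g t \<in> tpow s 2"
  using tmap_tpow[of s "[1, 1]" "[emb s \<circ> f, emb s \<circ> g]" t] linear_into_emb_comp[OF f]
    linear_into_emb_comp[OF g] t by (simp add: numeral_2_eq_2)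

lemma on_both_tmult:
  assumes f: "Vector_Spaces.linear s s f" "\<And>x y. f (x * y) = f x * f y"
    and g: "Vector_Spaces.linear s s g" "\<And>x y. g (x * y) = g x * g y"
    and t: "t \<in> tpow s 2" and u: "u \<in> tpow s 2"
  shows "on_both f g (t \<cdot>\<^bsub>s\<^esub> u) = on_both f g t \<cdot>\<^bsub>s\<^esub> on_both f g u"
  using tmap_add tmap_scale _ _ t u
proof (rule multiplicative_if_on_pure[where n = 2])
  fix xs ys :: "'h list" assume "length xs = 2" "length ys = 2"
  then obtain x x' y y' where "xs = [x, x']" "ys = [y, y']" by (auto simp: numeral_2_eq_2 length_Suc_conv)
  then show "on_both f g (pure s (map2 (*) xs ys)) = on_both f g (pure s xs) \<cdot>\<^bsub>s\<^esub> on_both f g (pure s ys)"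
    by (simp add: tmap_both_pure[OF f(1) g(1)] f(2) g(2) tmult_pures)
qed (rule on_both_tpow[OF f(1) g(1) pure_in_tpow])

lemma flip_on_both:
  assumes f: "Vector_Spaces.linear s s f" and g: "Vector_Spaces.linear s s g" and t: "t \<in> tpow s 2"
  shows "flip s (on_both f g t) = on_both g f (flip s t)"
  using t
  by (rule tensor2_eqI)
    (simp_all only: tmap_add tmap_scale tswap_add tswap_scale tmap_both_pure[OF f g]
      tmap_both_pure[OF g f] flip_pure)

lemma on_both_on_both:
  assumes "Vector_Spaces.linear s s f" "Vector_Spaces.linear s s g"
    and "Vector_Spaces.linear s s f'" "Vector_Spaces.linear s s g'"
    and "Vector_Spaces.linear s s f''" "Vector_Spaces.linear s s g''"
    and "\<And>x. f (f' x) = f'' x" "\<And>x. g (g' x) = g'' x" and t: "t \<in> tpow s 2"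
  shows "on_both f g (on_both f' g' t) = on_both f'' g'' t"
  using t by (rule tensor2_eqI) (simp_all only: tmap_add tmap_scale tmap_both_pure assms)

lemma on_both_id:
  assumes "t \<in> tpow s 2"
  shows "on_both id id t = t"
proof -
  have "on_both id id (pure s [x, y]) = pure s [x, y]" for x y
    using tmap_both_pure[OF linear_id linear_id, of x y] by simp
  then show ?thesis
    using tensor2_eqI[OF assms, of "on_both id id" "\<lambda>t. t"] by (simp only: tmap_add tmap_scale)
qed

lemma on_first_leg_12:
  assumes f: "Vector_Spaces.linear s s f" and n: "2 \<le> n" and t: "t \<in> tpow s 2"
  shows "on_first n f (leg s n 1 2 t) = leg s n 1 2 (on_both f id t)"
  using t
proof (rule tensor2_eqI)
  fix x y
  obtain m where m: "n = Suc (Suc m)" using n by (metis add_2_eq_Suc le_Suc_ex)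
  have "leg s n 1 2 (pure s [u, v]) = pure s (u # v # replicate m 1)" for u v
    using n by (subst leg_pure) (simp_all add: m numeral_2_eq_2)
  then show "on_first n f (leg s n 1 2 (pure s [x, y])) = leg s n 1 2 (on_both f id (pure s [x, y]))"
    using on_first_pure[OF f, of "y # replicate m 1" n x] by (simp only: tmap_both_pure[OF f linear_id]) (simp add: m)
qed (simp_all only: tmap_add tmap_scale leg_add leg_scale)

lemma on_first_leg:
  assumes f: "Vector_Spaces.linear s s f" "f 1 = 1"
    and ij: "i \<in> {2..n}" "j \<in> {2..n}" "i \<noteq> j" and t: "t \<in> tpow s 2"
  shows "on_first n f (leg s n i j t) = leg s n i j t"
  using t
proof (rule tensor2_eqI)
  fix x y
  obtain m i' j' where m: "n = Suc m" "i - 1 = Suc i'" "j - 1 = Suc j'"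
    using ij by (cases n; cases "i - 1"; cases "j - 1") auto
  then have "leg s n i j (pure s [x, y]) = pure s (1 # (replicate m 1)[i' := x, j' := y])"
    using ij by (subst leg_pure) simp_all
  then show "on_first n f (leg s n i j (pure s [x, y])) = leg s n i j (pure s [x, y])"
    using on_first_pure[OF f(1), of "(replicate m 1)[i' := x, j' := y]" n 1] f(2) m(1) by simp
qed (simp_all only: tmap_add tmap_scale leg_add leg_scale)

lemma tswap_Cons_pure:
  assumes ij: "i \<in> {2..n}" "j \<in> {2..n}" and "Suc (length xs) = n"
  shows "\<exists>ys. length ys = length xs \<and> (\<forall>x. tswap s n i j (pure s (x # xs)) = pure s (x # ys))"
proof -
  let ?p = "transpose (i - 1) (j - 1)"
  let ?ys = "map (\<lambda>k. xs ! (?p (Suc k) - 1)) [0..<length xs]"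
  have "permute_list ?p (x # xs) = x # ?ys" for x
  proof (rule nth_equalityI)
    fix k assume "k < length (permute_list ?p (x # xs))"
    then have k: "k < Suc (length xs)" by simp
    have "?p 0 = 0" using ij by (simp add: transpose_def)
    moreover have "?p (Suc l) \<noteq> 0" for l using ij by (simp add: transpose_def)
    moreover have "permute_list ?p (x # xs) ! k = (x # xs) ! ?p k"
      using k by (simp add: permute_list_def del: upt_Suc)
    ultimately show "permute_list ?p (x # xs) ! k = (x # ?ys) ! k"
      using k by (cases k) (simp_all add: nth_Cons_pos)
  qed simp
  then have "tswap s n i j (pure s (x # xs)) = pure s (x # ?ys)" for x
    using ij assms(3) by (subst tswap_pure) auto
  then show ?thesis by (intro exI[of _ ?ys]) simp
qed

lemma on_first_tswap:
  assumes f: "Vector_Spaces.linear s s f" and ij: "i \<in> {2..n}" "j \<in> {2..n}" and t: "t \<in> tpow s n"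
  shows "on_first n f (tswap s n i j t) = tswap s n i j (on_first n f t)"
  using t
proof (rule tensor_eqI)
  fix xs :: "'h list" assume "length xs = n"
  then obtain x xs' where xs: "xs = x # xs'" "Suc (length xs') = n" using ij by (cases xs) auto
  then obtain ys where "length ys = length xs'" "\<And>x. tswap s n i j (pure s (x # xs')) = pure s (x # ys)"
    using tswap_Cons_pure[OF ij] by metis
  then show "on_first n f (tswap s n i j (pure s xs)) = tswap s n i j (on_first n f (pure s xs))"
    using on_first_pure[OF f] xs by simp
qed (simp_all only: tmap_add tmap_scale tswap_add tswap_scale)

lemma tswap_12_pure:
  assumes "n = Suc (Suc (length xs))"
  shows "tswap s n 1 2 (pure s (x # y # xs)) = pure s (y # x # xs)"
proof -
  have "n = length [] + (2 + length xs)" and "1 = Suc (length [])" and "pure s [x, y] \<in> tpow s 2"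
    using assms by (simp_all add: pure_in_tpow)
  from tswap_sandwich[OF this] show ?thesis
    by (simp only: tprod_pure flip_pure append.simps one_add_one)
qed

text \<open>
  The conjugate of a map on the first leg by the transposition is the same map on the second leg, and
  maps on different legs commute.
\<close>

lemma on_first_conjugate_commute:
  assumes f: "Vector_Spaces.linear s s f" and n: "2 \<le> n" and t: "t \<in> tpow s n"
  shows "on_first n f (tswap s n 1 2 (on_first n f (tswap s n 1 2 t)))
    = tswap s n 1 2 (on_first n f (tswap s n 1 2 (on_first n f t)))"
  using t
proof (rule tensor_eqI)
  fix xs :: "'h list" assume "length xs = n"
  then obtain x y zs where xs: "xs = x # y # zs" "n = Suc (Suc (length zs))"
    using n by (metis add_2_eq_Suc le_Suc_ex length_Suc_conv)
  then show "on_first n f (tswap s n 1 2 (on_first n f (tswap s n 1 2 (pure s xs))))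
    = tswap s n 1 2 (on_first n f (tswap s n 1 2 (on_first n f (pure s xs))))"
    using on_first_pure[OF f] by (simp only: tswap_12_pure xs length_Cons)
qed (simp_all only: tmap_add tmap_scale tswap_add tswap_scale)

lemma pure_first_tswap_commute:
  assumes ij: "i \<in> {2..n}" "j \<in> {2..n}"
  shows "tswap s n i j (pure s (a # replicate (n - 1) 1)) = pure s (a # replicate (n - 1) 1)"
proof -
  obtain m i' j' where m: "n = Suc m" "i - 1 = Suc i'" "j - 1 = Suc j'"
    using ij by (cases n; cases "i - 1"; cases "j - 1") auto
  have "i' < m" "j' < m" using ij m by auto
  have "permute_list (transpose (i - 1) (j - 1)) (a # replicate m 1) = a # replicate m 1" (is "?l = ?r")
  proof (rule nth_equalityI)
    fix k assume "k < length ?l"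
    then have "k < Suc m" by simp
    with \<open>i' < m\<close> \<open>j' < m\<close> show "?l ! k = ?r ! k"
      unfolding m(2,3) by (cases k) (simp_all add: permute_list_def transpose_def del: upt_Suc)
  qed simp
  then show ?thesis using ij m(1) by (subst tswap_pure) auto
qed

lemma pure_first_leg_commute:
  assumes ij: "i \<in> {2..n}" "j \<in> {2..n}" "i \<noteq> j" and t: "t \<in> tpow s 2"
  shows "pure s (a # replicate (n - 1) 1) \<cdot>\<^bsub>s\<^esub> leg s n i j t
    = leg s n i j t \<cdot>\<^bsub>s\<^esub> pure s (a # replicate (n - 1) 1)"
  using t
proof (induction rule: tpow_induct)
  case (pure xs)
  then obtain x y where xs: "xs = [x, y]" by (auto simp: numeral_2_eq_2 length_Suc_conv)
  obtain m i' j' where m: "n = Suc m" "i - 1 = Suc i'" "j - 1 = Suc j'"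
    using ij by (cases n; cases "i - 1"; cases "j - 1") auto
  then have leg: "leg s n i j (pure s xs) = pure s (1 # (replicate m 1)[i' := x, j' := y])"
    using ij unfolding xs by (subst leg_pure) simp_all
  have "map2 (*) (replicate m 1) zs = zs" "map2 (*) zs (replicate m 1) = zs"
    if "length zs = m" for zs :: "'h list"
    using that by (auto intro: nth_equalityI)
  then show ?case unfolding leg by (simp add: m(1) tmult_pures)
next
  case (add u v)
  have "pure s (a # replicate (n - 1) 1) \<in> tpow s n" using ij by (intro pure_in_tpow) simp
  moreover have "leg s n i j u \<in> tpow s n" "leg s n i j v \<in> tpow s n"
    using add ij by (auto intro: leg_tpow)
  ultimately show ?case using add by (simp add: leg_add tmult_linear_left tmult_add_right)
next
  case (scale c u)
  have "pure s (a # replicate (n - 1) 1) \<in> tpow s n" using ij by (intro pure_in_tpow) simp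
  moreover have "leg s n i j u \<in> tpow s n" using scale ij by (auto intro: leg_tpow)
  ultimately show ?case using scale by (simp add: leg_scale tmult_linear_left tmult_scale_right)
qed

lemma flip_tmult: "t \<in> tpow s 2 \<Longrightarrow> u \<in> tpow s 2 \<Longrightarrow> flip s (t \<cdot>\<^bsub>s\<^esub> u) = flip s t \<cdot>\<^bsub>s\<^esub> flip s u"
  by (rule tswap_tmult) auto

end


section \<open>The reflection equation\<close>

context cylindrical_bialgebra
begin

definition \<psi>' :: "'h \<Rightarrow> 'h" where "\<psi>' = inv_into UNIV \<psi>"

lemma
  shows linear_\<psi>: "Vector_Spaces.linear s s \<psi>" and \<psi>_mult: "\<psi> (x * y) = \<psi> x * \<psi> y" and \<psi>_one: "\<psi> 1 = 1"
    and \<psi>_\<psi>': "\<psi> (\<psi>' z) = z" and \<psi>'_\<psi>: "\<psi>' (\<psi> z) = z"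
    and linear_\<psi>': "Vector_Spaces.linear s s \<psi>'" and \<psi>'_mult: "\<psi>' (x * y) = \<psi>' x * \<psi>' y"
    and \<psi>'_one: "\<psi>' 1 = 1"
proof -
  have aut: "bij \<psi>" "Vector_Spaces.linear s s \<psi>" "\<And>x y. \<psi> (x * y) = \<psi> x * \<psi> y" "\<psi> 1 = 1"
    using twist_pair by (auto simp: twist_pair_def algebra_automorphism_def)
  interpret \<psi>: Vector_Spaces.linear s s \<psi> by (fact aut(2))
  show "Vector_Spaces.linear s s \<psi>" and "\<psi> (x * y) = \<psi> x * \<psi> y" and "\<psi> 1 = 1" by (fact aut)+
  show 1: "\<psi> (\<psi>' z) = z" for z
    unfolding \<psi>'_def using aut(1) by (simp add: bij_is_surj surj_f_inv_f)
  show 2: "\<psi>' (\<psi> z) = z" for z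
    unfolding \<psi>'_def using aut(1) by (simp add: bij_is_inj)
  have "\<psi>' (x + y) = \<psi>' x + \<psi>' y" and "\<psi>' (s c x) = s c (\<psi>' x)" for x y c
    by (metis 1 2 \<psi>.add) (metis 1 2 \<psi>.scale)
  then show "Vector_Spaces.linear s s \<psi>'" by unfold_locales
  show "\<psi>' (x * y) = \<psi>' x * \<psi>' y" and "\<psi>' 1 = 1" by (metis 1 2 aut(3)) (metis 2 aut(4))
qed

lemma pure2_tpow: "pure s [x, y] \<in> tpow s 2"
  by (simp add: pure_in_tpow)

text \<open>
  Both sides equal \<open>J\<^sub>2\<^sub>1 R \<Delta>(K)\<close>. The right side arises from the formula for \<open>\<Delta>(K)\<close> and
  \<open>J\<^sub>2\<^sub>1 R J\<^sup>-\<^sup>1 = (\<psi> \<otimes> \<psi>)(R\<^sub>2\<^sub>1)\<close>, the left side from \<open>R \<Delta>(K) = \<Delta>\<^sup>o\<^sup>p(K) R\<close> and the flipped formula.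
\<close>

theorem reflection_equation:
  "pure s [K, 1] \<cdot>\<^bsub>s\<^esub> flip s (on_both \<psi> id R) \<cdot>\<^bsub>s\<^esub> pure s [1, K] \<cdot>\<^bsub>s\<^esub> R
    = flip s (on_both \<psi> \<psi> R) \<cdot>\<^bsub>s\<^esub> pure s [1, K] \<cdot>\<^bsub>s\<^esub> on_both \<psi> id R \<cdot>\<^bsub>s\<^esub> pure s [K, 1]"
proof -
  let ?P = "on_both \<psi> id R" and ?J' = "inv\<^bsub>tpow_monoid s 2\<^esub> J"
  interpret T2: monoid "tpow_monoid s 2" by (rule monoid_tpow)
  have "J \<in> Units (tpow_monoid s 2)" and RJ: "on_both \<psi> \<psi> (flip s R) = flip s J \<cdot>\<^bsub>s\<^esub> R \<cdot>\<^bsub>s\<^esub> ?J'"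
    using twist_pair by (auto simp: twist_pair_def drinfeld_twist_def)
  then have J: "J \<in> tpow s 2" "?J' \<in> tpow s 2" "J \<cdot>\<^bsub>s\<^esub> ?J' = pure s [1, 1]"
    using T2.Units_closed T2.Units_inv_closed T2.Units_r_inv
    by (auto simp: tpow_monoid_simps numeral_2_eq_2)
  have P: "?P \<in> tpow s 2" by (rule on_both_tpow[OF linear_\<psi> linear_id R_tpow])
  note mem = J(1,2) P R_tpow pure2_tpow flip_tpow tmult_tpow
  note assoc = tmult_assoc[where n = 2]
  have one: "pure s [1, 1] \<cdot>\<^bsub>s\<^esub> t = t" if "t \<in> tpow s 2" for t
    using tmult_one(1)[OF that] by (simp add: numeral_2_eq_2)
  have \<Delta>K: "\<Delta> K = ?J' \<cdot>\<^bsub>s\<^esub> pure s [1, K] \<cdot>\<^bsub>s\<^esub> ?P \<cdot>\<^bsub>s\<^esub> pure s [K, 1]"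
    using comult_K by simp
  have "flip s J \<cdot>\<^bsub>s\<^esub> flip s ?J' = pure s [1, 1]"
    using flip_tmult[OF J(1,2)] J(3) by (simp only: flip_pure)
  then have cancel: "flip s J \<cdot>\<^bsub>s\<^esub> (flip s ?J' \<cdot>\<^bsub>s\<^esub> t) = t" if "t \<in> tpow s 2" for t
    using that one assoc[OF flip_tpow[OF J(1)] flip_tpow[OF J(2)] that] by simp
  \<comment> \<open>The twist cancels against its inverse in the flipped formula for \<open>\<Delta>(K)\<close>.\<close>
  have "flip s J \<cdot>\<^bsub>s\<^esub> (R \<cdot>\<^bsub>s\<^esub> \<Delta> K) = flip s J \<cdot>\<^bsub>s\<^esub> (flip s (\<Delta> K) \<cdot>\<^bsub>s\<^esub> R)"
    by (simp only: R_comult)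
  also have "flip s (\<Delta> K) = flip s ?J' \<cdot>\<^bsub>s\<^esub> (pure s [K, 1] \<cdot>\<^bsub>s\<^esub> flip s ?P \<cdot>\<^bsub>s\<^esub> pure s [1, K])"
    unfolding \<Delta>K by (simp only: flip_tmult flip_pure assoc mem)
  also have "flip s J \<cdot>\<^bsub>s\<^esub> (flip s ?J' \<cdot>\<^bsub>s\<^esub> (pure s [K, 1] \<cdot>\<^bsub>s\<^esub> flip s ?P \<cdot>\<^bsub>s\<^esub> pure s [1, K]) \<cdot>\<^bsub>s\<^esub> R)
      = pure s [K, 1] \<cdot>\<^bsub>s\<^esub> flip s ?P \<cdot>\<^bsub>s\<^esub> pure s [1, K] \<cdot>\<^bsub>s\<^esub> R"
    by (simp only: assoc mem cancel)
  finally have "pure s [K, 1] \<cdot>\<^bsub>s\<^esub> flip s ?P \<cdot>\<^bsub>s\<^esub> pure s [1, K] \<cdot>\<^bsub>s\<^esub> R = flip s J \<cdot>\<^bsub>s\<^esub> (R \<cdot>\<^bsub>s\<^esub> \<Delta> K)" ..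
  also have "\<dots> = flip s J \<cdot>\<^bsub>s\<^esub> R \<cdot>\<^bsub>s\<^esub> ?J' \<cdot>\<^bsub>s\<^esub> pure s [1, K] \<cdot>\<^bsub>s\<^esub> ?P \<cdot>\<^bsub>s\<^esub> pure s [K, 1]"
    unfolding \<Delta>K by (simp only: assoc mem)
  also have "flip s J \<cdot>\<^bsub>s\<^esub> R \<cdot>\<^bsub>s\<^esub> ?J' = flip s (on_both \<psi> \<psi> R)"
    unfolding RJ[symmetric] by (rule flip_on_both[OF linear_\<psi> linear_\<psi> R_tpow, symmetric])
  finally show ?thesis .
qed

text \<open>
  The reflection equation after application of \<open>\<psi>\<^sup>-\<^sup>1 \<otimes> \<psi>\<^sup>-\<^sup>1\<close>, where all maps are expressed by \<open>\<psi>\<^sup>-\<^sup>1\<close> on the first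
  leg and flips. In this form the coefficients of the relation of length four appear when the
  automorphisms are moved to the right.
\<close>

lemma untwisted_reflection_equation:
  "pure s [\<psi>' K, 1] \<cdot>\<^bsub>s\<^esub> on_both \<psi>' id (flip s R) \<cdot>\<^bsub>s\<^esub> pure s [1, \<psi>' K]
      \<cdot>\<^bsub>s\<^esub> on_both \<psi>' id (flip s (on_both \<psi>' id (flip s R)))
    = flip s R \<cdot>\<^bsub>s\<^esub> pure s [1, \<psi>' K] \<cdot>\<^bsub>s\<^esub> flip s (on_both \<psi>' id (flip s R)) \<cdot>\<^bsub>s\<^esub> pure s [\<psi>' K, 1]"
proof -
  let ?\<Psi> = "on_both \<psi>' \<psi>'"
  note lin = linear_\<psi> linear_\<psi>' linear_id
  note mult = on_both_tmult[OF linear_\<psi>' \<psi>'_mult linear_\<psi>' \<psi>'_mult]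
  note R' = flip_tpow[OF R_tpow]
  have P: "on_both \<psi> id R \<in> tpow s 2" "on_both \<psi> \<psi> R \<in> tpow s 2"
    using lin R_tpow by (blast intro: on_both_tpow)+
  note mem = P R_tpow pure2_tpow flip_tpow tmult_tpow
  have pure: "?\<Psi> (pure s [x, y]) = pure s [\<psi>' x, \<psi>' y]" for x y
    by (rule tmap_both_pure[OF linear_\<psi>' linear_\<psi>'])
  have "flip s (on_both \<psi>' id (flip s R)) = on_both id \<psi>' R"
    by (simp only: flip_on_both[OF linear_\<psi>' linear_id R'] flip_flip[OF R_tpow])
  moreover have "on_both \<psi>' id (on_both id \<psi>' R) = ?\<Psi> R"
    by (rule on_both_on_both) (simp_all only: lin R_tpow id_apply)
  moreover have "?\<Psi> (flip s (on_both \<psi> id R)) = on_both \<psi>' id (flip s R)"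
    unfolding flip_on_both[OF linear_\<psi> linear_id R_tpow]
    by (rule on_both_on_both) (simp_all only: lin R' id_apply \<psi>'_\<psi>)
  moreover have "?\<Psi> (on_both \<psi> id R) = on_both id \<psi>' R"
    by (rule on_both_on_both) (simp_all only: lin R_tpow id_apply \<psi>'_\<psi>)
  moreover have "?\<Psi> (flip s (on_both \<psi> \<psi> R)) = flip s R"
  proof -
    have "?\<Psi> (on_both \<psi> \<psi> (flip s R)) = on_both id id (flip s R)"
      by (rule on_both_on_both) (simp_all only: lin R' id_apply \<psi>'_\<psi>)
    then show ?thesis
      by (simp only: flip_on_both[OF linear_\<psi> linear_\<psi> R_tpow] on_both_id[OF R'])
  qed
  ultimately show ?thesis
    using arg_cong[OF reflection_equation, of ?\<Psi>] by (simp only: mult mem pure \<psi>'_one)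
qed


section \<open>The cylindrical braiding\<close>

definition cylinder_twist :: "nat \<Rightarrow> ('f, 'h) tensor \<Rightarrow> ('f, 'h) tensor"
  where "cylinder_twist n t = on_first n \<psi>' (pure s (K # replicate (n - 1) 1) \<cdot>\<^bsub>s\<^esub> t)"

context
  fixes n :: nat
  assumes n: "1 \<le> n"
begin

lemma pure_first_tpow: "pure s (x # replicate (n - 1) 1) \<in> tpow s n"
  using n by (intro pure_in_tpow) simp

lemma cylinder_twist_eq:
  assumes t: "t \<in> tpow s n"
  shows "cylinder_twist n t = pure s (\<psi>' K # replicate (n - 1) 1) \<cdot>\<^bsub>s\<^esub> on_first n \<psi>' t"
proof -
  have "on_first n \<psi>' (pure s (K # replicate (n - 1) 1)) = pure s (\<psi>' K # replicate (n - 1) 1)"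
    using n by (intro on_first_pure linear_\<psi>') simp
  then show ?thesis
    unfolding cylinder_twist_def
    by (simp only: on_first_tmult[OF linear_\<psi>' \<psi>'_mult n pure_first_tpow t])
qed

lemma cylinder_twist_tpow: "t \<in> tpow s n \<Longrightarrow> cylinder_twist n t \<in> tpow s n"
  unfolding cylinder_twist_def by (intro on_first_tpow linear_\<psi>' n tmult_tpow pure_first_tpow)

lemma cylinder_twist_add:
  "t \<in> tpow s n \<Longrightarrow> u \<in> tpow s n \<Longrightarrow> cylinder_twist n (t + u) = cylinder_twist n t + cylinder_twist n u"
  and cylinder_twist_scale:
  "t \<in> tpow s n \<Longrightarrow> cylinder_twist n (tscale c t) = tscale c (cylinder_twist n t)"
  by (simp_all only: cylinder_twist_def tmult_linear_right[OF pure_first_tpow] tmap_add tmap_scale)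

text \<open>
  The inverse is \<open>\<psi>\<close> on the first leg followed by multiplication with \<open>K\<^sup>-\<^sup>1\<close>.
\<close>

lemma cylinder_twist_inverse:
  obtains g where "\<And>t. t \<in> tpow s n \<Longrightarrow> g t \<in> tpow s n"
    and "\<And>t. t \<in> tpow s n \<Longrightarrow> cylinder_twist n (g t) = t"
    and "\<And>t. t \<in> tpow s n \<Longrightarrow> g (cylinder_twist n t) = t"
proof -
  obtain L where L: "K * L = 1" "L * K = 1" using K_unit by blast
  let ?p = "\<lambda>x. pure s (x # replicate (n - 1) 1)"
  have pp: "?p x \<cdot>\<^bsub>s\<^esub> ?p y = ?p (x * y)" for x y
    by (simp add: tmult_pures zip_replicate)
  have p1: "?p 1 = pure s (replicate n 1)" using n by (cases n) simp_all
  have inv: "?p x \<cdot>\<^bsub>s\<^esub> (?p y \<cdot>\<^bsub>s\<^esub> t) = t" if "x * y = 1" "t \<in> tpow s n" for x y t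
    by (simp only: tmult_assoc[OF pure_first_tpow pure_first_tpow that(2), symmetric] pp that(1) p1
        tmult_one[OF that(2)])
  show thesis
  proof (rule that[of "\<lambda>t. ?p L \<cdot>\<^bsub>s\<^esub> on_first n \<psi> t"])
    fix t assume t: "t \<in> tpow s n"
    note \<psi>t = on_first_tpow[OF linear_\<psi> n t]
    note Kt = tmult_tpow[OF pure_first_tpow t, of K]
    show "?p L \<cdot>\<^bsub>s\<^esub> on_first n \<psi> t \<in> tpow s n" by (intro tmult_tpow pure_first_tpow \<psi>t)
    show "cylinder_twist n (?p L \<cdot>\<^bsub>s\<^esub> on_first n \<psi> t) = t"
      unfolding cylinder_twist_def inv[OF L(1) \<psi>t]
      by (rule on_first_on_first[OF linear_\<psi>' linear_\<psi> \<psi>'_\<psi> n t])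
    show "?p L \<cdot>\<^bsub>s\<^esub> on_first n \<psi> (cylinder_twist n t) = t"
      unfolding cylinder_twist_def on_first_on_first[OF linear_\<psi> linear_\<psi>' \<psi>_\<psi>' n Kt]
      by (rule inv[OF L(2) t])
  qed
qed

text \<open>
  On \<open>B \<otimes> H\<^sup>\<otimes>\<^sup>(\<^sup>n\<^sup>-\<^sup>1\<^sup>)\<close>, which contains \<open>\<Delta>\<^sup>(\<^sup>n\<^sup>)(b)\<close>, moving \<open>K\<close> past an element applies \<open>\<psi>\<close> to its first leg;
  then \<open>\<psi>\<^sup>-\<^sup>1\<close> undoes this.
\<close>

lemma cylinder_twist_tact:
  assumes "right_coideal s \<Delta> B" and inv: "cylindrically_invariant \<psi> K B"
    and b: "b \<in> B" and t: "t \<in> tpow s n"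
  shows "cylinder_twist n (tact s \<Delta> n b t) = tact s \<Delta> n b (cylinder_twist n t)"
proof -
  let ?p = "\<lambda>x. pure s (x # replicate (n - 1) 1)"
  let ?A = "{c # hs |c hs. c \<in> B \<and> length hs = n - 1}"
  define D where "D = comult_iter s \<Delta> (n - 1) b"
  have D: "D \<in> tpow s n" using comult_iter_tpow[of "n - 1" b] n by (simp add: D_def)
  have sub: "u \<in> tpow s n" if "u \<in> tensor.span (pure s ` ?A)" for u
    using that unfolding tpow_def by (rule tensor.span_mono[THEN subsetD, rotated]) (use n in auto)
  have "D \<in> tensor.span (pure s ` ?A)"
    unfolding D_def by (rule comult_iter_coideal[OF assms(1) b])
  moreover have "b # replicate (n - 1) 1 \<in> ?A" using b by simp
  then have "?A \<noteq> {}" by blast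
  ultimately have "?p K \<cdot>\<^bsub>s\<^esub> D = on_first n \<psi> D \<cdot>\<^bsub>s\<^esub> ?p K"
  proof (induction rule: span_pure_induct)
    case (pure xs)
    then obtain c hs where c: "c \<in> B" "length hs = n - 1" "xs = c # hs" by blast
    have "map2 (*) (replicate (n - 1) 1) hs = hs" "map2 (*) hs (replicate (n - 1) 1) = hs"
      using c(2) by (auto intro: nth_equalityI)
    moreover have "on_first n \<psi> (pure s xs) = pure s (\<psi> c # hs)"
      unfolding c(3) using c(2) n by (intro on_first_pure linear_\<psi>) simp
    moreover have "K * c = \<psi> c * K" using inv c(1) by (simp add: cylindrically_invariant_def)
    ultimately show ?case using c by (simp add: tmult_pures del: o_apply One_nat_def)
  next
    case (add u v)
    then show ?case
      by (simp only: tmap_add tmult_linear_left tmult_add_right[OF pure_first_tpow sub sub])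
  next
    case (scale c u)
    then show ?case
      by (simp only: tmap_scale tmult_linear_left tmult_scale_right[OF pure_first_tpow sub])
  qed
  then have "?p K \<cdot>\<^bsub>s\<^esub> (D \<cdot>\<^bsub>s\<^esub> t) = on_first n \<psi> D \<cdot>\<^bsub>s\<^esub> (?p K \<cdot>\<^bsub>s\<^esub> t)"
    using tmult_assoc[OF pure_first_tpow D t, of K]
      tmult_assoc[OF on_first_tpow[OF linear_\<psi> n D] pure_first_tpow t, of K] by simp
  then show ?thesis
    unfolding tact_def cylinder_twist_def D_def[symmetric]
    by (simp only: on_first_tmult[OF linear_\<psi>' \<psi>'_mult n on_first_tpow[OF linear_\<psi> n D]
          tmult_tpow[OF pure_first_tpow t]] on_first_on_first[OF linear_\<psi>' linear_\<psi> \<psi>'_\<psi> n D])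
qed

end

lemma cylinder_twist_braiding_commute:
  assumes i: "2 \<le> i" "i + 1 \<le> n" and t: "t \<in> tpow s n"
  shows "cylinder_twist n (braiding n i t) = braiding n i (cylinder_twist n t)"
proof -
  let ?k = "pure s (\<psi>' K # replicate (n - 1) 1)" and ?r = "leg s n (i + 1) i R"
    and ?\<tau> = "tswap s n i (i + 1)" and ?\<Psi> = "on_first n \<psi>'"
  have n: "1 \<le> n" and ij: "i \<in> {2..n}" "i + 1 \<in> {2..n}" "i + 1 \<noteq> i"
    and ij1: "i \<in> {1..n}" "i + 1 \<in> {1..n}" "1 \<le> i" using i by auto
  have k: "?k \<in> tpow s n" by (rule pure_first_tpow[OF n])
  have r: "?r \<in> tpow s n" using ij ij1 R_tpow by (intro leg_tpow) auto
  note \<Psi>_mult = on_first_tmult[OF linear_\<psi>' \<psi>'_mult n]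
  note \<Psi> = on_first_tpow[OF linear_\<psi>' n] and \<tau> = tswap_tpow[OF ij1(1,2)]
  have \<Psi>r: "?\<Psi> ?r = ?r" using ij R_tpow by (intro on_first_leg linear_\<psi>' \<psi>'_one) auto
  have kr: "?k \<cdot>\<^bsub>s\<^esub> ?r = ?r \<cdot>\<^bsub>s\<^esub> ?k" using ij R_tpow by (intro pure_first_leg_commute) auto
  have "cylinder_twist n (braiding n i t) = ?k \<cdot>\<^bsub>s\<^esub> (?r \<cdot>\<^bsub>s\<^esub> ?\<Psi> (?\<tau> t))"
    unfolding cylinder_twist_eq[OF n braiding_tpow[OF ij1(3) i(2) t]]
    by (simp only: braiding_eq[OF ij1(3) i(2) t] \<Psi>_mult[OF r \<tau>[OF t]] \<Psi>r)
  also have "\<dots> = ?r \<cdot>\<^bsub>s\<^esub> (?k \<cdot>\<^bsub>s\<^esub> ?\<tau> (?\<Psi> t))"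
    using tmult_assoc[OF k r \<tau>[OF \<Psi>[OF t]]] tmult_assoc[OF r k \<tau>[OF \<Psi>[OF t]]] kr
      on_first_tswap[OF linear_\<psi>' ij(1,2) t] by simp
  also have "\<dots> = braiding n i (cylinder_twist n t)"
    unfolding braiding_eq[OF ij1(3) i(2) cylinder_twist_tpow[OF n t]]
    by (simp only: cylinder_twist_eq[OF n t] tswap_tmult[OF ij1(1,2) k \<Psi>[OF t]]
        pure_first_tswap_commute[OF ij(1,2)])
  finally show ?thesis .
qed

text \<open>
  Moving all automorphisms to the right, both sides become an element of the first two legs times an
  automorphism. The elements agree by the untwisted reflection equation, the automorphisms since
  \<open>\<psi>\<^sup>-\<^sup>1\<close> on the first leg commutes with \<open>\<psi>\<^sup>-\<^sup>1\<close> on the second.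
\<close>

lemma cylinder_twist_braiding_reflection:
  assumes n: "2 \<le> n" and t: "t \<in> tpow s n"
  shows "cylinder_twist n (braiding n 1 (cylinder_twist n (braiding n 1 t)))
    = braiding n 1 (cylinder_twist n (braiding n 1 (cylinder_twist n t)))"
proof -
  let ?e = "leg s n 1 2" and ?\<tau> = "tswap s n 1 2" and ?\<Psi> = "on_first n \<psi>'"
  let ?P = "on_both \<psi>' id" and ?R = "flip s R"
  let ?k = "?e (pure s [\<psi>' K, 1])" and ?k' = "?e (pure s [1, \<psi>' K])"
  let ?r = "?e ?R" and ?a = "?e (?P ?R)" and ?b = "?e (flip s (?P ?R))" and ?c = "?e (?P (flip s (?P ?R)))"
  have n1: "1 \<le> n" "1 + 1 \<le> n" and legs: "1 \<in> {1..n}" "2 \<in> {1..n}" "(1::nat) \<noteq> 2" using n by auto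
  have R: "?R \<in> tpow s 2" by (rule flip_tpow[OF R_tpow])
  note P = on_both_tpow[OF linear_\<psi>' linear_id]
  note in2 = R P[OF R] flip_tpow[OF P[OF R]] P[OF flip_tpow[OF P[OF R]]] pure2_tpow
  note e = leg_tpow[OF legs] and e_mult = leg_tmult[OF legs]
  note \<tau> = tswap_tpow[OF legs(1,2)] and \<Psi> = on_first_tpow[OF linear_\<psi>' n1(1)]
  have \<tau>e: "?\<tau> (?e u) = ?e (flip s u)" if "u \<in> tpow s 2" for u
    using tswap_leg[OF legs legs(1,2) that] leg_flip[OF legs that] by simp
  note \<Psi>e = on_first_leg_12[OF linear_\<psi>' n]
  have P_pure: "?P (pure s [x, y]) = pure s [\<psi>' x, y]" for x y
    using tmap_both_pure[OF linear_\<psi>' linear_id, of x y] by simp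
  have k: "pure s (\<psi>' K # replicate (n - 1) 1) = ?k"
  proof -
    obtain m where m: "n = Suc (Suc m)" using n by (metis add_2_eq_Suc le_Suc_ex)
    show ?thesis using legs by (subst leg_pure) (simp_all add: m numeral_2_eq_2)
  qed
  have twist: "cylinder_twist n u = ?k \<cdot>\<^bsub>s\<^esub> ?\<Psi> u" if "u \<in> tpow s n" for u
    using cylinder_twist_eq[OF n1(1) that] k by simp
  have braid: "braiding n 1 u = ?r \<cdot>\<^bsub>s\<^esub> ?\<tau> u" if "u \<in> tpow s n" for u
    using braiding_eq[OF _ n1(2) that] leg_flip[OF legs R_tpow] by (simp add: numeral_2_eq_2)
  note steps = tswap_tmult[OF legs(1,2)] on_first_tmult[OF linear_\<psi>' \<psi>'_mult n1(1)]
    \<tau>e \<Psi>e flip_pure P_pure \<psi>'_one e \<tau> \<Psi> tmult_tpow in2 t flip_flip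
  have "cylinder_twist n (braiding n 1 (cylinder_twist n (braiding n 1 t)))
      = ?k \<cdot>\<^bsub>s\<^esub> (?a \<cdot>\<^bsub>s\<^esub> (?k' \<cdot>\<^bsub>s\<^esub> (?c \<cdot>\<^bsub>s\<^esub> ?\<Psi> (?\<tau> (?\<Psi> (?\<tau> t))))))"
    by (simp only: twist braid steps)
  also have "\<dots> = ?e (pure s [\<psi>' K, 1] \<cdot>\<^bsub>s\<^esub> ?P ?R \<cdot>\<^bsub>s\<^esub> pure s [1, \<psi>' K] \<cdot>\<^bsub>s\<^esub> ?P (flip s (?P ?R)))
      \<cdot>\<^bsub>s\<^esub> ?\<Psi> (?\<tau> (?\<Psi> (?\<tau> t)))"
    by (simp only: e_mult tmult_assoc[where n = n] steps)
  also have "\<dots> = ?e (?R \<cdot>\<^bsub>s\<^esub> pure s [1, \<psi>' K] \<cdot>\<^bsub>s\<^esub> flip s (?P ?R) \<cdot>\<^bsub>s\<^esub> pure s [\<psi>' K, 1])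
      \<cdot>\<^bsub>s\<^esub> ?\<tau> (?\<Psi> (?\<tau> (?\<Psi> t)))"
    by (simp only: untwisted_reflection_equation on_first_conjugate_commute[OF linear_\<psi>' n t])
  also have "\<dots> = ?r \<cdot>\<^bsub>s\<^esub> (?k' \<cdot>\<^bsub>s\<^esub> (?b \<cdot>\<^bsub>s\<^esub> (?k \<cdot>\<^bsub>s\<^esub> ?\<tau> (?\<Psi> (?\<tau> (?\<Psi> t))))))"
    by (simp only: e_mult tmult_assoc[where n = n] steps)
  also have "\<dots> = braiding n 1 (cylinder_twist n (braiding n 1 (cylinder_twist n t)))"
    by (simp only: twist braid steps)
  finally show ?thesis .
qed

end


section \<open>Groups given by generators and relations\<close>

lemma words_simps:
  "[] \<in> words G" "(x # w) \<in> words G \<longleftrightarrow> fst x \<in> G \<and> w \<in> words G"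
  "u @ v \<in> words G \<longleftrightarrow> u \<in> words G \<and> v \<in> words G"
  by (cases x; auto simp: words_def)+

lemma pres_rel_words: "(v, w) \<in> pres_rel G rels \<Longrightarrow> v \<in> words G \<and> w \<in> words G"
  by (induction rule: pres_rel.induct) (auto simp: words_simps)

lemma equiv_pres_rel: "equiv (words G) (pres_rel G rels)"
  by (rule equivI)
    (auto intro!: refl_onI symI transI intro: pres_refl pres_sym pres_trans dest: pres_rel_words)

lemma pres_rel_append_left:
  "(v, w) \<in> pres_rel G rels \<Longrightarrow> x \<in> words G \<Longrightarrow> (x @ v, x @ w) \<in> pres_rel G rels"
proof (induction rule: pres_rel.induct)
  case (pres_cancel u v g e)
  then show ?case using pres_rel.pres_cancel[of "x @ u" G v g e rels] by (simp add: words_simps)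
next
  case (pres_relator u v l r)
  then show ?case using pres_rel.pres_relator[of "x @ u" G v l r rels] by (simp add: words_simps)
qed (auto intro: pres_rel.intros simp: words_simps)

lemma pres_rel_append_right:
  "(v, w) \<in> pres_rel G rels \<Longrightarrow> x \<in> words G \<Longrightarrow> (v @ x, w @ x) \<in> pres_rel G rels"
proof (induction rule: pres_rel.induct)
  case (pres_cancel u v g e)
  then show ?case using pres_rel.pres_cancel[of u G "v @ x" g e rels] by (simp add: words_simps)
next
  case (pres_relator u v l r)
  then show ?case using pres_rel.pres_relator[of u G "v @ x" l r rels] by (simp add: words_simps)
qed (auto intro: pres_rel.intros simp: words_simps)

lemma pres_rel_append:
  assumes "(u, u') \<in> pres_rel G rels" and "(v, v') \<in> pres_rel G rels"
  shows "(u @ v, u' @ v') \<in> pres_rel G rels"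
  using assms pres_rel_words by (blast intro: pres_trans pres_rel_append_left pres_rel_append_right)

lemma presented_group_mult:
  assumes u: "u \<in> words G" and v: "v \<in> words G"
  shows "pres_rel G rels `` {u} \<otimes>\<^bsub>presented_group G rels\<^esub> pres_rel G rels `` {v}
    = pres_rel G rels `` {u @ v}"
proof -
  have "pres_rel G rels `` {x @ y} = pres_rel G rels `` {u @ v}"
    if "x \<in> pres_rel G rels `` {u}" "y \<in> pres_rel G rels `` {v}" for x y
  proof -
    have "(u @ v, x @ y) \<in> pres_rel G rels" using that by (auto intro: pres_rel_append)
    then show ?thesis by (rule equiv_class_eq[OF equiv_pres_rel, symmetric])
  qed
  moreover have "u \<in> pres_rel G rels `` {u}" "v \<in> pres_rel G rels `` {v}"
    using u v by (auto intro: pres_refl)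
  ultimately have "(\<Union>x\<in>pres_rel G rels `` {u}. \<Union>y\<in>pres_rel G rels `` {v}. pres_rel G rels `` {x @ y})
      = pres_rel G rels `` {u @ v}" by blast
  then show ?thesis by (simp only: presented_group_def monoid.simps)
qed

lemma presented_group_carrier:
  "X \<in> carrier (presented_group G rels) \<longleftrightarrow> (\<exists>w\<in>words G. X = pres_rel G rels `` {w})"
  by (auto simp: presented_group_def quotient_def)

definition inverse_word :: "'g word \<Rightarrow> 'g word"
  where "inverse_word w = rev (map (\<lambda>(g, e). (g, \<not> e)) w)"

lemma inverse_word_words: "w \<in> words G \<Longrightarrow> inverse_word w \<in> words G"
  by (induction w) (auto simp: inverse_word_def words_simps)

lemma inverse_word_cancel: "w \<in> words G \<Longrightarrow> (inverse_word w @ w, []) \<in> pres_rel G rels"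
proof (induction w)
  case Nil
  then show ?case by (simp add: inverse_word_def pres_refl words_simps)
next
  case (Cons x w)
  obtain g e where x: "x = (g, e)" by fastforce
  have "(inverse_word w @ [(g, \<not> e), (g, \<not> \<not> e)] @ w, inverse_word w @ w) \<in> pres_rel G rels"
    using Cons.prems by (intro pres_cancel inverse_word_words) (simp_all add: words_simps x)
  with Cons have "(inverse_word w @ [(g, \<not> e), (g, e)] @ w, []) \<in> pres_rel G rels"
    by (auto simp: words_simps intro: pres_trans)
  then show ?case by (simp add: x inverse_word_def)
qed

lemma group_presented_group: "group (presented_group G rels)"
proof (rule groupI)
  have one: "\<one>\<^bsub>presented_group G rels\<^esub> = pres_rel G rels `` {[]}"
    by (simp add: presented_group_def)
  then show "\<one>\<^bsub>presented_group G rels\<^esub> \<in> carrier (presented_group G rels)"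
    using presented_group_carrier words_simps(1) by blast
  fix X assume "X \<in> carrier (presented_group G rels)"
  then obtain u where u: "u \<in> words G" "X = pres_rel G rels `` {u}"
    using presented_group_carrier by blast
  show "\<one>\<^bsub>presented_group G rels\<^esub> \<otimes>\<^bsub>presented_group G rels\<^esub> X = X"
    using u by (simp add: one presented_group_mult words_simps)
  have "pres_rel G rels `` {inverse_word u} \<otimes>\<^bsub>presented_group G rels\<^esub> X = \<one>\<^bsub>presented_group G rels\<^esub>"
    using u by (simp add: one presented_group_mult inverse_word_words
        equiv_class_eq[OF equiv_pres_rel inverse_word_cancel])
  then show "\<exists>Y\<in>carrier (presented_group G rels).
      Y \<otimes>\<^bsub>presented_group G rels\<^esub> X = \<one>\<^bsub>presented_group G rels\<^esub>"
    using u(1) presented_group_carrier inverse_word_words by blast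
  fix Y assume "Y \<in> carrier (presented_group G rels)"
  then obtain v where v: "v \<in> words G" "Y = pres_rel G rels `` {v}"
    using presented_group_carrier by blast
  show "X \<otimes>\<^bsub>presented_group G rels\<^esub> Y \<in> carrier (presented_group G rels)"
    using u v presented_group_carrier words_simps(3) by (metis presented_group_mult)
  fix Z assume "Z \<in> carrier (presented_group G rels)"
  then obtain w where w: "w \<in> words G" "Z = pres_rel G rels `` {w}"
    using presented_group_carrier by blast
  show "X \<otimes>\<^bsub>presented_group G rels\<^esub> Y \<otimes>\<^bsub>presented_group G rels\<^esub> Z
      = X \<otimes>\<^bsub>presented_group G rels\<^esub> (Y \<otimes>\<^bsub>presented_group G rels\<^esub> Z)"
    using u v w by (simp add: presented_group_mult words_simps)
qed

definition word_value :: "('a, 'b) monoid_scheme \<Rightarrow> ('g \<Rightarrow> 'a) \<Rightarrow> 'g word \<Rightarrow> 'a"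
  where "word_value H f w
    = foldr (\<lambda>(g, e) y. (if e then f g else inv\<^bsub>H\<^esub> f g) \<otimes>\<^bsub>H\<^esub> y) w \<one>\<^bsub>H\<^esub>"

lemma word_value_simps:
  "word_value H f [] = \<one>\<^bsub>H\<^esub>"
  "word_value H f ((g, e) # w) = (if e then f g else inv\<^bsub>H\<^esub> f g) \<otimes>\<^bsub>H\<^esub> word_value H f w"
  by (simp_all add: word_value_def)

context group
begin

lemma word_value_closed:
  "f \<in> S \<rightarrow> carrier G \<Longrightarrow> w \<in> words S \<Longrightarrow> word_value G f w \<in> carrier G"
  by (induction w) (auto simp: word_value_simps words_simps Pi_iff)

lemma word_value_append:
  assumes f: "f \<in> S \<rightarrow> carrier G" and "u \<in> words S" and v: "v \<in> words S"
  shows "word_value G f (u @ v) = word_value G f u \<otimes> word_value G f v"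
  using assms(2)
  by (induction u) (use f v in \<open>auto simp: word_value_simps words_simps Pi_iff m_assoc word_value_closed[OF f]\<close>)

lemma word_value_pres_rel:
  assumes f: "f \<in> S \<rightarrow> carrier G"
    and rels: "\<And>l r. (l, r) \<in> rels \<Longrightarrow> l \<in> words S \<Longrightarrow> r \<in> words S \<Longrightarrow>
      word_value G f l = word_value G f r"
    and "(v, w) \<in> pres_rel S rels"
  shows "word_value G f v = word_value G f w"
  using assms(3)
proof (induction rule: pres_rel.induct)
  case (pres_cancel u v g e)
  then have "f g \<in> carrier G" using f by blast
  then have "word_value G f ([(g, e), (g, \<not> e)] @ v) = word_value G f v"
    using word_value_closed[OF f pres_cancel(2)]
    by (cases e) (simp_all add: word_value_simps flip: m_assoc)
  with pres_cancel show ?case by (simp add: word_value_append[OF f] words_simps)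
next
  case (pres_relator u v l r)
  then show ?case by (simp add: word_value_append[OF f] words_simps rels)
qed simp_all

text \<open>
  The universal property. The homomorphism evaluates any representative of a class; evaluation does not
  depend on the choice because it respects cancellation and the relations.
\<close>

theorem presented_group_universal:
  assumes f: "f \<in> S \<rightarrow> carrier G"
    and rels: "\<And>l r. (l, r) \<in> rels \<Longrightarrow> l \<in> words S \<Longrightarrow> r \<in> words S \<Longrightarrow>
      word_value G f l = word_value G f r"
  shows "\<exists>\<mu>. group_hom (presented_group S rels) G \<mu> \<and>
    (\<forall>g\<in>S. \<mu> (pres_rel S rels `` {[(g, True)]}) = f g)"
proof -
  define \<mu> where "\<mu> X = word_value G f (SOME w. w \<in> X)" for X
  have \<mu>: "\<mu> (pres_rel S rels `` {w}) = word_value G f w" if "w \<in> words S" for w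
  proof -
    have "w \<in> pres_rel S rels `` {w}" using that by (auto intro: pres_refl)
    then have "(SOME v. v \<in> pres_rel S rels `` {w}) \<in> pres_rel S rels `` {w}" by (rule someI)
    then show ?thesis unfolding \<mu>_def by (auto intro!: word_value_pres_rel[OF f rels, symmetric])
  qed
  have "\<mu> \<in> hom (presented_group S rels) G"
  proof (rule homI)
    fix X assume "X \<in> carrier (presented_group S rels)"
    then obtain u where u: "u \<in> words S" "X = pres_rel S rels `` {u}"
      using presented_group_carrier by blast
    then show "\<mu> X \<in> carrier G" using f by (simp add: \<mu> word_value_closed)
    fix Y assume "Y \<in> carrier (presented_group S rels)"
    then obtain v where v: "v \<in> words S" "Y = pres_rel S rels `` {v}"
      using presented_group_carrier by blast
    show "\<mu> (X \<otimes>\<^bsub>presented_group S rels\<^esub> Y) = \<mu> X \<otimes> \<mu> Y"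
      using u v by (simp add: presented_group_mult \<mu> words_simps word_value_append[OF f])
  qed
  then have "group_hom (presented_group S rels) G \<mu>"
    by (intro group_hom.intro group_presented_group group_axioms group_hom_axioms.intro)
  moreover have "\<mu> (pres_rel S rels `` {[(g, True)]}) = f g" if "g \<in> S" for g
  proof -
    have "f g \<in> carrier G" using f that by blast
    with that show ?thesis by (simp add: \<mu> words_simps word_value_simps)
  qed
  ultimately show ?thesis by blast
qed

end


section \<open>The automorphism group\<close>

lemma Aut_tpow_carrier:
  "f \<in> carrier (Aut_tpow s \<Delta> B n) \<longleftrightarrow> f \<in> Bij (tpow s n) \<and>
    (\<forall>t\<in>tpow s n. \<forall>u\<in>tpow s n. f (t + u) = f t + f u) \<and>
    (\<forall>c. \<forall>t\<in>tpow s n. f (tscale c t) = tscale c (f t)) \<and>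
    (\<forall>b\<in>B. \<forall>t\<in>tpow s n. f (tact s \<Delta> n b t) = tact s \<Delta> n b (f t))"
  by (simp add: Aut_tpow_def)

lemma Bij_into: "f \<in> Bij S \<Longrightarrow> x \<in> S \<Longrightarrow> f x \<in> S"
  by (auto simp: Bij_def bij_betw_def)

lemma Aut_tpow_mult:
  assumes "f \<in> carrier (Aut_tpow s \<Delta> B n)" and "g \<in> carrier (Aut_tpow s \<Delta> B n)" and "t \<in> tpow s n"
  shows "(f \<otimes>\<^bsub>Aut_tpow s \<Delta> B n\<^esub> g) t = f (g t)"
  using assms unfolding Aut_tpow_carrier by (simp add: Aut_tpow_def BijGroup_def compose_def)

lemma Aut_tpow_eqI:
  assumes "f \<in> carrier (Aut_tpow s \<Delta> B n)" and "g \<in> carrier (Aut_tpow s \<Delta> B n)"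
    and "\<And>t. t \<in> tpow s n \<Longrightarrow> f t = g t"
  shows "f = g"
proof -
  have "f \<in> extensional (tpow s n)" "g \<in> extensional (tpow s n)"
    using assms(1,2) unfolding Aut_tpow_carrier Bij_def by auto
  then show ?thesis using assms(3) by (rule extensionalityI)
qed

text \<open>
  A subgroup of the group of bijections. That the inverse of an automorphism is again linear and
  commutes with the action follows by applying the injective automorphism to both sides; for this the
  action has to preserve the tensor power.
\<close>

lemma group_Aut_tpow:
  assumes act: "\<And>b t. b \<in> B \<Longrightarrow> t \<in> tpow s n \<Longrightarrow> tact s \<Delta> n b t \<in> tpow s n"
  shows "group (Aut_tpow s \<Delta> B n)"
proof -
  interpret Bij: group "BijGroup (tpow s n)" by (rule group_BijGroup)
  let ?A = "{f \<in> Bij (tpow s n).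
    (\<forall>t\<in>tpow s n. \<forall>u\<in>tpow s n. f (t + u) = f t + f u) \<and>
    (\<forall>c. \<forall>t\<in>tpow s n. f (tscale c t) = tscale c (f t)) \<and>
    (\<forall>b\<in>B. \<forall>t\<in>tpow s n. f (tact s \<Delta> n b t) = tact s \<Delta> n b (f t))}"
  have "subgroup ?A (BijGroup (tpow s n))"
  proof (rule Bij.subgroupI)
    show "?A \<subseteq> carrier (BijGroup (tpow s n))" by (auto simp: BijGroup_def)
    have "(\<lambda>t\<in>tpow s n. t) \<in> ?A"
      using id_Bij by (auto simp: act tpow_add tpow_scale)
    then show "?A \<noteq> {}" by blast
  next
    fix f assume f: "f \<in> ?A"
    define g where "g = (\<lambda>t\<in>tpow s n. inv_into (tpow s n) f t)"
    have bij: "bij_betw f (tpow s n) (tpow s n)" using f by (simp add: Bij_def)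
    have fadd: "f (t + u) = f t + f u" if "t \<in> tpow s n" "u \<in> tpow s n" for t u
      using f that by blast
    have fscale: "f (tscale c t) = tscale c (f t)" if "t \<in> tpow s n" for c t
      using f that by blast
    have fact: "f (tact s \<Delta> n b t) = tact s \<Delta> n b (f t)" if "b \<in> B" "t \<in> tpow s n" for b t
      using f that by blast
    have g: "g t \<in> tpow s n" "f (g t) = t" if "t \<in> tpow s n" for t
      using that bij by (auto simp: g_def bij_betw_def inv_into_into f_inv_into_f)
    have inj: "t = u" if "t \<in> tpow s n" "u \<in> tpow s n" "f t = f u" for t u
      using that bij by (auto simp: bij_betw_def dest: inj_onD)
    have "g \<in> ?A"
    proof (intro CollectI conjI ballI allI)
      show "g \<in> Bij (tpow s n)" unfolding g_def by (rule restrict_inv_into_Bij) (use f in blast)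
      show "g (t + u) = g t + g u" if "t \<in> tpow s n" "u \<in> tpow s n" for t u
        by (rule inj) (use that in \<open>simp_all add: g tpow_add fadd\<close>)
      show "g (tscale c t) = tscale c (g t)" if "t \<in> tpow s n" for c t
        by (rule inj) (use that in \<open>simp_all add: g tpow_scale fscale\<close>)
      show "g (tact s \<Delta> n b t) = tact s \<Delta> n b (g t)" if "b \<in> B" "t \<in> tpow s n" for b t
        by (rule inj) (use that in \<open>simp_all add: g act fact\<close>)
    qed
    then show "inv\<^bsub>BijGroup (tpow s n)\<^esub> f \<in> ?A" using f by (simp add: inv_BijGroup g_def)
  next
    fix f g assume f: "f \<in> ?A" and g: "g \<in> ?A"
    have "compose (tpow s n) f g \<in> ?A"
    proof (intro CollectI conjI ballI allI)
      show "compose (tpow s n) f g \<in> Bij (tpow s n)" using f g by (intro compose_Bij) auto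
    qed (use f g in \<open>simp_all add: compose_def tpow_add tpow_scale act Bij_into\<close>)
    then show "f \<otimes>\<^bsub>BijGroup (tpow s n)\<^esub> g \<in> ?A" using f g by (simp add: BijGroup_def)
  qed
  then show ?thesis unfolding Aut_tpow_def by (rule Bij.subgroup_imp_group)
qed


section \<open>The representation of the cylindrical braid group\<close>

context cylindrical_bialgebra
begin

theorem braid_group_action:
  assumes coideal: "right_coideal s \<Delta> B" and inv: "cylindrically_invariant \<psi> K B" and n: "1 \<le> n"
  shows "\<exists>\<mu>. group_hom (cyl_braid_group n) (Aut_tpow s \<Delta> B n) \<mu> \<and>
    \<mu> (cyl_braid_gen n 0) = restrict (cylinder_twist n) (tpow s n) \<and>
    (\<forall>i\<in>{1..n - 1}. \<mu> (cyl_braid_gen n i) = restrict (braiding n i) (tpow s n))"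
proof -
  let ?G = "Aut_tpow s \<Delta> B n"
  define f where "f i = (if i = 0 then cylinder_twist n else braiding n i)" for i
  let ?f = "\<lambda>i. restrict (f i) (tpow s n)"
  have act: "tact s \<Delta> n b t \<in> tpow s n" if "t \<in> tpow s n" for b t
    unfolding tact_def using that comult_iter_tpow[of "n - 1" b] n by (simp add: tmult_tpow)
  interpret G: group ?G by (rule group_Aut_tpow) (rule act)
  have into: "f i t \<in> tpow s n" if "i < n" "t \<in> tpow s n" for i t
    using that n by (simp add: f_def cylinder_twist_tpow braiding_tpow)
  have f_carrier: "?f i \<in> carrier ?G" if i: "i < n" for i
    unfolding Aut_tpow_carrier
  proof (intro conjI ballI allI)
    obtain g where g: "\<And>t. t \<in> tpow s n \<Longrightarrow> g t \<in> tpow s n" "\<And>t. t \<in> tpow s n \<Longrightarrow> f i (g t) = t"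
        "\<And>t. t \<in> tpow s n \<Longrightarrow> g (f i t) = t"
    proof (cases "i = 0")
      case True
      then show ?thesis using cylinder_twist_inverse[OF n] that by (auto simp: f_def)
    next
      case False
      then have "1 \<le> i" "i + 1 \<le> n" using i by auto
      from braiding_inverse[OF this] that False show ?thesis by (auto simp: f_def)
    qed
    have "bij_betw (f i) (tpow s n) (tpow s n)"
      by (rule bij_betw_byWitness[of _ g]) (use g into[OF i] in auto)
    then have "bij_betw (?f i) (tpow s n) (tpow s n)"
      by (rule bij_betw_cong[THEN iffD1, rotated]) simp
    then show "?f i \<in> Bij (tpow s n)" by (simp add: Bij_def)
    show "?f i (t + u) = ?f i t + ?f i u" if "t \<in> tpow s n" "u \<in> tpow s n" for t u
      using that i n by (simp add: f_def tpow_add cylinder_twist_add braiding_add)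
    show "?f i (tscale c t) = tscale c (?f i t)" if "t \<in> tpow s n" for c t
      using that i n by (simp add: f_def tpow_scale cylinder_twist_scale braiding_scale)
    show "?f i (tact s \<Delta> n b t) = tact s \<Delta> n b (?f i t)" if "b \<in> B" "t \<in> tpow s n" for b t
      using that i n by (simp add: f_def act cylinder_twist_tact[OF n coideal inv] braiding_tact)
  qed
  have f_mult: "(?f i \<otimes>\<^bsub>?G\<^esub> g) t = f i (g t)"
    if "i < n" "g \<in> carrier ?G" "t \<in> tpow s n" for i g t
    using Aut_tpow_mult[OF f_carrier[OF that(1)] that(2,3)] Bij_into[of g "tpow s n" t] that
    by (simp add: Aut_tpow_carrier)
  \<comment> \<open>The relations only contain positive words, and such a word acts by composition of the operators.\<close>
  have ev_carrier: "word_value ?G ?f (map (\<lambda>i. (i, True)) ws) \<in> carrier ?G"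
    and ev: "t \<in> tpow s n \<Longrightarrow> word_value ?G ?f (map (\<lambda>i. (i, True)) ws) t = foldr f ws t"
    if "set ws \<subseteq> {..<n}" for ws t
  proof -
    have "word_value ?G ?f (map (\<lambda>i. (i, True)) ws) \<in> carrier ?G \<and>
        (\<forall>t\<in>tpow s n. word_value ?G ?f (map (\<lambda>i. (i, True)) ws) t = foldr f ws t)"
      using that
    proof (induction ws)
      case Nil
      have "\<one>\<^bsub>?G\<^esub> t = t" if "t \<in> tpow s n" for t
        using that by (simp add: Aut_tpow_def BijGroup_def)
      then show ?case by (simp add: word_value_simps)
    qed (simp add: word_value_simps f_carrier f_mult)
    then show "word_value ?G ?f (map (\<lambda>i. (i, True)) ws) \<in> carrier ?G"
      and "t \<in> tpow s n \<Longrightarrow> word_value ?G ?f (map (\<lambda>i. (i, True)) ws) t = foldr f ws t" by blast+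
  qed
  have eqI: "word_value ?G ?f (map (\<lambda>i. (i, True)) ws) = word_value ?G ?f (map (\<lambda>i. (i, True)) js)"
    if "set ws \<subseteq> {..<n}" "set js \<subseteq> {..<n}" "\<And>t. t \<in> tpow s n \<Longrightarrow> foldr f ws t = foldr f js t"
    for ws js
    using that by (intro Aut_tpow_eqI[OF ev_carrier ev_carrier]) (simp_all add: ev)
  have commute: "f i (f j t) = f j (f i t)" if "i + 1 < j" "j < n" "t \<in> tpow s n" for i j t
    using that cylinder_twist_braiding_commute[of j n t] braiding_commute[of i j n t]
    by (cases "i = 0") (simp_all add: f_def)
  have "word_value ?G ?f l = word_value ?G ?f r" if "(l, r) \<in> cyl_braid_relations n" for l r
  proof -
    from that consider
        i where "1 \<le> i" "i + 1 < n" "l = map (\<lambda>i. (i, True)) [i, i + 1, i]"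
          "r = map (\<lambda>i. (i, True)) [i + 1, i, i + 1]"
      | i j where "i < n" "j < n" "\<bar>int i - int j\<bar> > 1" "l = map (\<lambda>i. (i, True)) [i, j]"
          "r = map (\<lambda>i. (i, True)) [j, i]"
      | "1 < n" "l = map (\<lambda>i. (i, True)) [0, 1, 0, 1]" "r = map (\<lambda>i. (i, True)) [1, 0, 1, 0]"
      by (auto simp: cyl_braid_relations_def Let_def split: if_splits)
    then show ?thesis
    proof cases
      case 1
      show ?thesis unfolding 1(3,4)
        by (rule eqI) (use 1(1,2) braiding_braid[of i n] in \<open>simp_all add: f_def\<close>)
    next
      case 2
      then have "i + 1 < j \<or> j + 1 < i" by linarith
      then show ?thesis unfolding 2(4,5)
        by (intro eqI) (use 2(1,2) commute in auto)
    next
      case 3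
      show ?thesis unfolding 3(2,3)
        by (rule eqI) (use 3(1) cylinder_twist_braiding_reflection[of n] in \<open>simp_all add: f_def\<close>)
    qed
  qed
  then obtain \<mu> where \<mu>: "group_hom (presented_group {..<n} (cyl_braid_relations n)) ?G \<mu>"
      "\<And>i. i < n \<Longrightarrow> \<mu> (pres_rel {..<n} (cyl_braid_relations n) `` {[(i, True)]}) = ?f i"
    using G.presented_group_universal[of ?f "{..<n}" "cyl_braid_relations n"] f_carrier by blast
  show ?thesis
  proof (intro exI conjI ballI)
    show "group_hom (cyl_braid_group n) ?G \<mu>" unfolding cyl_braid_group_def by (fact \<mu>(1))
    show "\<mu> (cyl_braid_gen n 0) = restrict (cylinder_twist n) (tpow s n)"
      using \<mu>(2)[of 0] n by (simp add: cyl_braid_gen_def f_def)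
    show "\<mu> (cyl_braid_gen n i) = restrict (braiding n i) (tpow s n)" if "i \<in> {1..n - 1}" for i
      using \<mu>(2)[of i] that n by (auto simp: cyl_braid_gen_def f_def)
  qed
qed

end


theorem proposition2p4:
  fixes s :: "'f::field \<Rightarrow> 'h::ring_1 \<Rightarrow> 'h"
    and \<Delta> :: "'h \<Rightarrow> ('f, 'h) tensor" and \<epsilon> :: "'h \<Rightarrow> 'f"
    and R J :: "('f, 'h) tensor" and \<psi> :: "'h \<Rightarrow> 'h" and K :: 'h
  assumes "cylindrical_bialgebra s \<Delta> \<epsilon> R \<psi> J K"
  shows "(let R\<psi> = tmap s [emb s \<circ> \<psi>, emb s] R; R\<psi>\<psi> = tmap s [emb s \<circ> \<psi>, emb s \<circ> \<psi>] R in
      pure s [K, 1] \<cdot>\<^bsub>s\<^esub> flip s R\<psi> \<cdot>\<^bsub>s\<^esub> pure s [1, K] \<cdot>\<^bsub>s\<^esub> R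
      = flip s R\<psi>\<psi> \<cdot>\<^bsub>s\<^esub> pure s [1, K] \<cdot>\<^bsub>s\<^esub> R\<psi> \<cdot>\<^bsub>s\<^esub> pure s [K, 1]) \<and>
    (\<forall>B n. subalgebra s B \<longrightarrow> right_coideal s \<Delta> B \<longrightarrow> cylindrically_invariant \<psi> K B \<longrightarrow> 1 \<le> n \<longrightarrow>
      (\<exists>\<mu>. group_hom (cyl_braid_group n) (Aut_tpow s \<Delta> B n) \<mu> \<and>
        \<mu> (cyl_braid_gen n 0) = (\<lambda>t\<in>tpow s n.
          tmap s ((emb s \<circ> inv_into UNIV \<psi>) # replicate (n - 1) (emb s))
            (pure s (K # replicate (n - 1) 1) \<cdot>\<^bsub>s\<^esub> t)) \<and>
        (\<forall>i\<in>{1..n - 1}. \<mu> (cyl_braid_gen n i) = (\<lambda>t\<in>tpow s n.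
          tswap s n i (i + 1) (leg s n i (i + 1) R \<cdot>\<^bsub>s\<^esub> t)))))"
proof -
  interpret cylindrical_bialgebra s \<Delta> \<epsilon> R \<psi> J K by fact
  have "restrict (cylinder_twist n) (tpow s n) = (\<lambda>t\<in>tpow s n.
      tmap s ((emb s \<circ> inv_into UNIV \<psi>) # replicate (n - 1) (emb s))
        (pure s (K # replicate (n - 1) 1) \<cdot>\<^bsub>s\<^esub> t))"
    and "restrict (braiding n i) (tpow s n) = (\<lambda>t\<in>tpow s n.
      tswap s n i (i + 1) (leg s n i (i + 1) R \<cdot>\<^bsub>s\<^esub> t))" for n i
    by (rule ext, simp add: cylinder_twist_def braiding_def \<psi>'_def)+
  note restr = this
  show ?thesis
    unfolding Let_def restr[symmetric]
    using reflection_equation braid_group_action by simp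
qed

end
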